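(* Let $d\in\mathbb{N}$ and $S=\mathbb{R}^d\setminus\{0\}$. Assume that a sequence of point processes $\xi_n=\sum_{k=1}^\infty X_k\delta_{Z_k^n}$, $n\in\mathbb{N}$, on $(0,\infty)$ converges vaguely in distribution, as $n\to\infty$, to a simple point process $\xi$ on $(0,\infty)$ with finite intensity. Moreover, let $V$ be a random vector in $S$ with i.i.d. copies $(V_k)_{k\in\mathbb{N}}$ (independent of the point processes being uplifted) such that for every $f\in\widehat C_S$ and $\varepsilon>0$ there exists a compact set $K_{f,\varepsilon}\subseteq\mathbb{N}_0\times(0,\infty)$ with $$\limsup_{n\to\infty}\mathbf{E}\sum_{k:\,(X_k,Z_k^n)\in K_{f,\varepsilon}^c}X_k f(V_kZ_k^n)\le\varepsilon.$$ Then the uplifted processes $\xi_n^V$ converge vaguely in distribution to $\xi^V$ on $S$ as $n\to\infty$.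
   Context: $\mathbb{N}_0=\{0,1,2,\dots\}$; the $X_k$ are $\mathbb{N}_0$-valued and the $Z_k^n$ are $(0,\infty)$-valued random variables; $\delta_x$ is the Dirac measure at $x$. $\widehat C_S$ is the set of bounded non-negative continuous functions on $S$ with relatively compact support in $S$ (i.e. support bounded and bounded away from $0$). A point process is a random locally finite counting measure; it is simple if a.s. all its atoms have mass one; it has finite intensity if the expected mass of every relatively compact Borel set is finite. Vague convergence in distribution means convergence in distribution as random elements of the space of locally finite measures with the vague topology (generated by integration against bounded non-negative continuous functions with relatively compact support). Uplifting: for a point process $\zeta=\sum_{k=1}^\infty X_k\delta_{Z_k}$ on $(0,\infty)$ with finite intensity and a random vector $V$ in $S$ with i.i.d. copies $(V_k)_{k\in\mathbb{N}}$ independent of $\zeta$ (that is, of $(X_k,Z_k)_k$), the uplifted process is $\zeta^V=\sum_{k=1}^\infty X_k\delta_{V_kZ_k}$. Standing assumption: for every uplifted process $\zeta^V$ considered (here $\xi_n^V$, $n\in\mathbb{N}$, and $\xi^V$), $\mathbf{E}\sum_{k=1}^\infty X_k\mathbf{1}\{Z_k\|V_k\|\in[a,b]\}<\infty$ for all $0<a<b<\infty$, where $\|\cdot\|$ is the Euclidean norm. *)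

theory Defs
  imports "HOL-Probability.Probability"
begin

section \<open>Locally finite measures and the vague topology\<close>

abbreviation borel_on :: "'a::topological_space set \<Rightarrow> 'a measure" where
  "borel_on S \<equiv> restrict_space borel S"

definition relatively_compact_in :: "'a::topological_space set \<Rightarrow> 'a set \<Rightarrow> bool" where
  "relatively_compact_in S B \<longleftrightarrow> (\<exists>K. compact K \<and> K \<subseteq> S \<and> B \<subseteq> K)"

definition locally_finite_measures :: "'a::topological_space set \<Rightarrow> 'a measure set" where
  "locally_finite_measures S =
     {\<mu>. sets \<mu> = sets (borel_on S) \<and>
         (\<forall>B\<in>sets (borel_on S). relatively_compact_in S B \<longrightarrow> emeasure \<mu> B < \<infinity>)}"

text \<open>The bounded non-negative continuous functions on \<open>S\<close> with relatively compact support
  in \<open>S\<close>; the values outside \<open>S\<close> are irrelevant.\<close>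

definition C_hat :: "'a::topological_space set \<Rightarrow> ('a \<Rightarrow> real) set" where
  "C_hat S = {f. continuous_on S f \<and> bounded (f ` S) \<and> (\<forall>x\<in>S. 0 \<le> f x) \<and>
                 relatively_compact_in S {x\<in>S. f x \<noteq> 0}}"

definition vague_topology :: "'a::topological_space set \<Rightarrow> 'a measure topology" where
  "vague_topology S = topology_generated_by
     {{\<mu> \<in> locally_finite_measures S. (\<integral>x. f x \<partial>\<mu>) \<in> U} | f U. f \<in> C_hat S \<and> open U}"

lemma topspace_vague_topology: "topspace (vague_topology S) = locally_finite_measures S"
proof -
  have "(\<lambda>_. 0) \<in> C_hat S"
    by (auto simp: C_hat_def relatively_compact_in_def bounded_iff intro!: exI[of _ "{}"])
  then show ?thesis
    unfolding vague_topology_def topology_generated_by_topspace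
    by (fastforce intro!: exI[of _ "\<lambda>_. 0"] exI[of _ "UNIV :: real set"])
qed

lemma null_measure_locally_finite: "null_measure (borel_on S) \<in> locally_finite_measures S"
  by (simp add: locally_finite_measures_def)

section \<open>Convergence in distribution in a topological space\<close>

definition borel_of :: "'b topology \<Rightarrow> 'b measure" where
  "borel_of T = sigma (topspace T) {U. openin T U}"

definition converges_in_distribution ::
  "'b topology \<Rightarrow> 'w measure \<Rightarrow> (nat \<Rightarrow> 'w \<Rightarrow> 'b) \<Rightarrow> 'v measure \<Rightarrow> ('v \<Rightarrow> 'b) \<Rightarrow> bool" where
  "converges_in_distribution T M Y M' Y' \<longleftrightarrow>
     (\<forall>n. Y n \<in> M \<rightarrow>\<^sub>M borel_of T) \<and> Y' \<in> M' \<rightarrow>\<^sub>M borel_of T \<and>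
     (\<forall>h. continuous_map T euclideanreal h \<and> bounded (h ` topspace T) \<longrightarrow>
        (\<lambda>n. \<integral>\<omega>. h (Y n \<omega>) \<partial>M) \<longlonglongrightarrow> (\<integral>\<omega>. h (Y' \<omega>) \<partial>M'))"

section \<open>Point processes\<close>

text \<open>The measure \<open>\<Sum>k. x k \<cdot> \<delta>\<^bsub>z k\<^esub>\<close> on \<open>S\<close> is the image under \<open>z\<close> of the measure on the
  indices that gives mass \<open>x k\<close> to \<open>k\<close>.\<close>

definition atomic_measure ::
  "'a::topological_space set \<Rightarrow> (nat \<Rightarrow> nat) \<Rightarrow> (nat \<Rightarrow> 'a) \<Rightarrow> 'a measure" where
  "atomic_measure S x z = distr (density (count_space UNIV) (\<lambda>k. of_nat (x k))) (borel_on S) z"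

lemma emeasure_atomic_measure:
  assumes "\<And>k. z k \<in> S" and "A \<in> sets (borel_on S)"
  shows "emeasure (atomic_measure S x z) A = (\<Sum>k. of_nat (x k) * indicator A (z k))"
proof -
  have "z \<in> density (count_space UNIV) (\<lambda>k. of_nat (x k)) \<rightarrow>\<^sub>M borel_on S"
    using assms(1) by (simp add: measurable_def space_restrict_space)
  then show ?thesis
    using assms(2)
    by (simp add: atomic_measure_def emeasure_distr emeasure_density
        nn_integral_count_space_nat indicator_def)
qed

text \<open>The sums defining point processes are locally finite only almost surely in general. On the
  exceptional event the value is set to the zero measure, so that one has a genuine random element
  of the space of locally finite measures.\<close>

definition random_atomic_measure ::
  "'a::topological_space set \<Rightarrow> (nat \<Rightarrow> 'w \<Rightarrow> nat) \<Rightarrow> (nat \<Rightarrow> 'w \<Rightarrow> 'a) \<Rightarrow> 'w \<Rightarrow> 'a measure" where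
  "random_atomic_measure S X Z \<omega> =
     (let \<mu> = atomic_measure S (\<lambda>k. X k \<omega>) (\<lambda>k. Z k \<omega>)
      in if \<mu> \<in> locally_finite_measures S then \<mu> else null_measure (borel_on S))"

definition represents_point_process ::
  "'a::topological_space set \<Rightarrow> 'w measure \<Rightarrow> (nat \<Rightarrow> 'w \<Rightarrow> nat) \<Rightarrow> (nat \<Rightarrow> 'w \<Rightarrow> 'a) \<Rightarrow> bool" where
  "represents_point_process S M X Z \<longleftrightarrow>
     (\<forall>k. X k \<in> M \<rightarrow>\<^sub>M count_space UNIV) \<and> (\<forall>k. Z k \<in> M \<rightarrow>\<^sub>M borel_on S) \<and>
     (AE \<omega> in M. atomic_measure S (\<lambda>k. X k \<omega>) (\<lambda>k. Z k \<omega>) \<in> locally_finite_measures S)"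

definition finite_intensity ::
  "'a::topological_space set \<Rightarrow> 'w measure \<Rightarrow> ('w \<Rightarrow> 'a measure) \<Rightarrow> bool" where
  "finite_intensity S M \<xi> \<longleftrightarrow>
     (\<forall>B\<in>sets (borel_on S). relatively_compact_in S B \<longrightarrow> (\<integral>\<^sup>+\<omega>. emeasure (\<xi> \<omega>) B \<partial>M) < \<infinity>)"

definition simple_point_process ::
  "'a::topological_space set \<Rightarrow> 'w measure \<Rightarrow> ('w \<Rightarrow> 'a measure) \<Rightarrow> bool" where
  "simple_point_process S M \<xi> \<longleftrightarrow>
     (AE \<omega> in M. \<forall>x\<in>S. emeasure (\<xi> \<omega>) {x} \<noteq> 0 \<longrightarrow> emeasure (\<xi> \<omega>) {x} = 1)"

section \<open>Uplifting\<close>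

abbreviation punctured_space :: "(real ^ 'd) set" where
  "punctured_space \<equiv> UNIV - {0}"

text \<open>\<open>(V\<^sub>k)\<close> are i.i.d. with the law of the random vector \<open>V\<close> (defined on its own probability
  space \<open>N\<close>), and the whole sequence \<open>(V\<^sub>k)\<close> is independent of the whole sequence
  \<open>(X\<^sub>k, Z\<^sub>k)\<close>; the latter is stated as independence of the generated \<open>\<sigma>\<close>-algebras, because
  \<open>indep_var\<close> requires both variables to have the same value type.\<close>

definition independent_iid_copies ::
  "'v measure \<Rightarrow> ('v \<Rightarrow> real ^ 'd) \<Rightarrow> 'w measure \<Rightarrow> (nat \<Rightarrow> 'w \<Rightarrow> real ^ 'd) \<Rightarrow>
   (nat \<Rightarrow> 'w \<Rightarrow> nat) \<Rightarrow> (nat \<Rightarrow> 'w \<Rightarrow> real) \<Rightarrow> bool" where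
  "independent_iid_copies N V M Vs X Z \<longleftrightarrow>
     (\<forall>k. Vs k \<in> M \<rightarrow>\<^sub>M borel_on punctured_space) \<and>
     (\<forall>k. distr M (borel_on punctured_space) (Vs k) = distr N (borel_on punctured_space) V) \<and>
     prob_space.indep_vars M (\<lambda>_. borel_on punctured_space) Vs UNIV \<and>
     prob_space.indep_set M
       (sets (vimage_algebra (space M) (\<lambda>\<omega> k. (X k \<omega>, Z k \<omega>))
         (\<Pi>\<^sub>M k\<in>UNIV. count_space UNIV \<Otimes>\<^sub>M borel_on {0<..})))
       (sets (vimage_algebra (space M) (\<lambda>\<omega> k. Vs k \<omega>)
         (\<Pi>\<^sub>M k\<in>UNIV. borel_on punctured_space)))"

definition uplift ::
  "(nat \<Rightarrow> 'w \<Rightarrow> nat) \<Rightarrow> (nat \<Rightarrow> 'w \<Rightarrow> real) \<Rightarrow> (nat \<Rightarrow> 'w \<Rightarrow> real ^ 'd) \<Rightarrow> 'w \<Rightarrow> (real ^ 'd) measure" where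
  "uplift X Z Vs = random_atomic_measure punctured_space X (\<lambda>k \<omega>. Z k \<omega> *\<^sub>R Vs k \<omega>)"

definition finite_uplift_moments ::
  "'w measure \<Rightarrow> (nat \<Rightarrow> 'w \<Rightarrow> nat) \<Rightarrow> (nat \<Rightarrow> 'w \<Rightarrow> real) \<Rightarrow> (nat \<Rightarrow> 'w \<Rightarrow> real ^ 'd) \<Rightarrow> bool" where
  "finite_uplift_moments M X Z Vs \<longleftrightarrow>
     (\<forall>a b. 0 < a \<and> a < b \<longrightarrow>
        (\<integral>\<^sup>+\<omega>. (\<Sum>k. of_nat (X k \<omega>) * indicator {a..b} (Z k \<omega> * norm (Vs k \<omega>))) \<partial>M) < \<infinity>)"

end

theory Submission
  imports Defs
begin

text \<open>
  Convergence of the Laplace functionals \<open>E exp (- \<integral>f)\<close> of random locally finite measures, for all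
  test functions \<open>f\<close>, implies convergence in distribution for the vague topology
  (\<open>converges_in_distribution_from_laplace\<close>). The reason is that countably many test functions
  generate the vague topology, so that measures can be coded by points of the compact metric cube
  \<open>[0,1]\<^sup>\<nat>\<close> whose coordinates are values \<open>exp (- \<integral>f)\<close>. By the Stone-Weierstrass theorem,
  expectations of continuous functions of the code are limits of linear combinations of Laplace
  functionals, and every bounded vaguely continuous functional is an increasing limit of continuous
  functions of the code.

  For an uplifted process, averaging over the marks first turns the Laplace functional into
  \<open>E (\<Prod>k. E exp (- X\<^sub>k f(Z\<^sub>k V)))\<close>, where the inner expectation concerns \<open>V\<close> alone. A factor with \<open>X\<^sub>k = 1\<close>
  is \<open>exp (- g(Z\<^sub>k))\<close> for \<open>g z = - ln (E exp (- f(z V)))\<close>. If all weights were \<open>0\<close> or \<open>1\<close> and \<open>g\<close> were a test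
  function, this would be the Laplace functional of the original process at \<open>g\<close>, and the assumed
  convergence of the original processes would finish the proof. Both provisos hold approximately.

  The function \<open>g\<close> is continuous, but its support need not be compact. So \<open>f(z v)\<close> is first multiplied by a
  cutoff in \<open>z\<close>. The error is at most the expected contribution of the points outside a compact set,
  which the tail hypothesis makes small uniformly in large \<open>n\<close> (\<open>thinning_error\<close>).

  A weight \<open>X\<^sub>k \<ge> 2\<close> spoils the formula for the factor, because the \<open>X\<^sub>k\<close> coinciding points share one
  mark. But the limit process is simple, and therefore the probability that the \<open>n\<close>-th process has such a
  point in a given compact interval tends to \<open>0\<close> (\<open>multiple_points_vanish\<close>); the resulting error in the
  Laplace functional is at most this probability (\<open>thinned_laplace_estimate\<close>).
\<close>

section \<open>Test functions and the vague topology\<close>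

lemma compact_sets_borel_on:
  fixes K :: "'a::t2_space set"
  assumes "compact K" "K \<subseteq> S"
  shows "K \<in> sets (borel_on S)"
proof -
  have "K \<in> sets borel" using assms(1) by (simp add: borel_closed compact_imp_closed)
  moreover have "S \<inter> K = K" using assms(2) by blast
  ultimately show ?thesis by (metis image_eqI sets_restrict_space)
qed

lemma emeasure_compact_finite:
  fixes K :: "'a::t2_space set"
  assumes "\<mu> \<in> locally_finite_measures S" "compact K" "K \<subseteq> S"
  shows "emeasure \<mu> K < \<infinity>"
  using assms compact_sets_borel_on[OF assms(2,3)]
  by (auto simp: locally_finite_measures_def relatively_compact_in_def)

lemma C_hat_measurable:
  assumes "f \<in> C_hat S"
  shows "f \<in> borel_measurable (borel_on S)"
  using assms by (simp add: C_hat_def borel_measurable_continuous_on_restrict)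

lemma C_hat_nonneg: "f \<in> C_hat S \<Longrightarrow> x \<in> S \<Longrightarrow> 0 \<le> f x"
  by (simp add: C_hat_def)

lemma C_hat_support:
  assumes "f \<in> C_hat S"
  obtains K where "compact K" "K \<subseteq> S" "\<And>x. x \<in> S \<Longrightarrow> x \<notin> K \<Longrightarrow> f x = 0"
  using assms by (auto simp: C_hat_def relatively_compact_in_def)

lemma C_hat_bounded:
  assumes "f \<in> C_hat S"
  obtains B where "0 < B" "\<And>x. x \<in> S \<Longrightarrow> f x \<le> B"
proof -
  from assms have "bounded (f ` S)" by (simp add: C_hat_def)
  then obtain B where "0 < B" "\<forall>y\<in>f ` S. norm y \<le> B" by (auto simp: bounded_pos)
  then show ?thesis by (intro that[of B]) auto
qed

lemma C_hatI:
  fixes f :: "'a::t2_space \<Rightarrow> real"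
  assumes "continuous_on S f" "\<And>x. x \<in> S \<Longrightarrow> 0 \<le> f x"
    and "compact K" "K \<subseteq> S" "\<And>x. x \<in> S \<Longrightarrow> x \<notin> K \<Longrightarrow> f x = 0"
  shows "f \<in> C_hat S"
proof -
  have "compact (f ` K)"
    using assms(1,3,4) continuous_on_subset compact_continuous_image by blast
  then have "bounded (insert 0 (f ` K))"
    by (simp add: compact_imp_bounded)
  moreover have "f ` S \<subseteq> insert 0 (f ` K)" using assms(5) by auto
  ultimately have "bounded (f ` S)" by (rule bounded_subset)
  then show ?thesis
    using assms unfolding C_hat_def relatively_compact_in_def by blast
qed

lemma zero_in_C_hat: "(\<lambda>_. 0) \<in> C_hat S"
  by (auto simp: C_hat_def relatively_compact_in_def bounded_iff intro!: exI[of _ "{}"])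

lemma C_hat_add:
  fixes f g :: "'a::t2_space \<Rightarrow> real"
  assumes f: "f \<in> C_hat S" and g: "g \<in> C_hat S"
  shows "(\<lambda>x. f x + g x) \<in> C_hat S"
proof -
  obtain K where K: "compact K" "K \<subseteq> S" "\<And>x. x \<in> S \<Longrightarrow> x \<notin> K \<Longrightarrow> f x = 0"
    using C_hat_support[OF f] by metis
  obtain L where L: "compact L" "L \<subseteq> S" "\<And>x. x \<in> S \<Longrightarrow> x \<notin> L \<Longrightarrow> g x = 0"
    using C_hat_support[OF g] by metis
  have "continuous_on S f" "continuous_on S g" using f g by (auto simp: C_hat_def)
  then show ?thesis
    using K L C_hat_nonneg[OF f] C_hat_nonneg[OF g]
    by (intro C_hatI[of S _ "K \<union> L"]) (auto intro!: continuous_intros)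
qed

lemma space_locally_finite: "\<mu> \<in> locally_finite_measures S \<Longrightarrow> space \<mu> = S"
  by (metis (mono_tags, lifting) locally_finite_measures_def mem_Collect_eq sets_eq_imp_space_eq 
        space_borel space_restrict_space Int_UNIV_right)

lemma C_hat_integrable:
  fixes f :: "'a::t2_space \<Rightarrow> real"
  assumes \<mu>: "\<mu> \<in> locally_finite_measures S" and f: "f \<in> C_hat S"
  shows "integrable \<mu> f"
proof -
  obtain K where K: "compact K" "K \<subseteq> S" "\<And>x. x \<in> S \<Longrightarrow> x \<notin> K \<Longrightarrow> f x = 0"
    using C_hat_support[OF f] by metis
  obtain B where B: "\<And>x. x \<in> S \<Longrightarrow> f x \<le> B" using C_hat_bounded[OF f] by metis
  have sets: "sets \<mu> = sets (borel_on S)" using \<mu> by (simp add: locally_finite_measures_def)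
  have space: "space \<mu> = S" by (rule space_locally_finite[OF \<mu>])
  show ?thesis
  proof (rule integrableI_bounded_set[where A = K and B = B])
    show "K \<in> sets \<mu>" using compact_sets_borel_on[OF K(1,2)] sets by simp
    show "f \<in> borel_measurable \<mu>"
      using C_hat_measurable[OF f] measurable_cong_sets[OF sets refl] by blast
    show "emeasure \<mu> K < \<infinity>" using emeasure_compact_finite[OF \<mu> K(1,2)] .
  qed (use K B C_hat_nonneg[OF f] space in \<open>auto intro!: AE_I2\<close>)
qed

lemma integral_C_hat_nonneg:
  fixes f :: "'a::t2_space \<Rightarrow> real"
  assumes \<mu>: "\<mu> \<in> locally_finite_measures S" and f: "f \<in> C_hat S"
  shows "0 \<le> (\<integral>x. f x \<partial>\<mu>)"
  using C_hat_nonneg[OF f] space_locally_finite[OF \<mu>] by (intro integral_nonneg_AE AE_I2) auto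

text \<open>The maximum of \<open>0\<close> and of the cones with apex height \<open>q\<close>, slope \<open>m\<close> and centre \<open>c\<close>. Cones with
  rational data and centre in a countable dense set form a countable family, and by compactness
  finitely many of them suffice to approximate a test function from below.\<close>

fun tents :: "(real \<times> real \<times> 'a::metric_space) list \<Rightarrow> 'a \<Rightarrow> real" where
  "tents [] x = 0"
| "tents ((q, m, c) # ts) x = max (q - m * dist x c) (tents ts x)"

lemma continuous_on_tents: "continuous_on S (tents ts)"
proof (induction ts)
  case (Cons t ts)
  then show ?case by (cases t) (auto intro!: continuous_intros)
qed simp

lemma tents_le_iff:
  "tents ts x \<le> b \<longleftrightarrow> 0 \<le> b \<and> (\<forall>(q, m, c)\<in>set ts. q - m * dist x c \<le> b)"
  by (induction ts) auto

text \<open>Near a point \<open>x\<close> of the support, a narrow cone of height slightly less than \<open>f x\<close> stays below \<open>f\<close>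
  everywhere and is within \<open>\<epsilon>\<close> of \<open>f\<close> on a neighbourhood; the narrowness keeps it below \<open>f\<close> away
  from \<open>x\<close>. Finitely many such neighbourhoods cover the support. Being squeezed between \<open>0\<close> and
  \<open>f\<close>, the approximation inherits the compact support of \<open>f\<close>.\<close>

lemma tents_below:
  fixes f :: "'a::{metric_space, second_countable_topology} \<Rightarrow> real"
  assumes "open S" and f: "f \<in> C_hat S" and "0 < \<epsilon>"
    and dense: "\<And>U. open U \<Longrightarrow> U \<noteq> {} \<Longrightarrow> \<exists>c\<in>C. c \<in> U"
  shows "\<exists>ts\<in>lists (\<rat> \<times> \<nat> \<times> C). tents ts \<in> C_hat S \<and> (\<forall>x\<in>S. tents ts x \<le> f x \<and> f x \<le> tents ts x + \<epsilon>)"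
proof -
  obtain K where K: "compact K" "K \<subseteq> S" "\<And>x. x \<in> S \<Longrightarrow> x \<notin> K \<Longrightarrow> f x = 0"
    using C_hat_support[OF f] by metis
  have f0: "\<And>x. x \<in> S \<Longrightarrow> 0 \<le> f x" using C_hat_nonneg[OF f] .
  have contf: "continuous_on S f" using f by (simp add: C_hat_def)
  have local: "\<exists>t U. t \<in> \<rat> \<times> \<nat> \<times> C \<and> open U \<and> x \<in> U \<and>
      (\<forall>y\<in>S. tents [t] y \<le> f y) \<and> (\<forall>y\<in>U \<inter> S. f y \<le> tents [t] y + \<epsilon>)"
    if "x \<in> K" for x
  proof -
    have xS: "x \<in> S" using that K by blast
    obtain r1 where r1: "0 < r1" "\<And>y. y \<in> S \<Longrightarrow> dist y x < r1 \<Longrightarrow> dist (f y) (f x) < \<epsilon> / 4"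
      using contf xS \<open>0 < \<epsilon>\<close> unfolding continuous_on_iff
      by (metis zero_less_divide_iff zero_less_numeral)
    obtain r2 where r2: "0 < r2" "ball x r2 \<subseteq> S"
      using \<open>open S\<close> xS open_contains_ball by blast
    define r where "r = min r1 r2 / 2"
    have r: "0 < r" using r1 r2 by (simp add: r_def)
    have near: "y \<in> S \<and> \<bar>f y - f x\<bar> < \<epsilon> / 4" if "dist y x < 2 * r" for y
    proof -
      have "y \<in> S" using that r2 by (auto simp: r_def dist_commute subset_iff)
      then show ?thesis using r1(2)[of y] that by (auto simp: r_def dist_real_def)
    qed
    obtain q where q: "q \<in> \<rat>" "f x - \<epsilon> / 2 < q" "q < f x - \<epsilon> / 4"
      using Rats_dense_in_real[of "f x - \<epsilon> / 2" "f x - \<epsilon> / 4"] \<open>0 < \<epsilon>\<close> by auto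
    obtain m :: nat where m: "\<bar>q\<bar> / r < real m" "0 < m"
      by (metis reals_Archimedean2 gr0I of_nat_0 divide_nonneg_pos abs_ge_zero r not_le)
    \<comment> \<open>The slope \<open>m\<close> makes the cone vanish at distance \<open>r\<close> from its centre; moving centre and
      argument by at most \<open>s\<close> each costs at most \<open>\<epsilon> / 4\<close> in height.\<close>
    define s where "s = min (\<epsilon> / (8 * m)) r"
    have s: "0 < s" using \<open>0 < \<epsilon>\<close> m r by (simp add: s_def)
    obtain c where c: "c \<in> C" "dist x c < s"
      using dense[of "ball x s"] s by auto
    have low: "tents [(q, real m, c)] y \<le> f y" if "y \<in> S" for y
    proof (cases "dist y x < 2 * r")
      case True
      have "q - m * dist y c \<le> q" by simp
      also have "q \<le> f y" using near[OF True] q by linarith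
      finally show ?thesis using f0[OF that] by simp
    next
      case False
      have "dist y x \<le> dist y c + dist x c" by (metis dist_triangle dist_commute)
      then have "r \<le> dist y c" using c False by (simp add: s_def)
      have "q \<le> \<bar>q\<bar> / r * r" using r by simp
      also have "\<dots> \<le> m * dist y c" using m r \<open>r \<le> dist y c\<close> by (intro mult_mono) auto
      finally show ?thesis using f0[OF that] by simp
    qed
    have high: "f y \<le> tents [(q, real m, c)] y + \<epsilon>" if "y \<in> ball x s" for y
    proof -
      have "dist y c \<le> dist y x + dist x c" by (rule dist_triangle)
      then have "dist y c \<le> 2 * (\<epsilon> / (8 * m))" using c that by (auto simp: s_def dist_commute)
      then have "m * dist y c \<le> m * (2 * (\<epsilon> / (8 * m)))" by (intro mult_left_mono) auto
      also have "\<dots> = \<epsilon> / 4" using m by (simp add: field_simps)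
      finally have 1: "m * dist y c \<le> \<epsilon> / 4" .
      have "dist y x < 2 * r" using that r by (simp add: s_def dist_commute)
      then have "\<bar>f y - f x\<bar> < \<epsilon> / 4" using near by blast
      then have "f y \<le> (q - m * dist y c) + \<epsilon>" using 1 q by linarith
      then show ?thesis by simp
    qed
    show ?thesis
      by (rule exI[of _ "(q, real m, c)"], rule exI[of _ "ball x s"])
        (use q c s low high in auto)
  qed
  then obtain t U where tU: "\<And>x. x \<in> K \<Longrightarrow> t x \<in> \<rat> \<times> \<nat> \<times> C \<and> open (U x) \<and> x \<in> U x \<and>
      (\<forall>y\<in>S. tents [t x] y \<le> f y) \<and> (\<forall>y\<in>U x \<inter> S. f y \<le> tents [t x] y + \<epsilon>)"
    by metis
  obtain F where F: "F \<subseteq> K" "finite F" "K \<subseteq> (\<Union>x\<in>F. U x)"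
    using compactE_image[OF K(1), of K U] tU by blast
  obtain xs where xs: "set xs = F" using finite_list[OF F(2)] by blast
  define ts where "ts = map t xs"
  have "\<forall>x\<in>F. t x \<in> \<rat> \<times> \<nat> \<times> C" using tU F by blast
  then have ts: "ts \<in> lists (\<rat> \<times> \<nat> \<times> C)"
    by (auto simp: ts_def xs in_lists_conv_set simp del: mem_Sigma_iff)
  have le: "tents ts x \<le> f x" if "x \<in> S" for x
  proof -
    have "\<forall>y\<in>F. tents [t y] x \<le> f x" using tU F that by blast
    then show ?thesis using f0[OF that] unfolding tents_le_iff by (auto simp: ts_def xs split: prod.splits)
  qed
  have ge0: "0 \<le> tents ts x" for x using tents_le_iff[of ts x "tents ts x"] by blast
  have ge: "f x \<le> tents ts x + \<epsilon>" if "x \<in> S" for x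
  proof (cases "x \<in> K")
    case True
    then obtain y where y: "y \<in> F" "x \<in> U y" using F by blast
    have "f x \<le> tents [t y] x + \<epsilon>" using tU y F that by blast
    also have "tents [t y] x \<le> tents ts x"
    proof -
      have "\<forall>(q, m, c)\<in>set ts. q - m * dist x c \<le> tents ts x"
        using tents_le_iff[of ts x "tents ts x"] by blast
      moreover have "t y \<in> set ts" using y xs by (auto simp: ts_def)
      ultimately show ?thesis using ge0 unfolding tents_le_iff by auto
    qed
    finally show ?thesis by simp
  qed (use that K(3) ge0[of x] \<open>0 < \<epsilon>\<close> in auto)
  have "tents ts \<in> C_hat S"
    by (rule C_hatI[OF continuous_on_tents ge0 K(1,2)]) (metis K(3) ge0 le antisym)
  then show ?thesis using ts le ge by blast
qed

lemma C_hat_two_on_compact: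
  fixes K :: "'a::heine_borel set"
  assumes "open S" "compact K" "K \<subseteq> S"
  obtains f where "f \<in> C_hat S" "\<And>x. x \<in> K \<Longrightarrow> f x = 2"
proof (cases "K = {}")
  case True
  then show ?thesis using that[OF zero_in_C_hat] by blast
next
  case False
  obtain d where d: "0 < d" "\<And>x y. x \<in> K \<Longrightarrow> y \<in> - S \<Longrightarrow> d \<le> dist x y"
    using separate_compact_closed[of K "- S"] assms by (metis closed_Compl Compl_disjoint disjoint_eq_subset_Compl double_complement)
  let ?f = "\<lambda>x. max 0 (2 - (4 / d) * infdist x K)"
  let ?L = "{x. infdist x K \<le> d / 2}"
  have L: "compact ?L" using compact_infdist_le[OF False assms(2), of "d / 2"] d by simp
  have "?L \<subseteq> S"
  proof
    fix y assume "y \<in> ?L"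
    moreover obtain x where "x \<in> K" "infdist y K = dist y x"
      using infdist_attains_inf[of K y] assms(2) False compact_imp_closed by blast
    ultimately show "y \<in> S" using d(1) d(2)[of x y] by (fastforce simp: dist_commute)
  qed
  then have "?f \<in> C_hat S"
    using d by (intro C_hatI[OF _ _ L]) (auto intro!: continuous_intros simp: field_simps)
  then show ?thesis by (rule that) simp
qed

text \<open>The sequence \<open>g\<close> is dense among the test functions in the sense that matters for vague
  convergence: the error is \<open>\<epsilon>\<close> times one fixed member \<open>g i\<close>, so after integration it is at most
  \<open>\<epsilon> * \<integral>g i\<close>, which is finite for every locally finite measure. A uniform error without the
  factor \<open>g i\<close> would be useless, because the whole space may have infinite measure.\<close>

definition approximates_C_hat :: "'a::topological_space set \<Rightarrow> (nat \<Rightarrow> 'a \<Rightarrow> real) \<Rightarrow> bool" where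
  "approximates_C_hat S g \<longleftrightarrow> (\<forall>i. g i \<in> C_hat S) \<and>
     (\<forall>f\<in>C_hat S. \<exists>i. \<forall>\<epsilon>>0. \<exists>j. \<forall>x\<in>S. \<bar>f x - g j x\<bar> \<le> \<epsilon> * g i x)"

lemma approximates_C_hatD: "approximates_C_hat S g \<Longrightarrow> g i \<in> C_hat S"
  by (simp add: approximates_C_hat_def)

text \<open>The dominating function \<open>g i\<close> for \<open>f\<close> is a tent function that approximates, with error \<open>1\<close>, a
  test function equal to \<open>2\<close> on the support of \<open>f\<close>; so it is at least \<open>1\<close> there.\<close>

lemma ex_approximates_C_hat:
  fixes S :: "'a::{heine_borel, second_countable_topology} set"
  assumes "open S"
  obtains g where "approximates_C_hat S g"
proof -
  obtain C :: "'a set" where C: "countable C" "\<And>U. open U \<Longrightarrow> U \<noteq> {} \<Longrightarrow> \<exists>c\<in>C. c \<in> U"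
    using countable_dense_setE by blast
  define T :: "(real \<times> real \<times> 'a) list set" where
    "T = {ts \<in> lists (\<rat> \<times> \<nat> \<times> C). tents ts \<in> C_hat S}"
  have "countable (\<nat> :: real set)" by (simp add: Nats_def)
  then have "countable T"
    unfolding T_def using C(1) countable_rat by (intro countable_Collect countable_lists countable_SIGMA) auto
  moreover have "T \<noteq> {}" 
  proof -
    have "tents [] = (\<lambda>_::'a. 0)" by auto
    then have "[] \<in> T" using zero_in_C_hat[of S] by (auto simp: T_def)
    then show ?thesis by blast
  qed
  ultimately have rg: "range (from_nat_into T) = T" by (simp add: range_from_nat_into)
  show ?thesis
  proof (rule that[of "\<lambda>i. tents (from_nat_into T i)"], unfold approximates_C_hat_def, intro conjI allI ballI)
    show "tents (from_nat_into T i) \<in> C_hat S" for i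
      using rg by (auto simp: T_def)
    fix f assume f: "f \<in> C_hat S"
    obtain K where K: "compact K" "K \<subseteq> S" "\<And>x. x \<in> S \<Longrightarrow> x \<notin> K \<Longrightarrow> f x = 0"
      using C_hat_support[OF f] by metis
    obtain p where p: "p \<in> C_hat S" "\<And>x. x \<in> K \<Longrightarrow> p x = 2"
      using C_hat_two_on_compact[OF assms K(1,2)] by blast
    obtain us where us: "us \<in> T" "\<forall>x\<in>S. tents us x \<le> p x \<and> p x \<le> tents us x + 1"
      using tents_below[OF assms p(1) zero_less_one C(2)] unfolding T_def by blast
    then obtain i where i: "us = from_nat_into T i" using rg by blast
    have "\<exists>j. \<forall>x\<in>S. \<bar>f x - tents (from_nat_into T j) x\<bar> \<le> \<epsilon> * tents us x" if \<epsilon>: "0 < \<epsilon>" for \<epsilon>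
    proof -
      obtain ts where ts: "ts \<in> T" "\<forall>x\<in>S. tents ts x \<le> f x \<and> f x \<le> tents ts x + \<epsilon>"
        using tents_below[OF assms f \<epsilon> C(2)] unfolding T_def by blast
      then obtain j where j: "ts = from_nat_into T j" using rg by blast
      have "\<bar>f x - tents ts x\<bar> \<le> \<epsilon> * tents us x" if x: "x \<in> S" for x
      proof (cases "x \<in> K")
        case True
        then have "\<epsilon> * 1 \<le> \<epsilon> * tents us x" using us p(2)[of x] x \<open>0 < \<epsilon>\<close> by (intro mult_left_mono) force+
        then show ?thesis using ts(2) x by force
      next
        case False
        have "0 \<le> tents ts x" "0 \<le> tents us x" using tents_le_iff by blast+
        then show ?thesis using ts(2) x K(3)[OF x False] \<open>0 < \<epsilon>\<close> by force
      qed
      then show ?thesis using j by blast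
    qed
    then show "\<exists>i. \<forall>\<epsilon>>0. \<exists>j. \<forall>x\<in>S. \<bar>f x - tents (from_nat_into T j) x\<bar> \<le> \<epsilon> * tents (from_nat_into T i) x"
      using i by blast
  qed
qed

text \<open>The code of \<open>\<mu>\<close> is the point of the compact cube \<open>[0,1]\<^sup>\<nat>\<close> with coordinates
  \<open>exp (- \<integral>g i d\<mu>)\<close>. The exponential makes the range bounded and turns sums of test functions into
  products of coordinates.\<close>

definition integral_code :: "(nat \<Rightarrow> 'a \<Rightarrow> real) \<Rightarrow> 'a measure \<Rightarrow> nat \<Rightarrow> real" where
  "integral_code g \<mu> = (\<lambda>i. exp (- (\<integral>x. g i x \<partial>\<mu>)))"

text \<open>The countably many functions \<open>g i\<close> already generate the vague topology: if \<open>\<integral>g i\<close> stays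
  bounded and \<open>\<integral>g j\<close> moves little, then \<open>\<integral>f\<close> moves little as well. Hence the vague topology is
  the one induced by the code, which takes values in a compact metric space.\<close>

lemma vague_open_imp_code_preimage:
  fixes S :: "'a::t2_space set"
  assumes approx: "approximates_C_hat S g"
    and U: "openin (vague_topology S) U"
  shows "\<exists>G. open G \<and> U = {\<mu> \<in> locally_finite_measures S. integral_code g \<mu> \<in> G}"
proof -
  have g: "g i \<in> C_hat S" for i using approximates_C_hatD[OF approx] .
  let ?L = "locally_finite_measures S"
  let ?pre = "\<lambda>G. {\<mu> \<in> ?L. integral_code g \<mu> \<in> G}"
  have basic: "\<exists>G. open G \<and> {\<mu> \<in> ?L. (\<integral>x. f x \<partial>\<mu>) \<in> O'} = ?pre G"
    if f: "f \<in> C_hat S" and O': "open O'" for f O'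
  proof -
    let ?B = "{\<mu> \<in> ?L. (\<integral>x. f x \<partial>\<mu>) \<in> O'}"
    have nbhd: "\<exists>G. open G \<and> integral_code g \<nu> \<in> G \<and> ?pre G \<subseteq> ?B" if \<nu>: "\<nu> \<in> ?B" for \<nu>
    proof -
      have \<nu>L: "\<nu> \<in> ?L" using \<nu> by simp
      obtain \<delta> where \<delta>: "0 < \<delta>" "\<And>t. \<bar>t - (\<integral>x. f x \<partial>\<nu>)\<bar> < \<delta> \<Longrightarrow> t \<in> O'"
        using O' \<nu> unfolding open_dist by (auto simp: dist_real_def)
      obtain i where i: "\<And>\<epsilon>. 0 < \<epsilon> \<Longrightarrow> \<exists>j. \<forall>x\<in>S. \<bar>f x - g j x\<bar> \<le> \<epsilon> * g i x"
        using approx f unfolding approximates_C_hat_def by blast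
      define a where "a = (\<integral>x. g i x \<partial>\<nu>) + 1"
      have a: "0 < a" using integral_C_hat_nonneg[OF \<nu>L g[of i]] by (simp add: a_def)
      define \<epsilon> where "\<epsilon> = \<delta> / (3 * a)"
      have \<epsilon>: "0 < \<epsilon>" using \<delta> a by (simp add: \<epsilon>_def)
      obtain j where j: "\<And>x. x \<in> S \<Longrightarrow> \<bar>f x - g j x\<bar> \<le> \<epsilon> * g i x" using i[OF \<epsilon>] by blast
      define b where "b = (\<integral>x. g j x \<partial>\<nu>)"
      have close: "\<bar>(\<integral>x. f x \<partial>\<mu>) - (\<integral>x. g j x \<partial>\<mu>)\<bar> \<le> \<delta> / 3"
        if \<mu>: "\<mu> \<in> ?L" and small: "(\<integral>x. g i x \<partial>\<mu>) < a" for \<mu>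
      proof -
        note int = C_hat_integrable[OF \<mu>]
        have "\<bar>(\<integral>x. f x \<partial>\<mu>) - (\<integral>x. g j x \<partial>\<mu>)\<bar> = \<bar>\<integral>x. f x - g j x \<partial>\<mu>\<bar>"
          using int[OF f] int[OF g] by simp
        also have "\<dots> \<le> (\<integral>x. \<bar>f x - g j x\<bar> \<partial>\<mu>)" by (rule integral_abs_bound)
        also have "\<dots> \<le> (\<integral>x. \<epsilon> * g i x \<partial>\<mu>)"
          using int[OF f] int[OF g] j space_locally_finite[OF \<mu>] by (intro integral_mono) auto
        also have "\<dots> \<le> \<epsilon> * a" using small \<epsilon> by simp
        also have "\<dots> = \<delta> / 3" using a by (simp add: \<epsilon>_def)
        finally show ?thesis .
      qed
      let ?G = "{y :: nat \<Rightarrow> real. exp (- a) < y i} \<inter>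
        ({y. exp (- (b + \<delta> / 3)) < y j} \<inter> {y. y j < exp (- (b - \<delta> / 3))})"
      have "open ?G" by (intro open_Int open_Collect_less) (auto intro!: continuous_intros)
      moreover have "integral_code g \<nu> \<in> ?G" using \<delta> by (simp add: integral_code_def a_def b_def)
      moreover have "?pre ?G \<subseteq> ?B"
      proof
        fix \<mu> assume \<mu>: "\<mu> \<in> ?pre ?G"
        then have "(\<integral>x. g i x \<partial>\<mu>) < a"
          and "- (b + \<delta> / 3) < - (\<integral>x. g j x \<partial>\<mu>)" "- (\<integral>x. g j x \<partial>\<mu>) < - (b - \<delta> / 3)"
          by (auto simp: integral_code_def)
        then have "(\<integral>x. g i x \<partial>\<mu>) < a" "\<bar>(\<integral>x. g j x \<partial>\<mu>) - b\<bar> < \<delta> / 3" by linarith+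
        moreover have "\<bar>(\<integral>x. f x \<partial>\<nu>) - b\<bar> \<le> \<delta> / 3"
          using close[OF \<nu>L] by (simp add: a_def b_def)
        moreover have "\<bar>(\<integral>x. f x \<partial>\<mu>) - (\<integral>x. g j x \<partial>\<mu>)\<bar> \<le> \<delta> / 3"
          using close[of \<mu>] \<mu> \<open>(\<integral>x. g i x \<partial>\<mu>) < a\<close> by blast
        ultimately have "\<bar>(\<integral>x. f x \<partial>\<mu>) - (\<integral>x. f x \<partial>\<nu>)\<bar> < \<delta>" by linarith
        then show "\<mu> \<in> ?B" using \<delta>(2) \<mu> by blast
      qed
      ultimately show ?thesis by blast
    qed
    show ?thesis
    proof (intro exI[of _ "\<Union>{G. open G \<and> ?pre G \<subseteq> ?B}"] conjI)
      show "?B = ?pre (\<Union>{G. open G \<and> ?pre G \<subseteq> ?B})"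
        using nbhd by blast
    qed auto
  qed
  have "generate_topology_on {{\<mu> \<in> ?L. (\<integral>x. f x \<partial>\<mu>) \<in> O'} | f O'. f \<in> C_hat S \<and> open O'} U"
    using U unfolding vague_topology_def openin_topology_generated_by_iff .
  then show ?thesis
  proof induction
    case Empty
    show ?case by (rule exI[of _ "{}"]) auto
  next
    case (Int A B)
    then obtain G H where "open G" "A = ?pre G" "open H" "B = ?pre H" by blast
    then show ?case by (intro exI[of _ "G \<inter> H"]) auto
  next
    case (UN \<K>)
    then obtain G where "\<And>k. k \<in> \<K> \<Longrightarrow> open (G k) \<and> k = ?pre (G k)" by metis
    then show ?case by (intro exI[of _ "\<Union>k\<in>\<K>. G k"]) blast
  next
    case (Basis B)
    then show ?case using basic by auto
  qed
qed

section \<open>Convergence in distribution from Laplace functionals\<close>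

text \<open>Polynomials in the coordinates of \<open>nat \<Rightarrow> real\<close>. Multiplication only by a single coordinate makes
  the rule induction match the computation of expectations below; closure under products is derived.\<close>

inductive_set coord_polys :: "((nat \<Rightarrow> real) \<Rightarrow> real) set" where
  const: "(\<lambda>_. c) \<in> coord_polys"
| add: "F \<in> coord_polys \<Longrightarrow> G \<in> coord_polys \<Longrightarrow> (\<lambda>y. F y + G y) \<in> coord_polys"
| mult_coord: "F \<in> coord_polys \<Longrightarrow> (\<lambda>y. F y * y i) \<in> coord_polys"

lemma coord_polys_mult:
  assumes "F \<in> coord_polys" "G \<in> coord_polys"
  shows "(\<lambda>y. F y * G y) \<in> coord_polys"
  using assms(2,1)
proof (induction arbitrary: F)
  case (const c)
  then show ?case
  proof induction
    case (const d)
    then show ?case using coord_polys.const[of "d * c"] by simp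
  next
    case (add F G)
    then show ?case using coord_polys.add by (simp add: distrib_right)
  next
    case (mult_coord F i)
    then show ?case using coord_polys.mult_coord[OF mult_coord.IH, of i] by (simp add: mult_ac)
  qed
next
  case (add G H)
  then show ?case
    using coord_polys.add[OF add.IH(1)[OF add.prems] add.IH(2)[OF add.prems]] by (simp add: distrib_left)
next
  case (mult_coord G i)
  then show ?case
    using coord_polys.mult_coord[OF mult_coord.IH[OF mult_coord.prems], of i] by (simp add: mult_ac)
qed

lemma continuous_on_coord_poly: "F \<in> coord_polys \<Longrightarrow> continuous_on A F"
proof (induction rule: coord_polys.induct)
  case (mult_coord F i)
  then show ?case
    by (intro continuous_on_mult continuous_on_subset[OF continuous_on_product_coordinates]) auto
qed (auto intro: continuous_intros)

definition unit_cube :: "(nat \<Rightarrow> real) set" where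
  "unit_cube = (\<Pi>\<^sub>E i\<in>UNIV. {0..1})"

lemma compact_unit_cube: "compact unit_cube"
  unfolding unit_cube_def 
  by (metis compact_Icc compactin_PiE compactin_euclidean_iff euclidean_product_topology)

lemma coord_polys_dense:
  fixes F :: "(nat \<Rightarrow> real) \<Rightarrow> real"
  assumes "continuous_on unit_cube F" "0 < \<epsilon>"
  shows "\<exists>G\<in>coord_polys. \<forall>y\<in>unit_cube. \<bar>F y - G y\<bar> < \<epsilon>"
proof -
  interpret function_ring_on coord_polys unit_cube
  proof
    fix x y :: "nat \<Rightarrow> real" assume "x \<noteq> y"
    then obtain i where "x i \<noteq> y i" by blast
    moreover have "(\<lambda>y. 1 * y i) \<in> coord_polys" by (intro coord_polys.intros)
    ultimately show "\<exists>f\<in>coord_polys. f x \<noteq> f y" by (intro bexI[of _ "\<lambda>y. 1 * y i"]) auto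
  qed (auto intro: compact_unit_cube continuous_on_coord_poly coord_polys_mult coord_polys.intros)
  show ?thesis using Stone_Weierstrass_basic[OF assms] by blast
qed

lemma integral_code_in_unit_cube:
  fixes S :: "'a::t2_space set"
  assumes "\<And>i. g i \<in> C_hat S" "\<mu> \<in> locally_finite_measures S"
  shows "integral_code g \<mu> \<in> unit_cube"
  using integral_C_hat_nonneg[OF assms(2,1)] by (auto simp: unit_cube_def integral_code_def)

text \<open>A random locally finite measure, with measurability required only for the integrals of test
  functions. Measurability for the vague Borel sets follows (\<open>measurable_vague\<close>), because the vague
  topology on an open set \<open>S\<close> is induced by a countable family of such integrals.\<close>

locale random_lf_measure = prob_space M for M :: "'w measure" +
  fixes S :: "'a::{heine_borel, second_countable_topology} set" and Y :: "'w \<Rightarrow> 'a measure"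
  assumes locally_finite: "\<omega> \<in> space M \<Longrightarrow> Y \<omega> \<in> locally_finite_measures S"
    and integral_measurable: "f \<in> C_hat S \<Longrightarrow> (\<lambda>\<omega>. \<integral>x. f x \<partial>Y \<omega>) \<in> borel_measurable M"
begin

lemma code_in_unit_cube:
  assumes "\<And>i. g i \<in> C_hat S" "\<omega> \<in> space M"
  shows "integral_code g (Y \<omega>) \<in> unit_cube"
  using integral_code_in_unit_cube[OF assms(1) locally_finite[OF assms(2)]] .

lemma code_measurable:
  assumes "\<And>i. g i \<in> C_hat S"
  shows "(\<lambda>\<omega>. integral_code g (Y \<omega>)) \<in> borel_measurable M"
  using integral_measurable[OF assms] unfolding integral_code_def
  by (intro measurable_coordinatewise_then_product) simp

lemma integrable_code_times_exp:
  fixes H :: "(nat \<Rightarrow> real) \<Rightarrow> real"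
  assumes g: "\<And>i. g i \<in> C_hat S" and H: "continuous_on unit_cube H" and f: "f \<in> C_hat S"
  shows "integrable M (\<lambda>\<omega>. H (integral_code g (Y \<omega>)) * exp (- (\<integral>x. f x \<partial>Y \<omega>)))"
proof -
  have cm: "(\<lambda>\<omega>. integral_code g (Y \<omega>)) \<in> M \<rightarrow>\<^sub>M borel_on unit_cube"
    using code_measurable[of g] g code_in_unit_cube[of g] by (intro measurable_restrict_space2) auto
  obtain B where B: "\<forall>y\<in>unit_cube. norm (H y) \<le> B"
    using compact_continuous_image[OF H compact_unit_cube, THEN compact_imp_bounded] by (auto simp: bounded_iff)
  show ?thesis
  proof (rule integrable_const_bound[where B = B])
    show "AE \<omega> in M. norm (H (integral_code g (Y \<omega>)) * exp (- (\<integral>x. f x \<partial>Y \<omega>))) \<le> B"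
    proof (rule AE_I2)
      fix \<omega> assume \<omega>: "\<omega> \<in> space M"
      have "norm (H (integral_code g (Y \<omega>))) * exp (- (\<integral>x. f x \<partial>Y \<omega>)) \<le> B * 1"
        using B code_in_unit_cube[of g, OF g \<omega>] integral_C_hat_nonneg[OF locally_finite[OF \<omega>] f]
        by (intro mult_mono) force+
      then show "norm (H (integral_code g (Y \<omega>)) * exp (- (\<integral>x. f x \<partial>Y \<omega>))) \<le> B"
        by (simp add: abs_mult)
    qed
    show "(\<lambda>\<omega>. H (integral_code g (Y \<omega>)) * exp (- (\<integral>x. f x \<partial>Y \<omega>))) \<in> borel_measurable M"
      using measurable_compose[OF cm borel_measurable_continuous_on_restrict[OF H]]
        integral_measurable[OF f] by simp
  qed
qed

lemma integrable_code:
  fixes H :: "(nat \<Rightarrow> real) \<Rightarrow> real"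
  assumes "\<And>i. g i \<in> C_hat S" "continuous_on unit_cube H"
  shows "integrable M (\<lambda>\<omega>. H (integral_code g (Y \<omega>)))"
  using integrable_code_times_exp[of g, OF assms(1) assms(2) zero_in_C_hat] by simp

lemma expectation_code_close:
  fixes F H :: "(nat \<Rightarrow> real) \<Rightarrow> real"
  assumes g: "\<And>i. g i \<in> C_hat S" and "continuous_on unit_cube F" "continuous_on unit_cube H"
    and close: "\<And>y. y \<in> unit_cube \<Longrightarrow> \<bar>F y - H y\<bar> < e"
  shows "\<bar>(\<integral>\<omega>. F (integral_code g (Y \<omega>)) \<partial>M) - (\<integral>\<omega>. H (integral_code g (Y \<omega>)) \<partial>M)\<bar> \<le> e"
proof -
  note int = integrable_code[of g, OF g assms(2)] integrable_code[of g, OF g assms(3)]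
  have "\<bar>(\<integral>\<omega>. F (integral_code g (Y \<omega>)) \<partial>M) - (\<integral>\<omega>. H (integral_code g (Y \<omega>)) \<partial>M)\<bar>
      \<le> (\<integral>\<omega>. \<bar>F (integral_code g (Y \<omega>)) - H (integral_code g (Y \<omega>))\<bar> \<partial>M)"
    using integral_abs_bound[of M "\<lambda>\<omega>. F (integral_code g (Y \<omega>)) - H (integral_code g (Y \<omega>))"] int by simp
  also have "\<dots> \<le> (\<integral>\<omega>. e \<partial>M)"
    using int close code_in_unit_cube[of g, OF g] by (intro integral_mono) (auto intro: less_imp_le)
  finally show ?thesis by (simp add: prob_space)
qed

end

text \<open>The expectation of a coordinate polynomial of the code is a linear combination of Laplace
  functionals, since a product of coordinates is \<open>exp (- \<integral>f)\<close> for a sum \<open>f\<close> of test functions.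
  The induction carries an extra factor \<open>exp (- \<integral>f)\<close>, so that multiplying by a coordinate only
  changes \<open>f\<close>. The Stone-Weierstrass theorem then gives all continuous functions on the cube.\<close>

lemma expectation_code_tendsto:
  fixes M :: "'w measure" and M' :: "'v measure"
  assumes Y: "\<And>n. random_lf_measure M S (Y n)" and Y': "random_lf_measure M' S Y'"
    and laplace: "\<And>f. f \<in> C_hat S \<Longrightarrow> (\<lambda>n. \<integral>\<omega>. exp (- (\<integral>x. f x \<partial>Y n \<omega>)) \<partial>M)
                     \<longlonglongrightarrow> (\<integral>\<omega>. exp (- (\<integral>x. f x \<partial>Y' \<omega>)) \<partial>M')"
    and g: "\<And>i. g i \<in> C_hat S"
    and F: "continuous_on unit_cube (F :: (nat \<Rightarrow> real) \<Rightarrow> real)"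
  shows "(\<lambda>n. \<integral>\<omega>. F (integral_code g (Y n \<omega>)) \<partial>M) \<longlonglongrightarrow> (\<integral>\<omega>. F (integral_code g (Y' \<omega>)) \<partial>M')"
proof -
  interpret Y: random_lf_measure M S "Y n" for n by (rule Y)
  interpret Y': random_lf_measure M' S Y' by (rule Y')
  have poly: "(\<lambda>n. \<integral>\<omega>. H (integral_code g (Y n \<omega>)) * exp (- (\<integral>x. f x \<partial>Y n \<omega>)) \<partial>M) \<longlonglongrightarrow>
      (\<integral>\<omega>. H (integral_code g (Y' \<omega>)) * exp (- (\<integral>x. f x \<partial>Y' \<omega>)) \<partial>M')"
    if "H \<in> coord_polys" "f \<in> C_hat S" for H f
    using that
  proof (induction arbitrary: f)
    case (const c)
    then show ?case using tendsto_mult_left[OF laplace, of f c] by simp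
  next
    case (add H1 H2)
    note c = add.hyps[THEN continuous_on_coord_poly]
    show ?case
      using tendsto_add[OF add.IH(1)[OF add.prems] add.IH(2)[OF add.prems]]
        Y.integrable_code_times_exp[of g, OF g c(1) add.prems] Y.integrable_code_times_exp[of g, OF g c(2) add.prems]
        Y'.integrable_code_times_exp[of g, OF g c(1) add.prems] Y'.integrable_code_times_exp[of g, OF g c(2) add.prems]
      by (simp add: distrib_right)
  next
    case (mult_coord H i)
    let ?f = "\<lambda>x. f x + g i x"
    have eq: "H (integral_code g \<mu>) * integral_code g \<mu> i * exp (- (\<integral>x. f x \<partial>\<mu>)) =
        H (integral_code g \<mu>) * exp (- (\<integral>x. ?f x \<partial>\<mu>))" if \<mu>: "\<mu> \<in> locally_finite_measures S" for \<mu>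
      using C_hat_integrable[OF \<mu> g[of i]] C_hat_integrable[OF \<mu> mult_coord.prems]
      by (simp add: integral_code_def exp_add[symmetric] algebra_simps)
    have "?f \<in> C_hat S" by (rule C_hat_add[OF mult_coord.prems g])
    from mult_coord.IH[OF this] show ?case
      using Y.locally_finite Y'.locally_finite by (simp add: eq cong: Bochner_Integration.integral_cong)
  qed
  have poly0: "(\<lambda>n. \<integral>\<omega>. H (integral_code g (Y n \<omega>)) \<partial>M) \<longlonglongrightarrow> (\<integral>\<omega>. H (integral_code g (Y' \<omega>)) \<partial>M')"
    if "H \<in> coord_polys" for H using poly[OF that zero_in_C_hat] by simp
  show ?thesis
  proof (rule LIMSEQ_I)
    fix e :: real assume e: "0 < e"
    obtain H where H: "H \<in> coord_polys" "\<forall>y\<in>unit_cube. \<bar>F y - H y\<bar> < e / 3"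
      using coord_polys_dense[OF F, of "e / 3"] e by auto
    note cH = continuous_on_coord_poly[OF H(1), of unit_cube]
    obtain N where N: "\<And>n. n \<ge> N \<Longrightarrow>
        norm ((\<integral>\<omega>. H (integral_code g (Y n \<omega>)) \<partial>M) - (\<integral>\<omega>. H (integral_code g (Y' \<omega>)) \<partial>M')) < e / 3"
      using LIMSEQ_D[OF poly0[OF H(1)], of "e / 3"] e by auto
    show "\<exists>N. \<forall>n\<ge>N. norm ((\<integral>\<omega>. F (integral_code g (Y n \<omega>)) \<partial>M) - (\<integral>\<omega>. F (integral_code g (Y' \<omega>)) \<partial>M')) < e"
    proof (intro exI[of _ N] allI impI)
      fix n assume "n \<ge> N"
      show "norm ((\<integral>\<omega>. F (integral_code g (Y n \<omega>)) \<partial>M) - (\<integral>\<omega>. F (integral_code g (Y' \<omega>)) \<partial>M')) < e"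
        using N[OF \<open>n \<ge> N\<close>] Y.expectation_code_close[of g F H "e / 3" n, OF g F cH H(2)[rule_format]]
          Y'.expectation_code_close[of g F H "e / 3", OF g F cH H(2)[rule_format]] unfolding real_norm_def by linarith
    qed
  qed
qed

text \<open>For bounded \<open>h\<close> and \<open>c \<ge> 0\<close>, the largest function that is Lipschitz with constant \<open>c\<close> and whose
  value at the code of \<open>\<mu>\<close> is at most \<open>h \<mu>\<close>. A vaguely continuous \<open>h\<close> need not extend continuously to the closure of
  the set of codes, but it is the increasing limit of these minorants, which are defined on the
  whole cube.\<close>

definition lipschitz_minorant ::
  "(nat \<Rightarrow> 'a \<Rightarrow> real) \<Rightarrow> 'a::t2_space set \<Rightarrow> ('a measure \<Rightarrow> real) \<Rightarrow> real \<Rightarrow> (nat \<Rightarrow> real) \<Rightarrow> real" where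
  "lipschitz_minorant g S h c y = (INF \<mu>\<in>locally_finite_measures S. h \<mu> + c * dist y (integral_code g \<mu>))"

context
  fixes S :: "'a::t2_space set" and g :: "nat \<Rightarrow> 'a \<Rightarrow> real" and h :: "'a measure \<Rightarrow> real" and B :: real
  assumes h: "\<And>\<mu>. \<mu> \<in> locally_finite_measures S \<Longrightarrow> \<bar>h \<mu>\<bar> \<le> B"
begin

lemma locally_finite_nonempty: "locally_finite_measures S \<noteq> {}"
  using null_measure_locally_finite by blast

lemma minorant_bdd_below:
  assumes "0 \<le> c"
  shows "bdd_below ((\<lambda>\<mu>. h \<mu> + c * dist y (integral_code g \<mu>)) ` locally_finite_measures S)"
proof (rule bdd_belowI2)
  fix \<mu> assume "\<mu> \<in> locally_finite_measures S"
  then show "- B \<le> h \<mu> + c * dist y (integral_code g \<mu>)"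
    using h[of \<mu>] mult_nonneg_nonneg[OF assms zero_le_dist] by (smt (verit))
qed

lemma minorant_le:
  assumes "0 \<le> c" "\<mu> \<in> locally_finite_measures S"
  shows "lipschitz_minorant g S h c (integral_code g \<mu>) \<le> h \<mu>"
  using cINF_lower[OF minorant_bdd_below[OF assms(1)] assms(2), of "integral_code g \<mu>"]
  by (simp add: lipschitz_minorant_def)

lemma minorant_ge:
  assumes "0 \<le> c"
  shows "- B \<le> lipschitz_minorant g S h c y"
  unfolding lipschitz_minorant_def
proof (rule cINF_greatest[OF locally_finite_nonempty])
  fix \<mu> assume "\<mu> \<in> locally_finite_measures S"
  then show "- B \<le> h \<mu> + c * dist y (integral_code g \<mu>)"
    using h[of \<mu>] mult_nonneg_nonneg[OF assms zero_le_dist] by (smt (verit))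
qed

lemma minorant_lipschitz:
  assumes "0 \<le> c"
  shows "lipschitz_minorant g S h c x \<le> lipschitz_minorant g S h c y + c * dist x y"
proof -
  have "lipschitz_minorant g S h c x - c * dist x y \<le> lipschitz_minorant g S h c y"
    unfolding lipschitz_minorant_def[of g S h c y]
  proof (rule cINF_greatest[OF locally_finite_nonempty])
    fix \<mu> assume \<mu>: "\<mu> \<in> locally_finite_measures S"
    have "lipschitz_minorant g S h c x \<le> h \<mu> + c * dist x (integral_code g \<mu>)"
      unfolding lipschitz_minorant_def by (rule cINF_lower[OF minorant_bdd_below[OF assms] \<mu>])
    also have "\<dots> \<le> h \<mu> + c * (dist x y + dist y (integral_code g \<mu>))"
      using assms by (intro add_left_mono mult_left_mono dist_triangle)
    finally show "lipschitz_minorant g S h c x - c * dist x y \<le> h \<mu> + c * dist y (integral_code g \<mu>)"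
      by (simp add: algebra_simps)
  qed
  then show ?thesis by simp
qed

lemma continuous_on_minorant:
  assumes "0 \<le> c"
  shows "continuous_on A (lipschitz_minorant g S h c)"
proof -
  have "\<bar>lipschitz_minorant g S h c x - lipschitz_minorant g S h c y\<bar> \<le> c * dist x y" for x y
    using minorant_lipschitz[OF assms, of x y] minorant_lipschitz[OF assms, of y x]
    by (simp add: dist_commute abs_le_iff)
  then have "c-lipschitz_on A (lipschitz_minorant g S h c)"
    using assms by (auto intro!: lipschitz_onI simp: dist_real_def)
  then show ?thesis by (rule lipschitz_on_continuous_on)
qed

lemma minorant_tendsto:
  assumes approx: "approximates_C_hat S g"
    and cont: "continuous_map (vague_topology S) euclideanreal h"
    and \<mu>: "\<mu> \<in> locally_finite_measures S"
  shows "(\<lambda>k. lipschitz_minorant g S h (real k) (integral_code g \<mu>)) \<longlonglongrightarrow> h \<mu>"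
proof (rule LIMSEQ_I)
  fix e :: real assume e: "0 < e"
  \<comment> \<open>Measures with code near that of \<open>\<mu>\<close> have \<open>h \<nu> > h \<mu> - e / 2\<close> by continuity; for the others
    the penalty \<open>k * dist\<close> exceeds the oscillation \<open>2 * B\<close> of \<open>h\<close> once \<open>k\<close> is large.\<close>
  let ?U = "{\<nu> \<in> topspace (vague_topology S). h \<nu> \<in> {h \<mu> - e / 2<..}}"
  have "openin (vague_topology S) ?U"
    by (rule openin_continuous_map_preimage[OF cont]) (simp add: open_greaterThan)
  from vague_open_imp_code_preimage[OF approx this]
  obtain G where G: "open G" "?U = {\<nu> \<in> locally_finite_measures S. integral_code g \<nu> \<in> G}"
    by (elim exE conjE)
  have "\<mu> \<in> ?U" using \<mu> e by (simp add: topspace_vague_topology)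
  then have "integral_code g \<mu> \<in> G" using G(2) by blast
  then obtain \<delta> where \<delta>: "0 < \<delta>" "\<And>y. dist y (integral_code g \<mu>) < \<delta> \<Longrightarrow> y \<in> G"
    using G(1) unfolding open_dist by blast
  obtain k0 :: nat where k0: "2 * B / \<delta> \<le> real k0" using real_arch_simple by blast
  have low: "h \<mu> - e / 2 \<le> lipschitz_minorant g S h (real k) (integral_code g \<mu>)" if k: "k \<ge> k0" for k
    unfolding lipschitz_minorant_def
  proof (rule cINF_greatest[OF locally_finite_nonempty])
    fix \<nu> assume \<nu>: "\<nu> \<in> locally_finite_measures S"
    let ?d = "dist (integral_code g \<mu>) (integral_code g \<nu>)"
    show "h \<mu> - e / 2 \<le> h \<nu> + real k * ?d"
    proof (cases "?d < \<delta>")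
      case True
      then have "integral_code g \<nu> \<in> G" using \<delta>(2) by (simp add: dist_commute)
      then have "\<nu> \<in> ?U" using G(2) \<nu> by blast
      then show ?thesis by (simp add: add.commute add_increasing2 less_imp_le)
    next
      case False
      have "2 * B = 2 * B / \<delta> * \<delta>" using \<delta> by simp
      also have "\<dots> \<le> real k * ?d"
        using False k0 k \<delta> by (intro mult_mono) auto
      finally show ?thesis using h[OF \<mu>] h[OF \<nu>] e unfolding abs_le_iff by linarith
    qed
  qed
  show "\<exists>k0. \<forall>k\<ge>k0. norm (lipschitz_minorant g S h (real k) (integral_code g \<mu>) - h \<mu>) < e"
  proof (intro exI[of _ k0] allI impI)
    fix k assume "k0 \<le> k"
    then show "norm (lipschitz_minorant g S h (real k) (integral_code g \<mu>) - h \<mu>) < e"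
      using low[of k] minorant_le[OF _ \<mu>, of "real k"] e by (simp add: abs_if)
  qed
qed

end

lemma (in random_lf_measure) vague_open_preimage:
  assumes "open S" "openin (vague_topology S) U"
  shows "Y -` U \<inter> space M \<in> sets M"
proof -
  obtain g where approx: "approximates_C_hat S g"
    using ex_approximates_C_hat[OF assms(1)] .
  note g = approximates_C_hatD[OF approx]
  obtain G where G: "open G" "U = {\<mu> \<in> locally_finite_measures S. integral_code g \<mu> \<in> G}"
    using vague_open_imp_code_preimage[OF approx assms(2)] by metis
  have "Y -` U \<inter> space M = (\<lambda>\<omega>. integral_code g (Y \<omega>)) -` G \<inter> space M"
    using locally_finite by (auto simp: G(2))
  also have "\<dots> \<in> sets M" using measurable_sets[OF code_measurable[of g, OF g]] G(1) by simp
  finally show ?thesis .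
qed

lemma (in random_lf_measure) measurable_vague:
  assumes "open S"
  shows "Y \<in> M \<rightarrow>\<^sub>M borel_of (vague_topology S)"
  unfolding borel_of_def
  using vague_open_preimage[OF assms] locally_finite
  by (intro measurable_measure_of) (auto simp flip: topspace_vague_topology dest: openin_subset)

lemma (in random_lf_measure) integrable_vague_continuous:
  assumes "open S" and h: "continuous_map (vague_topology S) euclideanreal h"
    and B: "\<And>\<mu>. \<mu> \<in> locally_finite_measures S \<Longrightarrow> \<bar>h \<mu>\<bar> \<le> B"
  shows "integrable M (\<lambda>\<omega>. h (Y \<omega>))"
proof (rule integrable_const_bound[where B = B])
  show "AE \<omega> in M. norm (h (Y \<omega>)) \<le> B" using B locally_finite by (auto intro!: AE_I2)
  show "(\<lambda>\<omega>. h (Y \<omega>)) \<in> borel_measurable M"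
  proof (rule borel_measurableI)
    fix A :: "real set" assume "open A"
    then have "openin (vague_topology S) {\<mu> \<in> topspace (vague_topology S). h \<mu> \<in> A}"
      using openin_continuous_map_preimage[OF h] by simp
    from vague_open_preimage[OF assms(1) this]
    have "Y -` {\<mu> \<in> locally_finite_measures S. h \<mu> \<in> A} \<inter> space M \<in> sets M"
      by (simp add: topspace_vague_topology)
    also have "Y -` {\<mu> \<in> locally_finite_measures S. h \<mu> \<in> A} \<inter> space M = (\<lambda>\<omega>. h (Y \<omega>)) -` A \<inter> space M"
      using locally_finite by auto
    finally show "(\<lambda>\<omega>. h (Y \<omega>)) -` A \<inter> space M \<in> sets M" .
  qed
qed

text \<open>Each minorant gives a lower bound that passes to the limit in \<open>n\<close>, and the bounds increase to the
  expectation of \<open>h\<close>. Applied to \<open>h\<close> and to \<open>- h\<close>, this yields convergence.\<close>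

lemma expectation_liminf_from_laplace:
  fixes M :: "'w measure" and M' :: "'v measure"
  assumes "open S"
    and Y: "\<And>n. random_lf_measure M S (Y n)" and Y': "random_lf_measure M' S Y'"
    and laplace: "\<And>f. f \<in> C_hat S \<Longrightarrow> (\<lambda>n. \<integral>\<omega>. exp (- (\<integral>x. f x \<partial>Y n \<omega>)) \<partial>M)
                     \<longlonglongrightarrow> (\<integral>\<omega>. exp (- (\<integral>x. f x \<partial>Y' \<omega>)) \<partial>M')"
    and h: "continuous_map (vague_topology S) euclideanreal h"
    and B: "\<And>\<mu>. \<mu> \<in> locally_finite_measures S \<Longrightarrow> \<bar>h \<mu>\<bar> \<le> B"
    and "0 < e"
  shows "\<forall>\<^sub>F n in sequentially. (\<integral>\<omega>. h (Y' \<omega>) \<partial>M') - e < (\<integral>\<omega>. h (Y n \<omega>) \<partial>M)"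
proof -
  interpret Y: random_lf_measure M S "Y n" for n by (rule Y)
  interpret Y': random_lf_measure M' S Y' by (rule Y')
  obtain g where approx: "approximates_C_hat S g"
    using ex_approximates_C_hat[OF assms(1)] .
  note g = approximates_C_hatD[OF approx]
  let ?F = "\<lambda>k::nat. lipschitz_minorant g S h (real k)"
  have cont: "continuous_on unit_cube (?F k)" for k by (rule continuous_on_minorant[OF B]) simp_all
  have bound: "\<bar>?F k (integral_code g \<mu>)\<bar> \<le> B" if "\<mu> \<in> locally_finite_measures S" for k \<mu>
  proof -
    have "?F k (integral_code g \<mu>) \<le> h \<mu>" by (rule minorant_le[OF B _ that]) simp_all
    moreover have "- B \<le> ?F k (integral_code g \<mu>)" by (rule minorant_ge[OF B]) simp_all
    ultimately show ?thesis using B[OF that] by linarith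
  qed
  have "(\<lambda>k. \<integral>\<omega>. ?F k (integral_code g (Y' \<omega>)) \<partial>M') \<longlonglongrightarrow> (\<integral>\<omega>. h (Y' \<omega>) \<partial>M')"
  proof (rule integral_dominated_convergence[where w = "\<lambda>_. B"])
    show "AE \<omega> in M'. (\<lambda>k. ?F k (integral_code g (Y' \<omega>))) \<longlonglongrightarrow> h (Y' \<omega>)"
      by (rule AE_I2, rule minorant_tendsto[OF B approx h Y'.locally_finite])
    show "AE \<omega> in M'. norm (?F k (integral_code g (Y' \<omega>))) \<le> B" for k
      using bound[OF Y'.locally_finite] by (intro AE_I2) simp
    show "(\<lambda>\<omega>. h (Y' \<omega>)) \<in> borel_measurable M'"
      by (rule borel_measurable_integrable[OF Y'.integrable_vague_continuous[OF assms(1) h B]])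
    show "(\<lambda>\<omega>. ?F k (integral_code g (Y' \<omega>))) \<in> borel_measurable M'" for k
      by (rule borel_measurable_integrable[OF Y'.integrable_code[of g, OF g cont]])
  qed simp
  then obtain k where "\<bar>(\<integral>\<omega>. ?F k (integral_code g (Y' \<omega>)) \<partial>M') - (\<integral>\<omega>. h (Y' \<omega>) \<partial>M')\<bar> < e / 2"
    using LIMSEQ_D[of _ _ "e / 2"] \<open>0 < e\<close> by fastforce
  then have k: "(\<integral>\<omega>. h (Y' \<omega>) \<partial>M') - e < (\<integral>\<omega>. ?F k (integral_code g (Y' \<omega>)) \<partial>M')" using \<open>0 < e\<close> by linarith
  have "(\<lambda>n. \<integral>\<omega>. ?F k (integral_code g (Y n \<omega>)) \<partial>M) \<longlonglongrightarrow> (\<integral>\<omega>. ?F k (integral_code g (Y' \<omega>)) \<partial>M')"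
    by (rule expectation_code_tendsto[OF Y Y' laplace g cont])
  from order_tendstoD(1)[OF this k] show ?thesis
  proof eventually_elim
    case (elim n)
    have "(\<integral>\<omega>. ?F k (integral_code g (Y n \<omega>)) \<partial>M) \<le> (\<integral>\<omega>. h (Y n \<omega>) \<partial>M)"
      by (rule integral_mono[OF Y.integrable_code[of g, OF g cont]
            Y.integrable_vague_continuous[OF assms(1) h B] minorant_le[OF B _ Y.locally_finite]]) simp_all
    with elim show ?case by linarith
  qed
qed

theorem converges_in_distribution_from_laplace:
  fixes M :: "'w measure" and M' :: "'v measure"
  assumes "open S"
    and Y: "\<And>n. random_lf_measure M S (Y n)" and Y': "random_lf_measure M' S Y'"
    and laplace: "\<And>f. f \<in> C_hat S \<Longrightarrow> (\<lambda>n. \<integral>\<omega>. exp (- (\<integral>x. f x \<partial>Y n \<omega>)) \<partial>M)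
                     \<longlonglongrightarrow> (\<integral>\<omega>. exp (- (\<integral>x. f x \<partial>Y' \<omega>)) \<partial>M')"
  shows "converges_in_distribution (vague_topology S) M Y M' Y'"
  unfolding converges_in_distribution_def
proof (intro conjI allI impI)
  show "Y n \<in> M \<rightarrow>\<^sub>M borel_of (vague_topology S)" for n
    by (rule random_lf_measure.measurable_vague[OF Y assms(1)])
  show "Y' \<in> M' \<rightarrow>\<^sub>M borel_of (vague_topology S)"
    by (rule random_lf_measure.measurable_vague[OF Y' assms(1)])
  fix h assume "continuous_map (vague_topology S) euclideanreal h \<and> bounded (h ` topspace (vague_topology S))"
  then have h: "continuous_map (vague_topology S) euclideanreal h"
    and "bounded (h ` locally_finite_measures S)" by (auto simp: topspace_vague_topology)
  then obtain B where B: "\<And>\<mu>. \<mu> \<in> locally_finite_measures S \<Longrightarrow> \<bar>h \<mu>\<bar> \<le> B"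
    by (auto simp: bounded_iff)
  have B': "\<bar>- h \<mu>\<bar> \<le> B" if "\<mu> \<in> locally_finite_measures S" for \<mu>
    using B[OF that] by simp
  have h': "continuous_map (vague_topology S) euclideanreal (\<lambda>\<mu>. - h \<mu>)"
    using h by (rule continuous_map_minus)
  show "(\<lambda>n. \<integral>\<omega>. h (Y n \<omega>) \<partial>M) \<longlonglongrightarrow> (\<integral>\<omega>. h (Y' \<omega>) \<partial>M')"
  proof (rule tendstoI)
    fix e :: real assume e: "0 < e"
    have "\<forall>\<^sub>F n in sequentially. (\<integral>\<omega>. h (Y' \<omega>) \<partial>M') - e < (\<integral>\<omega>. h (Y n \<omega>) \<partial>M)"
      by (rule expectation_liminf_from_laplace[OF assms h B e])
    moreover have "\<forall>\<^sub>F n in sequentially. (\<integral>\<omega>. - h (Y' \<omega>) \<partial>M') - e < (\<integral>\<omega>. - h (Y n \<omega>) \<partial>M)"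
      by (rule expectation_liminf_from_laplace[OF assms h' B' e])
    ultimately show "\<forall>\<^sub>F n in sequentially. dist (\<integral>\<omega>. h (Y n \<omega>) \<partial>M) (\<integral>\<omega>. h (Y' \<omega>) \<partial>M') < e"
      by eventually_elim (auto simp: dist_real_def abs_less_iff)
  qed
qed

section \<open>Locally finite atomic measures\<close>

text \<open>The weights are natural numbers, so every nonzero term is at least one.\<close>

lemma finite_support_if_weighted_sum_finite:
  fixes x :: "nat \<Rightarrow> nat"
  assumes "(\<Sum>k. of_nat (x k) * indicator A (z k) :: ennreal) < \<infinity>"
  shows "finite {k. x k \<noteq> 0 \<and> z k \<in> A}"
proof (rule ccontr)
  let ?B = "{k. x k \<noteq> 0 \<and> z k \<in> A}"
  assume "infinite ?B"
  then have "\<infinity> = emeasure (count_space UNIV) ?B" by simp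
  also have "\<dots> = (\<integral>\<^sup>+k. indicator ?B k \<partial>count_space UNIV)" by simp
  also have "\<dots> \<le> (\<integral>\<^sup>+k. of_nat (x k) * indicator A (z k) \<partial>count_space UNIV)"
  proof (rule nn_integral_mono)
    fix k
    have "(1 :: ennreal) \<le> of_nat (x k)" if "x k \<noteq> 0"
      using that by (metis Suc_leI gr0I of_nat_1 of_nat_mono One_nat_def)
    then show "(indicator ?B k :: ennreal) \<le> of_nat (x k) * indicator A (z k)"
      by (auto simp: indicator_def)
  qed
  also have "\<dots> < \<infinity>" using assms by (simp add: nn_integral_count_space_nat)
  finally show False by simp
qed

text \<open>Local finiteness of a purely atomic measure with integer weights is a finiteness property of index
  sets; therefore all integrals of test functions are in fact finite sums.\<close>

lemma atomic_measure_locally_finite_iff: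
  fixes S :: "'a::t2_space set"
  assumes z: "\<And>k. z k \<in> S"
  shows "atomic_measure S x z \<in> locally_finite_measures S \<longleftrightarrow>
    (\<forall>K. compact K \<longrightarrow> K \<subseteq> S \<longrightarrow> finite {k. x k \<noteq> 0 \<and> z k \<in> K})"
proof (intro iffI allI impI)
  fix K :: "'a set"
  assume L: "atomic_measure S x z \<in> locally_finite_measures S" and K: "compact K" "K \<subseteq> S"
  show "finite {k. x k \<noteq> 0 \<and> z k \<in> K}"
    using emeasure_compact_finite[OF L K]
    by (intro finite_support_if_weighted_sum_finite)
      (simp add: emeasure_atomic_measure[OF z compact_sets_borel_on[OF K]])
next
  assume fin: "\<forall>K. compact K \<longrightarrow> K \<subseteq> S \<longrightarrow> finite {k. x k \<noteq> 0 \<and> z k \<in> K}"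
  have "emeasure (atomic_measure S x z) B < \<infinity>"
    if B: "B \<in> sets (borel_on S)" "compact K" "K \<subseteq> S" "B \<subseteq> K" for B K
  proof -
    have "finite {k. x k \<noteq> 0 \<and> z k \<in> B}"
      using fin[rule_format, OF B(2,3)] by (rule rev_finite_subset) (use B(4) in auto)
    then have "(\<Sum>k. of_nat (x k) * indicator B (z k) :: ennreal)
      = (\<Sum>k\<in>{k. x k \<noteq> 0 \<and> z k \<in> B}. of_nat (x k) * indicator B (z k))"
      by (rule suminf_finite) (auto simp: indicator_def)
    also have "\<dots> = of_nat (\<Sum>k | x k \<noteq> 0 \<and> z k \<in> B. x k)"
      unfolding of_nat_sum by (rule sum.cong) auto
    also have "\<dots> < \<infinity>" unfolding infinity_ennreal_def by (rule of_nat_less_top)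
    finally show ?thesis using emeasure_atomic_measure[OF z B(1)] by simp
  qed
  then show "atomic_measure S x z \<in> locally_finite_measures S"
    by (auto simp: locally_finite_measures_def relatively_compact_in_def atomic_measure_def)
qed

lemma atomic_measure_finite_support:
  fixes S :: "'a::t2_space set"
  assumes z: "\<And>k. z k \<in> S" and L: "atomic_measure S x z \<in> locally_finite_measures S" and f: "f \<in> C_hat S"
  shows "finite {k. x k \<noteq> 0 \<and> f (z k) \<noteq> 0}"
proof -
  obtain K where K: "compact K" "K \<subseteq> S" "\<And>x. x \<in> S \<Longrightarrow> x \<notin> K \<Longrightarrow> f x = 0"
    using C_hat_support[OF f] by metis
  have "finite {k. x k \<noteq> 0 \<and> z k \<in> K}"
    using L K(1,2) unfolding atomic_measure_locally_finite_iff[OF z] by blast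
  then show ?thesis by (rule rev_finite_subset) (use K z in auto)
qed

lemma atomic_measure_summable:
  fixes S :: "'a::t2_space set"
  assumes z: "\<And>k. z k \<in> S" and L: "atomic_measure S x z \<in> locally_finite_measures S" and f: "f \<in> C_hat S"
  shows "summable (\<lambda>k. real (x k) * f (z k))"
  using atomic_measure_finite_support[OF assms]
  by (rule summable_finite) auto

lemma integral_atomic_measure:
  fixes S :: "'a::t2_space set"
  assumes z: "\<And>k. z k \<in> S" and L: "atomic_measure S x z \<in> locally_finite_measures S" and f: "f \<in> C_hat S"
  shows "(\<integral>p. f p \<partial>atomic_measure S x z) = (\<Sum>k. real (x k) * f (z k))"
proof -
  let ?D = "density (count_space UNIV) (\<lambda>k. of_nat (x k) :: ennreal)"
  have zm: "z \<in> ?D \<rightarrow>\<^sub>M borel_on S"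
    using z by (simp add: measurable_def space_restrict_space)
  have "(\<integral>p. f p \<partial>atomic_measure S x z) = (\<integral>k. f (z k) \<partial>?D)"
    unfolding atomic_measure_def using integral_distr[OF zm C_hat_measurable[OF f]] .
  also have "?D = density (count_space UNIV) (\<lambda>k. ennreal (real (x k)))"
    by (simp add: ennreal_of_nat_eq_real_of_nat)
  also have "(\<integral>k. f (z k) \<partial>\<dots>) = (\<integral>k. real (x k) * f (z k) \<partial>count_space UNIV)"
    by (subst integral_density) auto
  also have "\<dots> = (\<Sum>k | k \<in> UNIV \<and> real (x k) * f (z k) \<noteq> 0. real (x k) * f (z k))"
    using atomic_measure_finite_support[OF assms] by (intro lebesgue_integral_count_space_finite_support) simp
  also have "\<dots> = (\<Sum>k. real (x k) * f (z k))"
    using atomic_measure_finite_support[OF assms] by (intro suminf_finite[symmetric]) auto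
  finally show ?thesis .
qed

lemma sum_measurable_atomic:
  assumes X: "\<And>k. X k \<in> M \<rightarrow>\<^sub>M count_space UNIV" and W: "\<And>k. W k \<in> M \<rightarrow>\<^sub>M borel_on S"
    and f: "f \<in> C_hat S"
  shows "(\<lambda>\<omega>. \<Sum>k. real (X k \<omega>) * f (W k \<omega>)) \<in> borel_measurable M"
proof -
  have "(\<lambda>\<omega>. f (W k \<omega>)) \<in> borel_measurable M" for k
    using measurable_compose[OF W C_hat_measurable[OF f]] .
  moreover have "(\<lambda>\<omega>. real (X k \<omega>)) \<in> borel_measurable M" for k
    using measurable_compose[OF X[of k], of real borel] by simp
  ultimately show ?thesis by simp
qed

text \<open>A countable exhaustion of the punctured space by compact sets. It reduces local finiteness to
  countably many conditions, which is what measurability of the uplifted process requires.\<close>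

definition annulus :: "nat \<Rightarrow> (real ^ 'd) set" where
  "annulus m = {v. norm v \<in> {1 / (real m + 1)..real m + 1}}"

lemma compact_annulus: "compact (annulus m :: (real ^ 'd) set)"
proof -
  have "closed {v :: real ^ 'd. 1 / (real m + 1) \<le> norm v \<and> norm v \<le> real m + 1}"
    by (intro closed_Collect_conj closed_Collect_le) (auto intro!: continuous_intros)
  moreover have "bounded {v :: real ^ 'd. 1 / (real m + 1) \<le> norm v \<and> norm v \<le> real m + 1}"
    by (auto simp: bounded_iff)
  ultimately show ?thesis by (simp add: annulus_def compact_eq_bounded_closed)
qed

lemma annulus_subset: "annulus m \<subseteq> punctured_space"
  by (auto simp: annulus_def divide_le_0_iff)

lemma compact_subset_annulus:
  fixes K :: "(real ^ 'd) set"
  assumes "compact K" "K \<subseteq> punctured_space"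
  shows "\<exists>m. K \<subseteq> annulus m"
proof -
  obtain B where B: "\<And>v. v \<in> K \<Longrightarrow> norm v \<le> B"
    using compact_imp_bounded[OF assms(1)] by (auto simp: bounded_iff)
  have "open (- K)" "0 \<in> - K" using assms compact_imp_closed by auto
  then obtain d where d: "0 < d" "ball 0 d \<subseteq> - K" using open_contains_ball by blast
  have away: "d \<le> norm v" if "v \<in> K" for v using d(2) that by (meson ComplD linorder_not_le mem_ball_0 subsetD)
  obtain m :: nat where m: "max B (1 / d) \<le> real m" using real_arch_simple by blast
  have "1 / (real m + 1) \<le> d"
  proof -
    have "1 / d \<le> real m + 1" using m by simp
    then show ?thesis using d(1) by (simp add: field_simps)
  qed
  then have "K \<subseteq> annulus m" using B away m by (fastforce simp: annulus_def)
  then show ?thesis ..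
qed

lemma atomic_measure_punctured_iff:
  fixes z :: "nat \<Rightarrow> real ^ 'd"
  assumes z: "\<And>k. z k \<in> punctured_space"
  shows "atomic_measure punctured_space x z \<in> locally_finite_measures punctured_space \<longleftrightarrow>
    (\<forall>m. finite {k. x k \<noteq> 0 \<and> z k \<in> annulus m})"
  unfolding atomic_measure_locally_finite_iff[of z, OF z]
proof (intro iffI allI impI)
  fix K :: "(real ^ 'd) set"
  assume fin: "\<forall>m. finite {k. x k \<noteq> 0 \<and> z k \<in> annulus m}" and K: "compact K" "K \<subseteq> punctured_space"
  obtain m where "K \<subseteq> annulus m" using compact_subset_annulus[OF K] ..
  then show "finite {k. x k \<noteq> 0 \<and> z k \<in> K}"
    by (intro rev_finite_subset[OF fin[rule_format, of m]]) auto
qed (use compact_annulus annulus_subset in blast)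

lemma random_atomic_measure_locally_finite:
  "random_atomic_measure S X W \<omega> \<in> locally_finite_measures S"
  by (simp add: random_atomic_measure_def Let_def null_measure_locally_finite)

lemma finite_Collect_nat_iff: "finite {k::nat. P k} \<longleftrightarrow> (\<exists>n. \<forall>k\<ge>n. \<not> P k)"
  unfolding finite_nat_set_iff_bounded by (metis mem_Collect_eq not_less)

text \<open>The event on which the zero measure is substituted is measurable, since it is described by
  countably many conditions on the variables \<open>X k\<close> and \<open>W k\<close>.\<close>

lemma random_lf_measure_atomic:
  fixes W :: "nat \<Rightarrow> 'w \<Rightarrow> real ^ 'd"
  assumes "prob_space M" and X: "\<And>k. X k \<in> M \<rightarrow>\<^sub>M count_space UNIV"
    and W: "\<And>k. W k \<in> M \<rightarrow>\<^sub>M borel_on punctured_space"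
  shows "random_lf_measure M punctured_space (random_atomic_measure punctured_space X W)"
proof -
  interpret prob_space M by fact
  show ?thesis
  proof
    fix f :: "real ^ 'd \<Rightarrow> real" assume f: "f \<in> C_hat punctured_space"
    have WS: "W k \<omega> \<in> punctured_space" if "\<omega> \<in> space M" for k \<omega>
      using measurable_space[OF W that] by (simp add: space_restrict_space)
    have eq: "(\<integral>p. f p \<partial>random_atomic_measure punctured_space X W \<omega>) =
        (if \<forall>m. \<exists>n. \<forall>k\<ge>n. \<not> (X k \<omega> \<noteq> 0 \<and> W k \<omega> \<in> annulus m)
         then \<Sum>k. real (X k \<omega>) * f (W k \<omega>) else 0)" if \<omega>: "\<omega> \<in> space M" for \<omega>
    proof -
      have iff: "atomic_measure punctured_space (\<lambda>k. X k \<omega>) (\<lambda>k. W k \<omega>) \<in> locally_finite_measures punctured_space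
          \<longleftrightarrow> (\<forall>m. \<exists>n. \<forall>k\<ge>n. \<not> (X k \<omega> \<noteq> 0 \<and> W k \<omega> \<in> annulus m))"
        using atomic_measure_punctured_iff[of "\<lambda>k. W k \<omega>" "\<lambda>k. X k \<omega>", OF WS[OF \<omega>]]
        unfolding finite_Collect_nat_iff .
      show ?thesis
        unfolding iff[symmetric] random_atomic_measure_def Let_def
        using integral_atomic_measure[of "\<lambda>k. W k \<omega>", OF WS[OF \<omega>] _ f] by simp
    qed
    have [measurable]: "Measurable.pred M (\<lambda>\<omega>. W k \<omega> \<in> annulus m)" for k m
    proof -
      have "{\<omega> \<in> space M. W k \<omega> \<in> annulus m} = W k -` annulus m \<inter> space M" by auto
      then show ?thesis
        using measurable_sets[OF W compact_sets_borel_on[OF compact_annulus annulus_subset]]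
        by (simp add: pred_def)
    qed
    have [measurable]: "Measurable.pred M (\<lambda>\<omega>. X k \<omega> \<noteq> 0)" for k
      using measurable_compose[OF X[of k], of "\<lambda>n. n \<noteq> 0" "count_space UNIV"] by simp
    note [measurable] = sum_measurable_atomic[OF X W f]
    have "(\<lambda>\<omega>. if \<forall>m. \<exists>n. \<forall>k\<ge>n. \<not> (X k \<omega> \<noteq> 0 \<and> W k \<omega> \<in> annulus m)
         then \<Sum>k. real (X k \<omega>) * f (W k \<omega>) else 0) \<in> borel_measurable M"
      by measurable
    then show "(\<lambda>\<omega>. \<integral>p. f p \<partial>random_atomic_measure punctured_space X W \<omega>) \<in> borel_measurable M"
      by (subst measurable_cong[OF eq])
  qed (rule random_atomic_measure_locally_finite)
qed

lemma scaled_measurable: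
  fixes V :: "'w \<Rightarrow> real ^ 'd"
  assumes Z: "Z \<in> M \<rightarrow>\<^sub>M borel_on {0<..}" and V: "V \<in> M \<rightarrow>\<^sub>M borel_on punctured_space"
  shows "(\<lambda>\<omega>. Z \<omega> *\<^sub>R V \<omega>) \<in> M \<rightarrow>\<^sub>M borel_on punctured_space"
proof (rule measurable_restrict_space2)
  have "Z \<in> borel_measurable M" "V \<in> borel_measurable M"
    using Z V by (auto dest: measurable_restrict_space2_iff[THEN iffD1])
  then show "(\<lambda>\<omega>. Z \<omega> *\<^sub>R V \<omega>) \<in> borel_measurable M" by simp
  show "(\<lambda>\<omega>. Z \<omega> *\<^sub>R V \<omega>) \<in> space M \<rightarrow> punctured_space"
    using measurable_space[OF Z] measurable_space[OF V] by (force simp: space_restrict_space)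
qed

lemma AE_uplift_atomic_locally_finite:
  fixes Vs :: "nat \<Rightarrow> 'w \<Rightarrow> real ^ 'd"
  assumes X: "\<And>k. X k \<in> M \<rightarrow>\<^sub>M count_space UNIV"
    and Z: "\<And>k. Z k \<in> M \<rightarrow>\<^sub>M borel_on {0<..}" and V: "\<And>k. Vs k \<in> M \<rightarrow>\<^sub>M borel_on punctured_space"
    and fin: "finite_uplift_moments M X Z Vs"
  shows "AE \<omega> in M. atomic_measure punctured_space (\<lambda>k. X k \<omega>) (\<lambda>k. Z k \<omega> *\<^sub>R Vs k \<omega>)
            \<in> locally_finite_measures punctured_space"
proof -
  have [measurable]: "Z k \<in> borel_measurable M" "Vs k \<in> borel_measurable M" for k
    using Z V by (auto dest: measurable_restrict_space2_iff[THEN iffD1])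
  have [measurable]: "(\<lambda>\<omega>. of_nat (X k \<omega>) :: ennreal) \<in> borel_measurable M" for k
    using measurable_compose[OF X[of k], of of_nat borel] by simp
  have "AE \<omega> in M. \<forall>m. (\<Sum>k. of_nat (X k \<omega>) * indicator {1 / (real m + 1)..real m + 1} (Z k \<omega> * norm (Vs k \<omega>)) :: ennreal) \<noteq> \<infinity>"
    unfolding AE_all_countable
  proof
    fix m
    have "(\<integral>\<^sup>+\<omega>. (\<Sum>k. of_nat (X k \<omega>) * indicator {1 / (real m + 2)..real m + 2} (Z k \<omega> * norm (Vs k \<omega>))) \<partial>M) \<noteq> \<infinity>"
      using fin[unfolded finite_uplift_moments_def, rule_format, of "1 / (real m + 2)" "real m + 2"]
      by (simp add: field_simps add_pos_nonneg)
    then have "AE \<omega> in M. (\<Sum>k. of_nat (X k \<omega>) * indicator {1 / (real m + 2)..real m + 2} (Z k \<omega> * norm (Vs k \<omega>)) :: ennreal) \<noteq> \<infinity>"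
      by (intro nn_integral_noteq_infinite) (simp_all, measurable)
    then show "AE \<omega> in M. (\<Sum>k. of_nat (X k \<omega>) * indicator {1 / (real m + 1)..real m + 1} (Z k \<omega> * norm (Vs k \<omega>)) :: ennreal) \<noteq> \<infinity>"
    proof eventually_elim
      case (elim \<omega>)
      have le: "1 / (real m + 2) \<le> 1 / (real m + 1)" by (simp add: frac_le)
      have "(\<Sum>k. of_nat (X k \<omega>) * indicator {1 / (real m + 1)..real m + 1} (Z k \<omega> * norm (Vs k \<omega>)) :: ennreal)
        \<le> (\<Sum>k. of_nat (X k \<omega>) * indicator {1 / (real m + 2)..real m + 2} (Z k \<omega> * norm (Vs k \<omega>)))"
        using le by (intro suminf_le mult_left_mono) (auto simp: indicator_def)
      with elim show ?case by (auto simp: top_unique)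
    qed
  qed
  then show ?thesis
  proof (rule AE_mp, intro AE_I2 impI)
    fix \<omega> assume \<omega>: "\<omega> \<in> space M"
      and sum: "\<forall>m. (\<Sum>k. of_nat (X k \<omega>) * indicator {1 / (real m + 1)..real m + 1} (Z k \<omega> * norm (Vs k \<omega>)) :: ennreal) \<noteq> \<infinity>"
    have pos: "0 < Z k \<omega>" "Vs k \<omega> \<noteq> 0" for k
      using measurable_space[OF Z \<omega>] measurable_space[OF V \<omega>] by (auto simp: space_restrict_space)
    have W: "Z k \<omega> *\<^sub>R Vs k \<omega> \<in> punctured_space" for k
      using pos[of k] by simp
    have "finite {k. X k \<omega> \<noteq> 0 \<and> Z k \<omega> *\<^sub>R Vs k \<omega> \<in> annulus m}" for m
    proof -
      have "finite {k. X k \<omega> \<noteq> 0 \<and> Z k \<omega> * norm (Vs k \<omega>) \<in> {1 / (real m + 1)..real m + 1}}"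
        using sum[rule_format, of m] by (intro finite_support_if_weighted_sum_finite) (simp add: top.not_eq_extremum)
      then show ?thesis using pos by (simp add: annulus_def less_imp_le abs_of_pos)
    qed
    then show "atomic_measure punctured_space (\<lambda>k. X k \<omega>) (\<lambda>k. Z k \<omega> *\<^sub>R Vs k \<omega>)
            \<in> locally_finite_measures punctured_space"
      unfolding atomic_measure_punctured_iff[of "\<lambda>k. Z k \<omega> *\<^sub>R Vs k \<omega>", OF W] by blast
  qed
qed

section \<open>Averaging over the marks\<close>

lemma (in prob_space) distr_pair_eq_of_indep_set:
  assumes A: "A \<in> M \<rightarrow>\<^sub>M PA" and B: "B \<in> M \<rightarrow>\<^sub>M PB"
    and indep: "indep_set (sets (vimage_algebra (space M) A PA)) (sets (vimage_algebra (space M) B PB))"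
  shows "distr M PA A \<Otimes>\<^sub>M distr M PB B = distr M (PA \<Otimes>\<^sub>M PB) (\<lambda>\<omega>. (A \<omega>, B \<omega>))"
proof (rule pair_measure_eqI)
  show "sigma_finite_measure (distr M PA A)" "sigma_finite_measure (distr M PB B)"
    using prob_space_distr[OF A] prob_space_distr[OF B]
    by (auto intro: prob_space_imp_sigma_finite)
  fix a b assume ab: "a \<in> sets (distr M PA A)" "b \<in> sets (distr M PB B)"
  then have ab': "a \<in> sets PA" "b \<in> sets PB" by simp_all
  have AB: "(\<lambda>\<omega>. (A \<omega>, B \<omega>)) \<in> M \<rightarrow>\<^sub>M PA \<Otimes>\<^sub>M PB" using A B by simp
  have "prob ((A -` a \<inter> space M) \<inter> (B -` b \<inter> space M)) = prob (A -` a \<inter> space M) * prob (B -` b \<inter> space M)"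
    by (rule indep_setD[OF indep]) (auto intro: in_vimage_algebra ab')
  moreover have "(A -` a \<inter> space M) \<inter> (B -` b \<inter> space M) = (\<lambda>\<omega>. (A \<omega>, B \<omega>)) -` (a \<times> b) \<inter> space M"
    by auto
  ultimately show "emeasure (distr M PA A) a * emeasure (distr M PB B) b =
      emeasure (distr M (PA \<Otimes>\<^sub>M PB) (\<lambda>\<omega>. (A \<omega>, B \<omega>))) (a \<times> b)"
    using ab' by (simp add: emeasure_distr[OF A] emeasure_distr[OF B] emeasure_distr[OF AB]
        emeasure_eq_measure ennreal_mult[symmetric])
qed simp

text \<open>Fubini's theorem for an independent pair, written on the original space: the independent copy of
  \<open>B\<close> in the inner integral is \<open>B\<close> itself, evaluated at a second sample point \<open>\<omega>'\<close>.\<close>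

lemma (in prob_space) expectation_of_independent_pair:
  fixes \<Phi> :: "'b \<times> 'c \<Rightarrow> real"
  assumes A: "A \<in> M \<rightarrow>\<^sub>M PA" and B: "B \<in> M \<rightarrow>\<^sub>M PB"
    and indep: "indep_set (sets (vimage_algebra (space M) A PA)) (sets (vimage_algebra (space M) B PB))"
    and \<Phi>: "\<Phi> \<in> borel_measurable (PA \<Otimes>\<^sub>M PB)" and bound: "\<And>p. \<bar>\<Phi> p\<bar> \<le> C"
  shows "(\<integral>\<omega>. \<Phi> (A \<omega>, B \<omega>) \<partial>M) = (\<integral>\<omega>. (\<integral>\<omega>'. \<Phi> (A \<omega>, B \<omega>') \<partial>M) \<partial>M)"
proof -
  interpret DA: prob_space "distr M PA A" by (rule prob_space_distr[OF A])
  interpret DB: prob_space "distr M PB B" by (rule prob_space_distr[OF B])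
  interpret D: pair_prob_space "distr M PA A" "distr M PB B" ..
  have AB: "(\<lambda>\<omega>. (A \<omega>, B \<omega>)) \<in> M \<rightarrow>\<^sub>M PA \<Otimes>\<^sub>M PB" using A B by simp
  have m: "\<Phi> \<in> borel_measurable (distr M PA A \<Otimes>\<^sub>M distr M PB B)"
    using \<Phi> by (simp cong: measurable_cong_sets)
  have int: "integrable (distr M PA A \<Otimes>\<^sub>M distr M PB B) \<Phi>"
    using bound m by (intro D.P.integrable_const_bound[where B = C]) auto
  have "(\<integral>\<omega>. \<Phi> (A \<omega>, B \<omega>) \<partial>M) = (\<integral>p. \<Phi> p \<partial>distr M (PA \<Otimes>\<^sub>M PB) (\<lambda>\<omega>. (A \<omega>, B \<omega>)))"
    by (rule integral_distr[OF AB \<Phi>, symmetric])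
  also have "\<dots> = (\<integral>a. (\<integral>b. \<Phi> (a, b) \<partial>distr M PB B) \<partial>distr M PA A)"
    unfolding distr_pair_eq_of_indep_set[OF A B indep, symmetric] by (rule D.integral_fst'[OF int, symmetric])
  also have "\<dots> = (\<integral>\<omega>. (\<integral>b. \<Phi> (A \<omega>, b) \<partial>distr M PB B) \<partial>M)"
  proof (rule integral_distr[OF A])
    show "(\<lambda>a. \<integral>b. \<Phi> (a, b) \<partial>distr M PB B) \<in> borel_measurable PA"
      using DB.borel_measurable_lebesgue_integral[of "\<lambda>a b. \<Phi> (a, b)" PA] \<Phi>
      by (simp cong: measurable_cong_sets)
  qed
  also have "\<dots> = (\<integral>\<omega>. (\<integral>\<omega>'. \<Phi> (A \<omega>, B \<omega>') \<partial>M) \<partial>M)"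
  proof (rule Bochner_Integration.integral_cong[OF refl])
    fix \<omega> assume "\<omega> \<in> space M"
    then have "A \<omega> \<in> space PA" by (rule measurable_space[OF A])
    then have "(\<lambda>b. \<Phi> (A \<omega>, b)) \<in> borel_measurable PB" using \<Phi> by simp
    then show "(\<integral>b. \<Phi> (A \<omega>, b) \<partial>distr M PB B) = (\<integral>\<omega>'. \<Phi> (A \<omega>, B \<omega>') \<partial>M)"
      by (rule integral_distr[OF B])
  qed
  finally show ?thesis .
qed

text \<open>Given the points \<open>(X k, Z k)\<close>, the marks are independent with the law of \<open>V\<close>, so a product over
  the points may be averaged factor by factor.\<close>

lemma expectation_prod_iid_marks:
  fixes V :: "'v \<Rightarrow> real ^ 'd" and Vs :: "nat \<Rightarrow> 'w \<Rightarrow> real ^ 'd"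
    and e :: "(nat \<times> real) \<times> (real ^ 'd) \<Rightarrow> real"
  assumes "prob_space M" "prob_space N" and V: "V \<in> N \<rightarrow>\<^sub>M borel_on punctured_space"
    and X: "\<And>k. X k \<in> M \<rightarrow>\<^sub>M count_space UNIV" and Z: "\<And>k. Z k \<in> M \<rightarrow>\<^sub>M borel_on {0<..}"
    and copies: "independent_iid_copies N V M Vs X Z"
    and e: "e \<in> borel_measurable ((count_space UNIV \<Otimes>\<^sub>M borel_on {0<..}) \<Otimes>\<^sub>M borel_on punctured_space)"
    and bound: "\<And>p. \<bar>e p\<bar> \<le> 1"
  shows "(\<integral>\<omega>. (\<Prod>k<m. e ((X k \<omega>, Z k \<omega>), Vs k \<omega>)) \<partial>M)
       = (\<integral>\<omega>. (\<Prod>k<m. \<integral>v. e ((X k \<omega>, Z k \<omega>), V v) \<partial>N) \<partial>M)"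
proof -
  interpret M: prob_space M by fact
  interpret N: prob_space N by fact
  have Vs: "\<And>k. Vs k \<in> M \<rightarrow>\<^sub>M borel_on punctured_space"
    and law: "\<And>k. distr M (borel_on punctured_space) (Vs k) = distr N (borel_on punctured_space) V"
    and indep_V: "M.indep_vars (\<lambda>_. borel_on punctured_space) Vs UNIV"
    and indep: "M.indep_set
       (sets (vimage_algebra (space M) (\<lambda>\<omega> k. (X k \<omega>, Z k \<omega>))
         (\<Pi>\<^sub>M k\<in>UNIV. count_space UNIV \<Otimes>\<^sub>M borel_on {0<..})))
       (sets (vimage_algebra (space M) (\<lambda>\<omega> k. Vs k \<omega>)
         (\<Pi>\<^sub>M k\<in>UNIV. borel_on punctured_space)))"
    using copies unfolding independent_iid_copies_def by blast+
  let ?PA = "\<Pi>\<^sub>M k\<in>(UNIV :: nat set). (count_space UNIV :: nat measure) \<Otimes>\<^sub>M borel_on {0 :: real<..}"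
  let ?PB = "\<Pi>\<^sub>M k\<in>(UNIV :: nat set). borel_on (punctured_space :: (real ^ 'd) set)"
  have A: "(\<lambda>\<omega> k. (X k \<omega>, Z k \<omega>)) \<in> M \<rightarrow>\<^sub>M ?PA"
    using X Z measurable_space[OF Z]
    by (intro measurable_PiM_single') (auto simp: space_pair_measure space_restrict_space)
  have B: "(\<lambda>\<omega> k. Vs k \<omega>) \<in> M \<rightarrow>\<^sub>M ?PB"
    using Vs measurable_space[OF Vs] by (intro measurable_PiM_single') (auto simp: space_restrict_space)
  define \<Phi> where "\<Phi> p = (\<Prod>k<m. e (fst p k, snd p k))" for p
  have "(\<lambda>p. (fst p k, snd p k)) \<in> ?PA \<Otimes>\<^sub>M ?PB \<rightarrow>\<^sub>M
      (count_space UNIV \<Otimes>\<^sub>M borel_on {0<..}) \<Otimes>\<^sub>M borel_on punctured_space" for k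
    by (intro measurable_Pair measurable_compose[OF measurable_fst measurable_component_singleton]
        measurable_compose[OF measurable_snd measurable_component_singleton]) simp_all
  from measurable_compose[OF this e] have \<Phi>m: "\<Phi> \<in> borel_measurable (?PA \<Otimes>\<^sub>M ?PB)"
    unfolding \<Phi>_def by (intro borel_measurable_prod)
  have \<Phi>b: "\<bar>\<Phi> p\<bar> \<le> 1" for p
    unfolding \<Phi>_def abs_prod using bound by (intro prod_le_1) auto
  have "(\<integral>\<omega>. (\<Prod>k<m. e ((X k \<omega>, Z k \<omega>), Vs k \<omega>)) \<partial>M)
      = (\<integral>\<omega>. (\<integral>\<omega>'. (\<Prod>k<m. e ((X k \<omega>, Z k \<omega>), Vs k \<omega>')) \<partial>M) \<partial>M)"
    using M.expectation_of_independent_pair[OF A B indep \<Phi>m \<Phi>b] by (simp add: \<Phi>_def)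
  also have "\<dots> = (\<integral>\<omega>. (\<Prod>k<m. \<integral>v. e ((X k \<omega>, Z k \<omega>), V v) \<partial>N) \<partial>M)"
  proof (rule Bochner_Integration.integral_cong[OF refl])
    fix \<omega> assume \<omega>: "\<omega> \<in> space M"
    have ek: "(\<lambda>v. e ((X k \<omega>, Z k \<omega>), v)) \<in> borel_measurable (borel_on punctured_space)" for k
      using measurable_space[OF Z \<omega>, of k]
      by (intro measurable_compose[OF measurable_Pair1' e]) (simp add: space_pair_measure)
    have "(\<integral>\<omega>'. (\<Prod>k<m. e ((X k \<omega>, Z k \<omega>), Vs k \<omega>')) \<partial>M)
        = (\<Prod>k<m. \<integral>\<omega>'. e ((X k \<omega>, Z k \<omega>), Vs k \<omega>') \<partial>M)"
    proof (rule M.indep_vars_lebesgue_integral)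
      show "M.indep_vars (\<lambda>_. borel) (\<lambda>k \<omega>'. e ((X k \<omega>, Z k \<omega>), Vs k \<omega>')) {..<m}"
        by (rule M.indep_vars_compose2[OF M.indep_vars_subset[OF indep_V]]) (use ek in auto)
      show "integrable M (\<lambda>\<omega>'. e ((X k \<omega>, Z k \<omega>), Vs k \<omega>'))" for k
        using bound measurable_compose[OF Vs ek]
        by (intro M.integrable_const_bound[where B = 1]) auto
    qed simp
    also have "\<dots> = (\<Prod>k<m. \<integral>v. e ((X k \<omega>, Z k \<omega>), V v) \<partial>N)"
    proof (rule prod.cong[OF refl])
      fix k
      have "(\<integral>\<omega>'. e ((X k \<omega>, Z k \<omega>), Vs k \<omega>') \<partial>M)
          = (\<integral>v. e ((X k \<omega>, Z k \<omega>), v) \<partial>distr M (borel_on punctured_space) (Vs k))"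
        by (rule integral_distr[OF Vs ek, symmetric])
      also have "\<dots> = (\<integral>v. e ((X k \<omega>, Z k \<omega>), V v) \<partial>N)"
        unfolding law by (rule integral_distr[OF V ek])
      finally show "(\<integral>\<omega>'. e ((X k \<omega>, Z k \<omega>), Vs k \<omega>') \<partial>M) = (\<integral>v. e ((X k \<omega>, Z k \<omega>), V v) \<partial>N)" .
    qed
    finally show "(\<integral>\<omega>'. (\<Prod>k<m. e ((X k \<omega>, Z k \<omega>), Vs k \<omega>')) \<partial>M)
        = (\<Prod>k<m. \<integral>v. e ((X k \<omega>, Z k \<omega>), V v) \<partial>N)" .
  qed
  finally show ?thesis .
qed

text \<open>Averaging \<open>exp (- \<kappa> z * f (z V))\<close> over the mark and taking \<open>- ln\<close> gives the test function on the
  half-line at which an original process with weights \<open>0\<close> and \<open>1\<close> has the Laplace functional that its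
  uplift has at \<open>f\<close> (up to the factor \<open>\<kappa>\<close>). The weight \<open>\<kappa>\<close> forces compact support: without it, the function is in general
  positive on the whole half-line.\<close>

definition mark_exponent ::
  "'v measure \<Rightarrow> ('v \<Rightarrow> real ^ 'd) \<Rightarrow> (real \<Rightarrow> real) \<Rightarrow> (real ^ 'd \<Rightarrow> real) \<Rightarrow> real \<Rightarrow> real" where
  "mark_exponent N V \<kappa> f z = - ln (\<integral>v. exp (- (\<kappa> z * f (z *\<^sub>R V v))) \<partial>N)"

context
  fixes N :: "'v measure" and V :: "'v \<Rightarrow> real ^ 'd" and \<kappa> :: "real \<Rightarrow> real" and f :: "real ^ 'd \<Rightarrow> real"
    and a b :: real
  assumes N: "prob_space N" and V: "V \<in> N \<rightarrow>\<^sub>M borel_on punctured_space"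
    and f: "f \<in> C_hat punctured_space"
    and \<kappa>_cont: "continuous_on {0<..} \<kappa>"
    and \<kappa>_bounds: "\<And>z. 0 < z \<Longrightarrow> 0 \<le> \<kappa> z" "\<And>z. 0 < z \<Longrightarrow> \<kappa> z \<le> 1"
    and a: "0 < a" and \<kappa>_supp: "\<And>z. 0 < z \<Longrightarrow> z \<notin> {a..b} \<Longrightarrow> \<kappa> z = 0"
begin

lemma V_punctured: "v \<in> space N \<Longrightarrow> V v \<in> punctured_space"
  using measurable_space[OF V] by (simp add: space_restrict_space)

lemma f_scaled_nonneg: "0 < z \<Longrightarrow> w \<in> punctured_space \<Longrightarrow> 0 \<le> f (z *\<^sub>R w)"
  using C_hat_nonneg[OF f, of "z *\<^sub>R w"] by simp

lemma mark_factor_measurable: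
  "(\<lambda>((x, z), v). exp (- (real x * (\<kappa> z * f (z *\<^sub>R v)))))
     \<in> borel_measurable ((count_space UNIV \<Otimes>\<^sub>M borel_on {0<..}) \<Otimes>\<^sub>M borel_on punctured_space)"
proof -
  let ?P = "((count_space UNIV :: nat measure) \<Otimes>\<^sub>M borel_on {0 :: real<..}) \<Otimes>\<^sub>M borel_on (punctured_space :: (real ^ 'd) set)"
  have z: "(\<lambda>p. snd (fst p)) \<in> ?P \<rightarrow>\<^sub>M borel_on {0<..}" by simp
  have x: "(\<lambda>p. real (fst (fst p))) \<in> borel_measurable ?P"
    by (rule measurable_compose[OF measurable_compose[OF measurable_fst measurable_fst]]) simp
  have "(\<lambda>p. \<kappa> (snd (fst p))) \<in> borel_measurable ?P"
    by (rule measurable_compose[OF z borel_measurable_continuous_on_restrict[OF \<kappa>_cont]])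
  moreover have "(\<lambda>p. f (snd (fst p) *\<^sub>R snd p)) \<in> borel_measurable ?P"
    by (rule measurable_compose[OF scaled_measurable[OF z measurable_snd] C_hat_measurable[OF f]])
  ultimately have "(\<lambda>p. exp (- (real (fst (fst p)) * (\<kappa> (snd (fst p)) * f (snd (fst p) *\<^sub>R snd p)))))
      \<in> borel_measurable ?P" using x by simp
  then show ?thesis by (simp add: split_beta')
qed

lemma mark_factor_integrand_measurable:
  assumes "0 < z"
  shows "(\<lambda>v. exp (- (real x * (\<kappa> z * f (z *\<^sub>R V v))))) \<in> borel_measurable N"
proof -
  have "(\<lambda>v. z *\<^sub>R V v) \<in> N \<rightarrow>\<^sub>M borel_on punctured_space"
    using assms by (intro scaled_measurable[OF _ V] measurable_const) (simp add: space_restrict_space)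
  from measurable_compose[OF this C_hat_measurable[OF f]] show ?thesis by simp
qed

lemma mark_factor_bounds:
  assumes "0 < z" "v \<in> space N"
  shows "exp (- (real x * (\<kappa> z * f (z *\<^sub>R V v)))) \<le> 1"
  using \<kappa>_bounds(1)[OF assms(1)] f_scaled_nonneg[OF assms(1) V_punctured[OF assms(2)]] by simp

lemma mark_factor_integrable:
  assumes "0 < z"
  shows "integrable N (\<lambda>v. exp (- (real x * (\<kappa> z * f (z *\<^sub>R V v)))))"
proof -
  interpret prob_space N by (rule N)
  show ?thesis
    using mark_factor_bounds[OF assms] mark_factor_integrand_measurable[OF assms]
    by (intro integrable_const_bound[where B = 1] AE_I2) auto
qed

lemma mark_factor_expectation_bounds:
  assumes "0 < z"
  shows "0 < (\<integral>v. exp (- (real x * (\<kappa> z * f (z *\<^sub>R V v)))) \<partial>N)"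
    and "(\<integral>v. exp (- (real x * (\<kappa> z * f (z *\<^sub>R V v)))) \<partial>N) \<le> 1"
proof -
  interpret prob_space N by (rule N)
  note int = mark_factor_integrable[OF assms]
  have "(\<integral>v. exp (- (real x * (\<kappa> z * f (z *\<^sub>R V v)))) \<partial>N) \<le> (\<integral>v. 1 \<partial>N)"
    using mark_factor_bounds[OF assms] int by (intro integral_mono) auto
  then show "(\<integral>v. exp (- (real x * (\<kappa> z * f (z *\<^sub>R V v)))) \<partial>N) \<le> 1" by (simp add: prob_space)
  obtain B where B: "0 < B" "\<And>w. w \<in> punctured_space \<Longrightarrow> f w \<le> B" using C_hat_bounded[OF f] by metis
  have "(\<integral>v. exp (- (real x * B)) \<partial>N) \<le> (\<integral>v. exp (- (real x * (\<kappa> z * f (z *\<^sub>R V v)))) \<partial>N)"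
  proof (rule integral_mono[OF _ int])
    fix v assume v: "v \<in> space N"
    have "f (z *\<^sub>R V v) \<le> B" using B(2)[of "z *\<^sub>R V v"] V_punctured[OF v] assms by simp
    then have "\<kappa> z * f (z *\<^sub>R V v) \<le> 1 * B"
      using \<kappa>_bounds[OF assms] f_scaled_nonneg[OF assms V_punctured[OF v]] by (intro mult_mono) auto
    then show "exp (- (real x * B)) \<le> exp (- (real x * (\<kappa> z * f (z *\<^sub>R V v))))"
      by (simp add: mult_left_mono)
  qed simp
  then have "exp (- (real x * B)) \<le> (\<integral>v. exp (- (real x * (\<kappa> z * f (z *\<^sub>R V v)))) \<partial>N)"
    by (simp add: prob_space)
  then show "0 < (\<integral>v. exp (- (real x * (\<kappa> z * f (z *\<^sub>R V v)))) \<partial>N)"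
    by (rule less_le_trans[OF exp_gt_zero])
qed

text \<open>Only for multiplicity \<open>x \<le> 1\<close> is the averaged factor of the form \<open>exp (- x * g z)\<close>: for larger
  \<open>x\<close> all \<open>x\<close> copies of the point carry the same mark, and averaging does not commute with the
  power.\<close>

lemma mark_factor_expectation_eq:
  assumes "0 < z" and "x \<le> 1 \<or> z \<notin> {a..b}"
  shows "(\<integral>v. exp (- (real x * (\<kappa> z * f (z *\<^sub>R V v)))) \<partial>N) = exp (- (real x * mark_exponent N V \<kappa> f z))"
proof -
  interpret prob_space N by (rule N)
  consider "x = 0" | "x = 1" | "z \<notin> {a..b}" using assms(2) by linarith
  then show ?thesis
  proof cases
    case 1
    then show ?thesis by (simp add: prob_space)
  next
    case 2
    then show ?thesis
      using mark_factor_expectation_bounds(1)[OF assms(1), of 1] by (simp add: mark_exponent_def)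
  next
    case 3
    then show ?thesis using \<kappa>_supp[OF assms(1)] by (simp add: mark_exponent_def prob_space)
  qed
qed

lemma mark_exponent_in_C_hat: "mark_exponent N V \<kappa> f \<in> C_hat {0<..}"
proof -
  interpret prob_space N by (rule N)
  let ?E = "\<lambda>z. \<integral>v. exp (- (\<kappa> z * f (z *\<^sub>R V v))) \<partial>N"
  have bounds: "0 < ?E z" "?E z \<le> 1" if "0 < z" for z
    using mark_factor_expectation_bounds[OF that, of 1] by simp_all
  have contf: "continuous_on punctured_space f" using f by (simp add: C_hat_def)
  have "continuous_on {0<..} ?E"
    unfolding continuous_on_sequentially
  proof (intro allI ballI impI)
    fix u :: "nat \<Rightarrow> real" and z assume z: "z \<in> {0<..}" and u: "(\<forall>n. u n \<in> {0<..}) \<and> u \<longlonglongrightarrow> z"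
    have "(\<lambda>n. ?E (u n)) \<longlonglongrightarrow> ?E z"
    proof (rule integral_dominated_convergence[where w = "\<lambda>_. 1"])
      show "(\<lambda>v. exp (- (\<kappa> z * f (z *\<^sub>R V v)))) \<in> borel_measurable N"
        using mark_factor_integrand_measurable[of z 1] z by simp
      show "(\<lambda>v. exp (- (\<kappa> (u n) * f (u n *\<^sub>R V v)))) \<in> borel_measurable N" for n
        using mark_factor_integrand_measurable[of "u n" 1] u by simp
      show "AE v in N. norm (exp (- (\<kappa> (u n) * f (u n *\<^sub>R V v)))) \<le> 1" for n
        using mark_factor_bounds[of "u n" _ 1] u by (intro AE_I2) simp
      show "AE v in N. (\<lambda>n. exp (- (\<kappa> (u n) * f (u n *\<^sub>R V v)))) \<longlonglongrightarrow> exp (- (\<kappa> z * f (z *\<^sub>R V v)))"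
      proof (rule AE_I2)
        fix v assume v: "v \<in> space N"
        have "(\<lambda>n. \<kappa> (u n)) \<longlonglongrightarrow> \<kappa> z"
          using \<kappa>_cont u z by (intro continuous_on_tendsto_compose[OF \<kappa>_cont]) auto
        moreover have "(\<lambda>n. f (u n *\<^sub>R V v)) \<longlonglongrightarrow> f (z *\<^sub>R V v)"
        proof (rule continuous_on_tendsto_compose[OF contf])
          show "(\<lambda>n. u n *\<^sub>R V v) \<longlonglongrightarrow> z *\<^sub>R V v" using u by (intro tendsto_intros) auto
          show "z *\<^sub>R V v \<in> punctured_space" using V_punctured[OF v] z by simp
          show "\<forall>\<^sub>F n in sequentially. u n *\<^sub>R V v \<in> punctured_space"
            using V_punctured[OF v] u by (intro always_eventually allI) (auto simp: less_le)
        qed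
        ultimately show "(\<lambda>n. exp (- (\<kappa> (u n) * f (u n *\<^sub>R V v)))) \<longlonglongrightarrow> exp (- (\<kappa> z * f (z *\<^sub>R V v)))"
          by (intro tendsto_intros)
      qed
    qed simp
    then show "(?E \<circ> u) \<longlonglongrightarrow> ?E z" by (simp add: comp_def)
  qed
  then have "continuous_on {0<..} (mark_exponent N V \<kappa> f)"
    unfolding mark_exponent_def using bounds by (intro continuous_intros) fastforce+
  then show ?thesis
  proof (rule C_hatI)
    show "0 \<le> mark_exponent N V \<kappa> f z" if "z \<in> {0<..}" for z
      using bounds[of z] that by (simp add: mark_exponent_def)
    show "compact {a..b}" "{a..b} \<subseteq> {0<..}" using a by auto
    show "mark_exponent N V \<kappa> f z = 0" if "z \<in> {0<..}" "z \<notin> {a..b}" for z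
      using \<kappa>_supp[of z] that by (simp add: mark_exponent_def prob_space)
  qed
qed

text \<open>After averaging over the marks, the two integrands agree unless some point in \<open>[a, b]\<close>, which
  contains the support of \<open>\<kappa>\<close>, has weight at least two, and both lie between \<open>0\<close> and \<open>1\<close>. The averaging is done for
  the first \<open>m\<close> points, followed by the limit \<open>m \<rightarrow> \<infinity>\<close>.\<close>

lemma thinned_laplace_estimate:
  fixes M :: "'w measure" and Vs :: "nat \<Rightarrow> 'w \<Rightarrow> real ^ 'd"
  assumes M: "prob_space M" and pp: "represents_point_process {0<..} M X Z"
    and copies: "independent_iid_copies N V M Vs X Z"
  shows "\<bar>(\<integral>\<omega>. exp (- (\<Sum>k. real (X k \<omega>) * (\<kappa> (Z k \<omega>) * f (Z k \<omega> *\<^sub>R Vs k \<omega>)))) \<partial>M)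
          - (\<integral>\<omega>. exp (- (\<Sum>k. real (X k \<omega>) * mark_exponent N V \<kappa> f (Z k \<omega>))) \<partial>M)\<bar>
         \<le> measure M {\<omega>\<in>space M. \<exists>k. 2 \<le> X k \<omega> \<and> Z k \<omega> \<in> {a..b}}"
proof -
  interpret M: prob_space M by (rule M)
  interpret N: prob_space N by (rule N)
  let ?g = "mark_exponent N V \<kappa> f"
  let ?s = "\<lambda>k \<omega>. real (X k \<omega>) * (\<kappa> (Z k \<omega>) * f (Z k \<omega> *\<^sub>R Vs k \<omega>))"
  let ?t = "\<lambda>k \<omega>. real (X k \<omega>) * ?g (Z k \<omega>)"
  let ?bad = "{\<omega>\<in>space M. \<exists>k. 2 \<le> X k \<omega> \<and> Z k \<omega> \<in> {a..b}}"
  have X: "\<And>k. X k \<in> M \<rightarrow>\<^sub>M count_space UNIV" and Z: "\<And>k. Z k \<in> M \<rightarrow>\<^sub>M borel_on {0<..}"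
    and lf: "AE \<omega> in M. atomic_measure {0<..} (\<lambda>k. X k \<omega>) (\<lambda>k. Z k \<omega>) \<in> locally_finite_measures {0<..}"
    using pp by (auto simp: represents_point_process_def)
  have Vs: "\<And>k. Vs k \<in> M \<rightarrow>\<^sub>M borel_on punctured_space"
    using copies by (simp add: independent_iid_copies_def)
  have Zpos: "0 < Z k \<omega>" if "\<omega> \<in> space M" for k \<omega>
    using measurable_space[OF Z that] by (simp add: space_restrict_space)
  have Vpunct: "Vs k \<omega> \<in> punctured_space" if "\<omega> \<in> space M" for k \<omega>
    using measurable_space[OF Vs that] by (simp add: space_restrict_space)
  have Xm [measurable]: "(\<lambda>\<omega>. real (X k \<omega>)) \<in> borel_measurable M" for k
    using measurable_compose[OF X[of k], of real borel] by simp
  have [measurable]: "X k \<in> M \<rightarrow>\<^sub>M count_space UNIV" "Z k \<in> borel_measurable M" for k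
    using X Z by (auto dest: measurable_restrict_space2_iff[THEN iffD1])
  have [measurable]: "(\<lambda>\<omega>. \<kappa> (Z k \<omega>)) \<in> borel_measurable M" for k
    by (rule measurable_compose[OF Z borel_measurable_continuous_on_restrict[OF \<kappa>_cont]])
  have [measurable]: "(\<lambda>\<omega>. f (Z k \<omega> *\<^sub>R Vs k \<omega>)) \<in> borel_measurable M" for k
    by (rule measurable_compose[OF scaled_measurable[OF Z Vs] C_hat_measurable[OF f]])
  have [measurable]: "(\<lambda>\<omega>. ?g (Z k \<omega>)) \<in> borel_measurable M" for k
    by (rule measurable_compose[OF Z C_hat_measurable[OF mark_exponent_in_C_hat]])
  have [measurable]: "?bad \<in> sets M" by measurable
  have s0: "0 \<le> ?s k \<omega>" if "\<omega> \<in> space M" for k \<omega>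
    using \<kappa>_bounds(1)[OF Zpos[OF that]] f_scaled_nonneg[OF Zpos[OF that] Vpunct[OF that]] by simp
  have t0: "0 \<le> ?t k \<omega>" if "\<omega> \<in> space M" for k \<omega>
    using C_hat_nonneg[OF mark_exponent_in_C_hat, of "Z k \<omega>"] Zpos[OF that] by simp
  have fin: "AE \<omega> in M. finite {k. X k \<omega> \<noteq> 0 \<and> Z k \<omega> \<in> {a..b}}"
    using lf
  proof (rule AE_mp, intro AE_I2 impI)
    fix \<omega> assume \<omega>: "\<omega> \<in> space M"
      and L: "atomic_measure {0<..} (\<lambda>k. X k \<omega>) (\<lambda>k. Z k \<omega>) \<in> locally_finite_measures {0<..}"
    have "Z k \<omega> \<in> {0<..}" for k using Zpos[OF \<omega>] by simp
    from L[unfolded atomic_measure_locally_finite_iff[of "\<lambda>k. Z k \<omega>", OF this], rule_format, of "{a..b}"]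
    show "finite {k. X k \<omega> \<noteq> 0 \<and> Z k \<omega> \<in> {a..b}}" using a by fastforce
  qed
  have s_lim: "(\<lambda>m. \<integral>\<omega>. exp (- (\<Sum>k<m. ?s k \<omega>)) \<partial>M) \<longlonglongrightarrow> (\<integral>\<omega>. exp (- (\<Sum>k. ?s k \<omega>)) \<partial>M)"
  proof (rule integral_dominated_convergence[where w = "\<lambda>_. 1"])
    show "AE \<omega> in M. (\<lambda>m. exp (- (\<Sum>k<m. ?s k \<omega>))) \<longlonglongrightarrow> exp (- (\<Sum>k. ?s k \<omega>))"
      using fin
    proof (rule AE_mp, intro AE_I2 impI)
      fix \<omega> assume \<omega>: "\<omega> \<in> space M" and F: "finite {k. X k \<omega> \<noteq> 0 \<and> Z k \<omega> \<in> {a..b}}"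
      have "summable (\<lambda>k. ?s k \<omega>)"
        by (rule summable_finite[OF F]) (use \<kappa>_supp[OF Zpos[OF \<omega>]] in auto)
      then show "(\<lambda>m. exp (- (\<Sum>k<m. ?s k \<omega>))) \<longlonglongrightarrow> exp (- (\<Sum>k. ?s k \<omega>))"
        by (intro tendsto_intros summable_LIMSEQ)
    qed
    show "AE \<omega> in M. norm (exp (- (\<Sum>k<m. ?s k \<omega>))) \<le> 1" for m
      using s0 by (intro AE_I2) (simp add: sum_nonneg)
  qed simp_all
  have t_lim: "(\<lambda>m. \<integral>\<omega>. exp (- (\<Sum>k<m. ?t k \<omega>)) \<partial>M) \<longlonglongrightarrow> (\<integral>\<omega>. exp (- (\<Sum>k. ?t k \<omega>)) \<partial>M)"
  proof (rule integral_dominated_convergence[where w = "\<lambda>_. 1"])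
    show "AE \<omega> in M. (\<lambda>m. exp (- (\<Sum>k<m. ?t k \<omega>))) \<longlonglongrightarrow> exp (- (\<Sum>k. ?t k \<omega>))"
      using lf
    proof (rule AE_mp, intro AE_I2 impI)
      fix \<omega> assume \<omega>: "\<omega> \<in> space M"
        and L: "atomic_measure {0<..} (\<lambda>k. X k \<omega>) (\<lambda>k. Z k \<omega>) \<in> locally_finite_measures {0<..}"
      have "summable (\<lambda>k. ?t k \<omega>)"
        using Zpos[OF \<omega>] by (intro atomic_measure_summable[OF _ L mark_exponent_in_C_hat]) simp
      then show "(\<lambda>m. exp (- (\<Sum>k<m. ?t k \<omega>))) \<longlonglongrightarrow> exp (- (\<Sum>k. ?t k \<omega>))"
        by (intro tendsto_intros summable_LIMSEQ)
    qed
    show "AE \<omega> in M. norm (exp (- (\<Sum>k<m. ?t k \<omega>))) \<le> 1" for m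
      using t0 by (intro AE_I2) (simp add: sum_nonneg)
  qed simp_all
  have le: "\<bar>(\<integral>\<omega>. exp (- (\<Sum>k<m. ?s k \<omega>)) \<partial>M) - (\<integral>\<omega>. exp (- (\<Sum>k<m. ?t k \<omega>)) \<partial>M)\<bar> \<le> measure M ?bad" for m
  proof -
    \<comment> \<open>The factor is bounded only for admissible \<open>z\<close> and \<open>v\<close>, hence the default value \<open>0\<close>.\<close>
    define e where "e = (\<lambda>((x, z), v). if 0 < z \<and> v \<in> punctured_space then exp (- (real x * (\<kappa> z * f (z *\<^sub>R v)))) else (0::real))"
    have "e \<in> borel_measurable ((count_space UNIV \<Otimes>\<^sub>M borel_on {0<..}) \<Otimes>\<^sub>M borel_on punctured_space)"
      by (rule measurable_cong[THEN iffD2, OF _ mark_factor_measurable])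
        (auto simp: e_def space_pair_measure space_restrict_space split: if_splits)
    moreover have "\<bar>e p\<bar> \<le> 1" for p
      using \<kappa>_bounds(1) f_scaled_nonneg by (auto simp: e_def split_beta)
    ultimately have prod: "(\<integral>\<omega>. (\<Prod>k<m. e ((X k \<omega>, Z k \<omega>), Vs k \<omega>)) \<partial>M)
       = (\<integral>\<omega>. (\<Prod>k<m. \<integral>v. e ((X k \<omega>, Z k \<omega>), V v) \<partial>N) \<partial>M)"
      by (rule expectation_prod_iid_marks[OF M N V X Z copies])
    define Q where "Q = (\<lambda>\<omega>. \<Prod>k<m. \<integral>v. exp (- (real (X k \<omega>) * (\<kappa> (Z k \<omega>) * f (Z k \<omega> *\<^sub>R V v)))) \<partial>N)"
    have "(\<integral>\<omega>. exp (- (\<Sum>k<m. ?s k \<omega>)) \<partial>M) = (\<integral>\<omega>. (\<Prod>k<m. e ((X k \<omega>, Z k \<omega>), Vs k \<omega>)) \<partial>M)"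
    proof (rule Bochner_Integration.integral_cong[OF refl])
      fix \<omega> assume \<omega>: "\<omega> \<in> space M"
      have "exp (- (\<Sum>k<m. ?s k \<omega>)) = (\<Prod>k<m. exp (- ?s k \<omega>))"
        by (simp add: exp_sum sum_negf[symmetric])
      then show "exp (- (\<Sum>k<m. ?s k \<omega>)) = (\<Prod>k<m. e ((X k \<omega>, Z k \<omega>), Vs k \<omega>))"
        using Zpos[OF \<omega>] Vpunct[OF \<omega>] by (simp add: e_def)
    qed
    also have "\<dots> = (\<integral>\<omega>. Q \<omega> \<partial>M)"
      unfolding prod Q_def
    proof (intro Bochner_Integration.integral_cong[OF refl] prod.cong[OF refl])
      fix \<omega> k v assume "\<omega> \<in> space M" "v \<in> space N"
      then show "e ((X k \<omega>, Z k \<omega>), V v) = exp (- (real (X k \<omega>) * (\<kappa> (Z k \<omega>) * f (Z k \<omega> *\<^sub>R V v))))"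
        using Zpos V_punctured by (simp add: e_def)
    qed
    finally have sQ: "(\<integral>\<omega>. exp (- (\<Sum>k<m. ?s k \<omega>)) \<partial>M) = (\<integral>\<omega>. Q \<omega> \<partial>M)" .
    have Q01: "0 \<le> Q \<omega>" "Q \<omega> \<le> 1" if "\<omega> \<in> space M" for \<omega>
      unfolding Q_def using mark_factor_expectation_bounds(2)[OF Zpos[OF that]]
        mark_factor_expectation_bounds(1)[OF Zpos[OF that], THEN less_imp_le]
      by (auto intro!: prod_nonneg prod_le_1)
    have Qgood: "Q \<omega> = exp (- (\<Sum>k<m. ?t k \<omega>))" if "\<omega> \<in> space M" "\<omega> \<notin> ?bad" for \<omega>
    proof -
      have "X k \<omega> \<le> 1 \<or> Z k \<omega> \<notin> {a..b}" for k using that by force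
      then have "Q \<omega> = (\<Prod>k<m. exp (- ?t k \<omega>))"
        unfolding Q_def using mark_factor_expectation_eq[OF Zpos[OF that(1)]] by (intro prod.cong) auto
      then show ?thesis by (simp add: exp_sum sum_negf[symmetric])
    qed
    have [measurable]: "Q \<in> borel_measurable M"
      unfolding Q_def
    proof (intro borel_measurable_prod N.borel_measurable_lebesgue_integral)
      fix k
      have "(\<lambda>p. ((X k (fst p), Z k (fst p)), V (snd p))) \<in> M \<Otimes>\<^sub>M N \<rightarrow>\<^sub>M
          (count_space UNIV \<Otimes>\<^sub>M borel_on {0<..}) \<Otimes>\<^sub>M borel_on punctured_space"
        by (intro measurable_Pair measurable_compose[OF measurable_fst X] measurable_compose[OF measurable_fst Z]
            measurable_compose[OF measurable_snd V])
      from measurable_compose[OF this mark_factor_measurable]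
      show "(\<lambda>(\<omega>, v). exp (- (real (X k \<omega>) * (\<kappa> (Z k \<omega>) * f (Z k \<omega> *\<^sub>R V v))))) \<in> borel_measurable (M \<Otimes>\<^sub>M N)"
        by (simp add: split_beta')
    qed
    have intQ: "integrable M Q"
      using Q01 by (intro M.integrable_const_bound[where B = 1] AE_I2) auto
    have intt: "integrable M (\<lambda>\<omega>. exp (- (\<Sum>k<m. ?t k \<omega>)))"
      using t0 by (intro M.integrable_const_bound[where B = 1] AE_I2) (auto simp: sum_nonneg)
    have "\<bar>(\<integral>\<omega>. Q \<omega> \<partial>M) - (\<integral>\<omega>. exp (- (\<Sum>k<m. ?t k \<omega>)) \<partial>M)\<bar>
        \<le> (\<integral>\<omega>. \<bar>Q \<omega> - exp (- (\<Sum>k<m. ?t k \<omega>))\<bar> \<partial>M)"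
      using integral_abs_bound[of M "\<lambda>\<omega>. Q \<omega> - exp (- (\<Sum>k<m. ?t k \<omega>))"] intQ intt by simp
    also have "\<dots> \<le> (\<integral>\<omega>. indicator ?bad \<omega> \<partial>M)"
    proof (rule integral_mono)
      fix \<omega> assume \<omega>: "\<omega> \<in> space M"
      have "0 \<le> (\<Sum>k<m. ?t k \<omega>)" using t0[OF \<omega>] by (intro sum_nonneg)
      then have "exp (- (\<Sum>k<m. ?t k \<omega>)) \<le> 1" by simp
      then have "\<bar>Q \<omega> - exp (- (\<Sum>k<m. ?t k \<omega>))\<bar> \<le> 1"
        using Q01[OF \<omega>] exp_ge_zero[of "- (\<Sum>k<m. ?t k \<omega>)"] by linarith
      then show "\<bar>Q \<omega> - exp (- (\<Sum>k<m. ?t k \<omega>))\<bar> \<le> indicator ?bad \<omega>"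
        using Qgood[OF \<omega>] by (cases "\<omega> \<in> ?bad") auto
    next
      show "integrable M (\<lambda>\<omega>. \<bar>Q \<omega> - exp (- (\<Sum>k<m. ?t k \<omega>))\<bar>)" using intQ intt by simp
    qed (auto simp: M.emeasure_eq_measure)
    also have "\<dots> = measure M ?bad" by simp
    finally show ?thesis unfolding sQ .
  qed
  show ?thesis
    by (rule LIMSEQ_le_const2[OF tendsto_rabs[OF tendsto_diff[OF s_lim t_lim]]]) (use le in blast)
qed

end

section \<open>Multiple points disappear in a simple limit\<close>

lemma continuous_map_vague_integral:
  assumes "f \<in> C_hat S"
  shows "continuous_map (vague_topology S) euclideanreal (\<lambda>\<mu>. \<integral>x. f x \<partial>\<mu>)"
  unfolding continuous_map_def
proof (intro conjI allI impI)
  fix U :: "real set" assume "openin euclideanreal U"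
  then have "{\<mu> \<in> locally_finite_measures S. (\<integral>x. f x \<partial>\<mu>) \<in> U}
      \<in> {{\<mu> \<in> locally_finite_measures S. (\<integral>x. f x \<partial>\<mu>) \<in> U} |f U. f \<in> C_hat S \<and> open U}"
    using assms by auto
  then show "openin (vague_topology S) {\<mu> \<in> topspace (vague_topology S). (\<integral>x. f x \<partial>\<mu>) \<in> U}"
    unfolding topspace_vague_topology unfolding vague_topology_def
    by (rule topology_generated_by_Basis)
qed simp

lemma borel_measurable_continuous_map:
  assumes h: "continuous_map T euclideanreal h"
  shows "h \<in> borel_measurable (borel_of T)"
proof (rule borel_measurableI)
  fix U :: "real set" assume "open U"
  then have "openin T {x \<in> topspace T. h x \<in> U}"
    using openin_continuous_map_preimage[OF h] by simp
  then have "{x \<in> topspace T. h x \<in> U} \<in> sets (borel_of T)"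
    unfolding borel_of_def by (intro in_measure_of) (auto dest: openin_subset)
  moreover have "h -` U \<inter> space (borel_of T) = {x \<in> topspace T. h x \<in> U}"
    unfolding borel_of_def by (subst space_measure_of) (auto dest: openin_subset)
  ultimately show "h -` U \<inter> space (borel_of T) \<in> sets (borel_of T)" by simp
qed

definition bump :: "real \<Rightarrow> real \<Rightarrow> real \<Rightarrow> real" where
  "bump \<delta> c z = max 0 (min 1 (2 - \<bar>z - c\<bar> / \<delta>))"

lemma bump_nonneg: "0 \<le> bump \<delta> c z" and bump_le_1: "bump \<delta> c z \<le> 1"
  by (auto simp: bump_def)

lemma bump_eq_1: "0 < \<delta> \<Longrightarrow> \<bar>z - c\<bar> \<le> \<delta> \<Longrightarrow> bump \<delta> c z = 1"
  by (simp add: bump_def max_def min_def field_simps)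

lemma bump_eq_0: "0 < \<delta> \<Longrightarrow> 2 * \<delta> \<le> \<bar>z - c\<bar> \<Longrightarrow> bump \<delta> c z = 0"
  by (simp add: bump_def max_def min_def field_simps)

lemma bump_in_C_hat:
  assumes "0 < \<delta>" "2 * \<delta> < c"
  shows "bump \<delta> c \<in> C_hat {0<..}"
proof (rule C_hatI)
  show "continuous_on {0<..} (bump \<delta> c)"
    unfolding bump_def using assms by (intro continuous_intros) auto
  show "compact {c - 2 * \<delta>..c + 2 * \<delta>}" "{c - 2 * \<delta>..c + 2 * \<delta>} \<subseteq> {0<..}" using assms by auto
  show "bump \<delta> c z = 0" if "z \<notin> {c - 2 * \<delta>..c + 2 * \<delta>}" for z
    using that assms by (intro bump_eq_0) (auto simp: abs_if)
qed (rule bump_nonneg)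

text \<open>A vaguely continuous functional that detects clusters. The bumps are centred at a grid of mesh \<open>\<delta>\<close>
  and equal \<open>1\<close> up to distance \<open>\<delta>\<close>, so every point of \<open>[a, b]\<close> lies on the plateau of some bump,
  and an atom of mass two there makes the functional equal to \<open>1\<close>. Conversely, the functional
  vanishes as soon as no bump sees more than one unit atom.\<close>

definition crowding :: "real \<Rightarrow> real \<Rightarrow> real \<Rightarrow> real measure \<Rightarrow> real" where
  "crowding a b \<delta> \<mu> =
     min 1 (\<Sum>j\<le>nat \<lfloor>(b - a) / \<delta>\<rfloor>. max 0 ((\<integral>z. bump \<delta> (a + real j * \<delta>) z \<partial>\<mu>) - 1))"

lemma crowding_bounds: "0 \<le> crowding a b \<delta> \<mu>" "crowding a b \<delta> \<mu> \<le> 1"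
  by (auto simp: crowding_def intro!: sum_nonneg)

lemma grid_bump_in_C_hat:
  assumes "0 < \<delta>" "2 * \<delta> < a"
  shows "bump \<delta> (a + real j * \<delta>) \<in> C_hat {0<..}"
proof (rule bump_in_C_hat)
  have "0 \<le> real j * \<delta>" using assms by simp
  then show "2 * \<delta> < a + real j * \<delta>" using assms by linarith
qed (rule assms(1))

lemma continuous_map_crowding:
  assumes "0 < \<delta>" "2 * \<delta> < a"
  shows "continuous_map (vague_topology {0<..}) euclideanreal (crowding a b \<delta>)"
  unfolding crowding_def
  by (intro continuous_map_real_min continuous_map_sum continuous_map_real_max continuous_map_diff
      continuous_map_vague_integral grid_bump_in_C_hat assms) simp_all

lemma crowding_eq_1:
  assumes z: "\<And>k. z k \<in> {0<..}" and L: "atomic_measure {0<..} x z \<in> locally_finite_measures {0<..}"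
    and \<delta>: "0 < \<delta>" "2 * \<delta> < a" and k: "2 \<le> x k" "z k \<in> {a..b}"
  shows "crowding a b \<delta> (atomic_measure {0<..} x z) = 1"
proof -
  let ?\<mu> = "atomic_measure {0<..} x z"
  define j where "j = nat \<lfloor>(z k - a) / \<delta>\<rfloor>"
  have j: "real j \<le> (z k - a) / \<delta>" "(z k - a) / \<delta> < real j + 1"
    using k(2) \<delta>(1) by (auto simp: j_def)
  then have "real j * \<delta> \<le> z k - a" "z k - a < real j * \<delta> + \<delta>" using \<delta>(1) by (auto simp: field_simps)
  then have "bump \<delta> (a + real j * \<delta>) (z k) = 1" using \<delta>(1) by (intro bump_eq_1) auto
  note C = grid_bump_in_C_hat[OF \<delta>, of j]
  have "2 \<le> real (x k) * bump \<delta> (a + real j * \<delta>) (z k)"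
    using k(1) \<open>bump \<delta> (a + real j * \<delta>) (z k) = 1\<close> by simp
  also have "\<dots> \<le> (\<Sum>k. real (x k) * bump \<delta> (a + real j * \<delta>) (z k))"
    using sum_le_suminf[OF atomic_measure_summable[of z, OF z L C], of "{k}"] bump_nonneg by simp
  also have "\<dots> = (\<integral>z. bump \<delta> (a + real j * \<delta>) z \<partial>?\<mu>)"
    by (rule integral_atomic_measure[of z, OF z L C, symmetric])
  finally have "1 \<le> max 0 ((\<integral>z. bump \<delta> (a + real j * \<delta>) z \<partial>?\<mu>) - 1)" by simp
  also have "\<dots> \<le> (\<Sum>j\<le>nat \<lfloor>(b - a) / \<delta>\<rfloor>. max 0 ((\<integral>z. bump \<delta> (a + real j * \<delta>) z \<partial>?\<mu>) - 1))"
  proof (rule member_le_sum)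
    show "j \<in> {..nat \<lfloor>(b - a) / \<delta>\<rfloor>}"
      using k(2) \<delta>(1) by (auto simp: j_def intro!: nat_mono floor_mono divide_right_mono)
  qed auto
  finally show ?thesis by (simp add: crowding_def)
qed

text \<open>A simple measure has no repeated index either: two indices with the same location would add up to an
  atom of mass two.\<close>

lemma simple_atomic_measure:
  fixes S :: "'a::t2_space set"
  assumes z: "\<And>k. z k \<in> S"
    and simple: "\<And>p. p \<in> S \<Longrightarrow> emeasure (atomic_measure S x z) {p} \<noteq> 0 \<Longrightarrow> emeasure (atomic_measure S x z) {p} = 1"
  shows "x k \<le> 1" and "k \<noteq> l \<Longrightarrow> x k \<noteq> 0 \<Longrightarrow> x l \<noteq> 0 \<Longrightarrow> z k \<noteq> z l"
proof -
  have mass: "(\<Sum>i\<in>F. of_nat (x i)) \<le> (1 :: ennreal)"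
    if F: "finite F" "\<And>i. i \<in> F \<Longrightarrow> z i = p" and p: "p \<in> S" for F p
  proof -
    have "(\<Sum>i\<in>F. of_nat (x i)) = (\<Sum>i\<in>F. of_nat (x i) * indicator {p} (z i) :: ennreal)"
      using F(2) by (intro sum.cong) auto
    also have "\<dots> \<le> (\<Sum>i. of_nat (x i) * indicator {p} (z i))"
      by (rule sum_le_suminf) (use F in auto)
    also have "\<dots> = emeasure (atomic_measure S x z) {p}"
      using p by (intro emeasure_atomic_measure[OF z, symmetric] compact_sets_borel_on) auto
    also have "\<dots> \<le> 1" using simple[OF p] by (cases "emeasure (atomic_measure S x z) {p} = 0") auto
    finally show ?thesis .
  qed
  have "(\<Sum>i\<in>{k}. of_nat (x i)) \<le> (1 :: ennreal)"
    by (rule mass[of _ "z k"]) (auto simp: z)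
  then have "(of_nat (x k) :: ennreal) \<le> of_nat 1" by simp
  then show "x k \<le> 1" by (simp only: of_nat_le_iff)
  assume kl: "k \<noteq> l" "x k \<noteq> 0" "x l \<noteq> 0"
  show "z k \<noteq> z l"
  proof
    assume "z k = z l"
    have "(\<Sum>i\<in>{k, l}. of_nat (x i)) \<le> (1 :: ennreal)"
      by (rule mass[of _ "z k"]) (auto simp: \<open>z k = z l\<close> z)
    then have "(of_nat (x k + x l) :: ennreal) \<le> of_nat 1" using kl(1) by simp
    then have "x k + x l \<le> 1" by (simp only: of_nat_le_iff)
    with kl show False by simp
  qed
qed

lemma AE_simple_multiplicity:
  fixes S :: "'a::t2_space set"
  assumes pp: "represents_point_process S M X Z"
    and simple: "simple_point_process S M (random_atomic_measure S X Z)"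
  shows "AE \<omega> in M. \<forall>k. X k \<omega> \<le> 1"
proof -
  have Z: "\<And>k. Z k \<in> M \<rightarrow>\<^sub>M borel_on S"
    and lf: "AE \<omega> in M. atomic_measure S (\<lambda>k. X k \<omega>) (\<lambda>k. Z k \<omega>) \<in> locally_finite_measures S"
    using pp by (auto simp: represents_point_process_def)
  have "AE \<omega> in M. \<forall>k. Z k \<omega> \<in> S"
    using measurable_space[OF Z] unfolding space_restrict_space by (intro AE_I2) blast
  with lf simple[unfolded simple_point_process_def] show ?thesis
  proof eventually_elim
    case (elim \<omega>)
    have eq: "random_atomic_measure S X Z \<omega> = atomic_measure S (\<lambda>k. X k \<omega>) (\<lambda>k. Z k \<omega>)"
      using elim(1) by (simp add: random_atomic_measure_def)
    show ?case
      using simple_atomic_measure(1)[of "\<lambda>k. Z k \<omega>" S "\<lambda>k. X k \<omega>", OF elim(3)[rule_format]] elim(2)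
      unfolding eq by blast
  qed
qed

lemma finite_separation:
  fixes z :: "'i \<Rightarrow> real"
  assumes "finite A" "inj_on z A"
  obtains D where "0 < D" "\<And>k l. k \<in> A \<Longrightarrow> l \<in> A \<Longrightarrow> k \<noteq> l \<Longrightarrow> D \<le> \<bar>z k - z l\<bar>"
proof -
  define P where "P = (\<lambda>p. \<bar>z (fst p) - z (snd p)\<bar>) ` {p \<in> A \<times> A. fst p \<noteq> snd p}"
  have fin: "finite (insert 1 P)"
    unfolding P_def by (intro finite.insertI finite_imageI, rule finite_subset[of _ "A \<times> A"])
      (use assms(1) in auto)
  have pos: "0 < d" if "d \<in> insert 1 P" for d
  proof (cases "d = 1")
    case False
    with that have "d \<in> P" by simp
    then obtain p where p: "d = \<bar>z (fst p) - z (snd p)\<bar>" "p \<in> {p \<in> A \<times> A. fst p \<noteq> snd p}"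
      unfolding P_def by (rule imageE)
    then have "z (fst p) \<noteq> z (snd p)" using inj_onD[OF assms(2), of "fst p" "snd p"] by auto
    then show ?thesis using p(1) by simp
  qed simp
  show ?thesis
  proof (rule that[of "Min (insert 1 P)"])
    show "0 < Min (insert 1 P)" using Min_in[OF fin] pos by blast
    fix k l assume "k \<in> A" "l \<in> A" "k \<noteq> l"
    then have "\<bar>z k - z l\<bar> \<in> insert 1 P"
      unfolding P_def by (intro insertI2 image_eqI[of _ _ "(k, l)"]) simp_all
    then show "Min (insert 1 P) \<le> \<bar>z k - z l\<bar>" by (rule Min_le[OF fin])
  qed
qed

text \<open>Only finitely many atoms meet the supports of the bumps, and they are distinct. Once \<open>4 * \<delta>\<close> is
  less than their smallest distance, a bump, whose support has length \<open>4 * \<delta>\<close>, contains at most one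
  of them.\<close>

lemma crowding_eq_0:
  assumes z: "\<And>k. z k \<in> {0<..}" and L: "atomic_measure {0<..} x z \<in> locally_finite_measures {0<..}"
    and simple: "\<And>p. p \<in> {0<..} \<Longrightarrow> emeasure (atomic_measure {0<..} x z) {p} \<noteq> 0
                   \<Longrightarrow> emeasure (atomic_measure {0<..} x z) {p} = 1"
    and "0 < a" "a \<le> b"
  obtains \<delta>0 where "0 < \<delta>0" "\<And>\<delta>. 0 < \<delta> \<Longrightarrow> \<delta> < \<delta>0 \<Longrightarrow> crowding a b \<delta> (atomic_measure {0<..} x z) = 0"
proof -
  let ?\<mu> = "atomic_measure {0<..} x z"
  \<comment> \<open>For \<open>\<delta> < a / 4\<close> all bumps centred in \<open>[a, b]\<close> are supported in \<open>[a / 2, b + a]\<close>.\<close>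
  define A where "A = {k. x k \<noteq> 0 \<and> z k \<in> {a / 2..b + a}}"
  have "compact {a / 2..b + a}" "{a / 2..b + a} \<subseteq> {0<..}" using \<open>0 < a\<close> by auto
  then have "finite A"
    using L unfolding A_def atomic_measure_locally_finite_iff[of z, OF z] by blast
  moreover have "inj_on z A"
  proof (rule inj_onI, rule ccontr)
    fix k l assume "k \<in> A" "l \<in> A" "z k = z l" "k \<noteq> l"
    then show False using simple_atomic_measure(2)[where z = z and x = x, OF z simple, of k l] by (simp add: A_def)
  qed
  ultimately obtain D where D: "0 < D" "\<And>k l. k \<in> A \<Longrightarrow> l \<in> A \<Longrightarrow> k \<noteq> l \<Longrightarrow> D \<le> \<bar>z k - z l\<bar>"
    using finite_separation by metis
  show ?thesis
  proof (rule that[of "min (D / 4) (a / 4)"])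
    show "0 < min (D / 4) (a / 4)" using D \<open>0 < a\<close> by simp
    fix \<delta> assume \<delta>: "0 < \<delta>" "\<delta> < min (D / 4) (a / 4)"
    have "(\<integral>z. bump \<delta> (a + real j * \<delta>) z \<partial>?\<mu>) \<le> 1" if j: "j \<le> nat \<lfloor>(b - a) / \<delta>\<rfloor>" for j
    proof -
      let ?c = "a + real j * \<delta>"
      have C: "bump \<delta> ?c \<in> C_hat {0<..}" using \<delta> \<open>0 < a\<close> by (intro grid_bump_in_C_hat) auto
      have "0 \<le> (b - a) / \<delta>" using \<open>a \<le> b\<close> \<delta>(1) by simp
      then have "real j \<le> (b - a) / \<delta>" using j by linarith
      then have c: "a \<le> ?c" "?c \<le> b" using \<delta>(1) by (auto simp: field_simps)
      have near: "\<bar>z k - ?c\<bar> < 2 * \<delta>" if "bump \<delta> ?c (z k) \<noteq> 0" for k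
        using that bump_eq_0[OF \<delta>(1), of "z k" ?c] by linarith
      have inA: "k \<in> A" if "x k \<noteq> 0" "bump \<delta> ?c (z k) \<noteq> 0" for k
      proof -
        have "4 * \<delta> < a" using \<delta>(2) by simp
        then have "a / 2 \<le> z k" "z k \<le> b + a"
          using near[OF that(2)] c unfolding abs_less_iff by linarith+
        then show ?thesis using that(1) by (simp add: A_def)
      qed
      have uniq: "k = l" if "x k \<noteq> 0" "bump \<delta> ?c (z k) \<noteq> 0" "x l \<noteq> 0" "bump \<delta> ?c (z l) \<noteq> 0" for k l
      proof (rule ccontr)
        assume "k \<noteq> l"
        then have "D \<le> \<bar>z k - z l\<bar>" using D(2) inA that by blast
        then show False using near[OF that(2)] near[OF that(4)] \<delta> by linarith
      qed
      have "(\<Sum>k. real (x k) * bump \<delta> ?c (z k)) \<le> 1"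
      proof (cases "\<exists>k. x k \<noteq> 0 \<and> bump \<delta> ?c (z k) \<noteq> 0")
        case True
        then obtain k where k: "x k \<noteq> 0" "bump \<delta> ?c (z k) \<noteq> 0" by blast
        have "(\<Sum>k. real (x k) * bump \<delta> ?c (z k)) = (\<Sum>k\<in>{k}. real (x k) * bump \<delta> ?c (z k))"
          by (rule suminf_finite) (use uniq k in auto)
        also have "\<dots> \<le> 1 * 1"
        proof -
          have "real (x k) \<le> 1" using simple_atomic_measure(1)[where z = z and x = x, OF z simple] by simp
          then have "real (x k) * bump \<delta> ?c (z k) \<le> 1 * 1"
            using bump_le_1 bump_nonneg by (intro mult_mono) auto
          then show ?thesis by simp
        qed
        finally show ?thesis by simp
      next
        case False
        then have "(\<Sum>k. real (x k) * bump \<delta> ?c (z k)) = (\<Sum>k. 0)" by (intro suminf_cong) auto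
        then show ?thesis by simp
      qed
      then show ?thesis unfolding integral_atomic_measure[of z, OF z L C] .
    qed
    then show "crowding a b \<delta> ?\<mu> = 0" by (simp add: crowding_def)
  qed
qed

text \<open>The event has no continuous indicator, but it is dominated by the crowding functional at every scale
  \<open>\<delta>\<close>. Convergence in distribution moves the expectation of that functional to the limit process,
  where it tends to \<open>0\<close> as \<open>\<delta> \<rightarrow> 0\<close> because the limit is simple.\<close>

lemma multiple_points_vanish:
  fixes a b :: real and M :: "'w measure" and M' :: "'u measure"
  assumes M: "prob_space M" and M': "prob_space M'"
    and pp: "\<And>n. represents_point_process {0<..} M (X n) (Z n)"
    and pp': "represents_point_process {0<..} M' X' Z'"
    and simple: "simple_point_process {0<..} M' (random_atomic_measure {0<..} X' Z')"
    and conv: "converges_in_distribution (vague_topology {0<..})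
                 M (\<lambda>n. random_atomic_measure {0<..} (X n) (Z n))
                 M' (random_atomic_measure {0<..} X' Z')"
    and a: "0 < a" and ab: "a \<le> b"
  shows "(\<lambda>n. measure M {\<omega>\<in>space M. \<exists>k. 2 \<le> X n k \<omega> \<and> Z n k \<omega> \<in> {a..b}}) \<longlonglongrightarrow> 0"
proof (rule LIMSEQ_I)
  interpret M: prob_space M by (rule M)
  interpret M': prob_space M' by (rule M')
  let ?\<xi> = "\<lambda>n. random_atomic_measure {0<..} (X n) (Z n)"
  let ?\<xi>' = "random_atomic_measure {0<..} X' Z'"
  let ?bad = "\<lambda>n. {\<omega>\<in>space M. \<exists>k. 2 \<le> X n k \<omega> \<and> Z n k \<omega> \<in> {a..b}}"
  \<comment> \<open>Any null sequence of scales below \<open>a / 2\<close>, so that the bumps live on the open half-line.\<close>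
  define d :: "nat \<Rightarrow> real" where "d i = a / (4 * (real i + 1))" for i
  have d: "0 < d i" "2 * d i < a" for i
    using a by (auto simp: d_def field_simps intro: add_pos_nonneg)
  have d0: "d \<longlonglongrightarrow> 0"
    unfolding d_def by real_asymp
  note cont = continuous_map_crowding[OF d, where b = b]
  have meas': "(\<lambda>\<omega>. crowding a b (d i) (?\<xi>' \<omega>)) \<in> borel_measurable M'" for i
    using conv unfolding converges_in_distribution_def
    by (intro measurable_compose[OF _ borel_measurable_continuous_map[OF cont]]) blast
  have meas: "(\<lambda>\<omega>. crowding a b (d i) (?\<xi> n \<omega>)) \<in> borel_measurable M" for i n
    using conv unfolding converges_in_distribution_def
    by (intro measurable_compose[OF _ borel_measurable_continuous_map[OF cont]]) blast
  fix e :: real assume e: "0 < e"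
  have "(\<lambda>i. \<integral>\<omega>. crowding a b (d i) (?\<xi>' \<omega>) \<partial>M') \<longlonglongrightarrow> (\<integral>\<omega>. 0 \<partial>M')"
  proof (rule integral_dominated_convergence[where w = "\<lambda>_. 1"])
    have "AE \<omega> in M'. atomic_measure {0<..} (\<lambda>k. X' k \<omega>) (\<lambda>k. Z' k \<omega>) \<in> locally_finite_measures {0<..}"
      using pp' by (simp add: represents_point_process_def)
    moreover have "AE \<omega> in M'. \<forall>p\<in>{0<..}. emeasure (?\<xi>' \<omega>) {p} \<noteq> 0 \<longrightarrow> emeasure (?\<xi>' \<omega>) {p} = 1"
      using simple by (simp add: simple_point_process_def)
    moreover have "AE \<omega> in M'. \<forall>k. Z' k \<omega> \<in> {0<..}"
      using pp' by (intro AE_I2) (auto simp: represents_point_process_def space_restrict_space dest!: spec measurable_space)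
    ultimately show "AE \<omega> in M'. (\<lambda>i. crowding a b (d i) (?\<xi>' \<omega>)) \<longlonglongrightarrow> 0"
    proof eventually_elim
      case (elim \<omega>)
      have eq: "?\<xi>' \<omega> = atomic_measure {0<..} (\<lambda>k. X' k \<omega>) (\<lambda>k. Z' k \<omega>)"
        using elim(1) by (simp add: random_atomic_measure_def)
      have s: "emeasure (atomic_measure {0<..} (\<lambda>k. X' k \<omega>) (\<lambda>k. Z' k \<omega>)) {p} = 1"
        if "p \<in> {0<..}" "emeasure (atomic_measure {0<..} (\<lambda>k. X' k \<omega>) (\<lambda>k. Z' k \<omega>)) {p} \<noteq> 0" for p
        using elim(2) that unfolding eq by blast
      obtain \<delta>0 where \<delta>0: "0 < \<delta>0" "\<And>\<delta>. 0 < \<delta> \<Longrightarrow> \<delta> < \<delta>0 \<Longrightarrow> crowding a b \<delta> (?\<xi>' \<omega>) = 0"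
        unfolding eq by (rule crowding_eq_0[of "\<lambda>k. Z' k \<omega>", OF elim(3)[rule_format] elim(1) s a ab]) blast+
      have "\<forall>\<^sub>F i in sequentially. crowding a b (d i) (?\<xi>' \<omega>) = 0"
        using order_tendstoD(2)[OF d0 \<delta>0(1)] by eventually_elim (use \<delta>0(2) d(1) in blast)
      then show ?case by (rule tendsto_eventually)
    qed
    show "AE \<omega> in M'. norm (crowding a b (d i) (?\<xi>' \<omega>)) \<le> 1" for i
      using crowding_bounds by (intro AE_I2) simp
  qed (use meas' in simp_all)
  then have "(\<lambda>i. \<integral>\<omega>. crowding a b (d i) (?\<xi>' \<omega>) \<partial>M') \<longlonglongrightarrow> 0" by simp
  from eventually_happens'[OF sequentially_bot order_tendstoD(2)[OF this e]]
  obtain i where i: "(\<integral>\<omega>. crowding a b (d i) (?\<xi>' \<omega>) \<partial>M') < e" ..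
  have "(\<lambda>n. \<integral>\<omega>. crowding a b (d i) (?\<xi> n \<omega>) \<partial>M) \<longlonglongrightarrow> (\<integral>\<omega>. crowding a b (d i) (?\<xi>' \<omega>) \<partial>M')"
  proof -
    have "bounded (crowding a b (d i) ` topspace (vague_topology {0<..}))"
      using crowding_bounds by (auto simp: bounded_iff intro!: exI[of _ 1])
    with conv cont show ?thesis unfolding converges_in_distribution_def by blast
  qed
  from order_tendstoD(2)[OF this i]
  obtain n0 where n0: "\<And>n. n \<ge> n0 \<Longrightarrow> (\<integral>\<omega>. crowding a b (d i) (?\<xi> n \<omega>) \<partial>M) < e"
    by (auto simp: eventually_sequentially)
  have le: "measure M (?bad n) \<le> (\<integral>\<omega>. crowding a b (d i) (?\<xi> n \<omega>) \<partial>M)" for n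
  proof -
    have X: "\<And>k. X n k \<in> M \<rightarrow>\<^sub>M count_space UNIV" and Z: "\<And>k. Z n k \<in> M \<rightarrow>\<^sub>M borel_on {0<..}"
      and lf: "AE \<omega> in M. atomic_measure {0<..} (\<lambda>k. X n k \<omega>) (\<lambda>k. Z n k \<omega>) \<in> locally_finite_measures {0<..}"
      using pp by (auto simp: represents_point_process_def)
    have [measurable]: "X n k \<in> M \<rightarrow>\<^sub>M count_space UNIV" "Z n k \<in> borel_measurable M" for k
      using X Z by (auto dest: measurable_restrict_space2_iff[THEN iffD1])
    have [measurable]: "?bad n \<in> sets M" by measurable
    have "measure M (?bad n) = (\<integral>\<omega>. indicator (?bad n) \<omega> \<partial>M)" by simp
    also have "\<dots> \<le> (\<integral>\<omega>. crowding a b (d i) (?\<xi> n \<omega>) \<partial>M)"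
    proof (rule integral_mono_AE)
      show "integrable M (\<lambda>\<omega>. indicator (?bad n) \<omega> :: real)" by (simp add: M.emeasure_eq_measure)
      show "integrable M (\<lambda>\<omega>. crowding a b (d i) (?\<xi> n \<omega>))"
        using crowding_bounds meas by (intro M.integrable_const_bound[where B = 1] AE_I2) auto
      show "AE \<omega> in M. indicator (?bad n) \<omega> \<le> crowding a b (d i) (?\<xi> n \<omega>)"
        using lf
      proof (rule AE_mp, intro AE_I2 impI)
        fix \<omega> assume \<omega>: "\<omega> \<in> space M"
          and L: "atomic_measure {0<..} (\<lambda>k. X n k \<omega>) (\<lambda>k. Z n k \<omega>) \<in> locally_finite_measures {0<..}"
        have z: "Z n k \<omega> \<in> {0<..}" for k
          using measurable_space[OF Z \<omega>] by (simp add: space_restrict_space)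
        have eq: "?\<xi> n \<omega> = atomic_measure {0<..} (\<lambda>k. X n k \<omega>) (\<lambda>k. Z n k \<omega>)"
          using L by (simp add: random_atomic_measure_def)
        show "indicator (?bad n) \<omega> \<le> crowding a b (d i) (?\<xi> n \<omega>)"
        proof (cases "\<omega> \<in> ?bad n")
          case True
          then obtain k where "2 \<le> X n k \<omega>" "Z n k \<omega> \<in> {a..b}" by blast
          from crowding_eq_1[of "\<lambda>k. Z n k \<omega>", OF z L d this] show ?thesis by (simp add: eq)
        qed (simp add: crowding_bounds)
      qed
    qed
    finally show ?thesis .
  qed
  show "\<exists>n0. \<forall>n\<ge>n0. norm (measure M (?bad n) - 0) < e"
  proof (intro exI[of _ n0] allI impI)
    fix n assume "n \<ge> n0"
    from le_less_trans[OF le n0[OF this]] show "norm (measure M (?bad n) - 0) < e" by simp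
  qed
qed

section \<open>Continuity of the uplift\<close>

text \<open>Using \<open>max z (1 / z)\<close> treats both ends of the half-line at once: the cutoff is \<open>1\<close> where this is at
  most \<open>m + 1\<close> and \<open>0\<close> where it is at least \<open>m + 2\<close>.\<close>

definition cutoff :: "nat \<Rightarrow> real \<Rightarrow> real" where
  "cutoff m z = max 0 (min 1 (real m + 2 - max z (1 / z)))"

lemma cutoff_bounds: "0 \<le> cutoff m z" "cutoff m z \<le> 1"
  by (auto simp: cutoff_def)

lemma continuous_on_cutoff: "continuous_on {0<..} (cutoff m)"
  unfolding cutoff_def by (intro continuous_intros) auto

lemma cutoff_eq_0:
  assumes "0 < z" "z \<notin> {1 / (real m + 2)..real m + 2}"
  shows "cutoff m z = 0"
proof -
  have "real m + 2 \<le> max z (1 / z)"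
  proof (cases "z \<le> real m + 2")
    case True
    then have "z < 1 / (real m + 2)" using assms(2) by auto
    then have "real m + 2 \<le> 1 / z" using assms(1) by (simp add: field_simps)
    then show ?thesis by simp
  qed simp
  then show ?thesis by (simp add: cutoff_def)
qed

lemma cutoff_eq_1:
  assumes "max z (1 / z) \<le> real m + 1"
  shows "cutoff m z = 1"
proof -
  have "1 \<le> real m + 2 - max z (1 / z)" using assms by linarith
  then show ?thesis unfolding cutoff_def by (subst min_absorb1) simp_all
qed

lemma eventually_cutoff_eq_1: "\<forall>\<^sub>F m in sequentially. cutoff m z = 1"
proof -
  obtain m0 :: nat where "max z (1 / z) \<le> real m0" using real_arch_simple by blast
  then show ?thesis
    unfolding eventually_sequentially by (intro exI[of _ m0] allI impI cutoff_eq_1) linarith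
qed

lemma eventually_cutoff_eq_1_on_compact:
  fixes K :: "(nat \<times> real) set"
  assumes K: "compact K" "K \<subseteq> UNIV \<times> {0<..}"
  shows "\<forall>\<^sub>F m in sequentially. \<forall>p\<in>K. cutoff m (snd p) = 1"
proof -
  have "continuous_on K (\<lambda>p. max (snd p) (1 / snd p))"
    using K(2) by (intro continuous_intros) auto
  from compact_imp_bounded[OF compact_continuous_image[OF this K(1)]]
  obtain B where B: "\<And>p. p \<in> K \<Longrightarrow> \<bar>max (snd p) (1 / snd p)\<bar> \<le> B"
    unfolding bounded_iff by auto
  obtain m0 :: nat where m0: "B \<le> real m0" using real_arch_simple by blast
  have "cutoff m (snd p) = 1" if "p \<in> K" "m0 \<le> m" for p m
  proof (rule cutoff_eq_1)
    have "real m0 \<le> real m" using that by simp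
    then show "max (snd p) (1 / snd p) \<le> real m + 1" using B[OF that(1)] m0 by linarith
  qed
  then show ?thesis unfolding eventually_sequentially by blast
qed

lemma exp_neg_diff_le:
  fixes s t :: real
  assumes "0 \<le> t" "t \<le> s"
  shows "\<bar>exp (- t) - exp (- s)\<bar> \<le> s - t"
proof -
  have "exp (- s) = exp (- t) * exp (- (s - t))" by (simp add: exp_add[symmetric])
  then have "exp (- t) - exp (- s) = exp (- t) * (1 - exp (- (s - t)))" by (simp add: algebra_simps)
  also have "\<dots> \<le> 1 * (s - t)"
  proof (rule mult_mono)
    show "1 - exp (- (s - t)) \<le> s - t" using exp_ge_add_one_self[of "- (s - t)"] by linarith
  qed (use assms in auto)
  finally show ?thesis using assms by simp
qed

text \<open>Inserting a cutoff that equals \<open>1\<close> on \<open>K\<close> changes the exponent by at most the sum over the points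
  outside \<open>K\<close>, and \<open>t \<mapsto> exp (- t)\<close> is a contraction on the nonnegative numbers.\<close>

lemma thinning_error:
  fixes M :: "'w measure" and Vs :: "nat \<Rightarrow> 'w \<Rightarrow> real ^ 'd"
  assumes M: "prob_space M" and f: "f \<in> C_hat punctured_space"
    and X: "\<And>k. X k \<in> M \<rightarrow>\<^sub>M count_space UNIV" and Z: "\<And>k. Z k \<in> M \<rightarrow>\<^sub>M borel_on {0<..}"
    and Vs: "\<And>k. Vs k \<in> M \<rightarrow>\<^sub>M borel_on punctured_space"
    and lf: "AE \<omega> in M. atomic_measure punctured_space (\<lambda>k. X k \<omega>) (\<lambda>k. Z k \<omega> *\<^sub>R Vs k \<omega>)
               \<in> locally_finite_measures punctured_space"
    and K: "\<forall>p\<in>K. cutoff m (snd p) = 1"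
  shows "ennreal \<bar>(\<integral>\<omega>. exp (- (\<Sum>k. real (X k \<omega>) * (cutoff m (Z k \<omega>) * f (Z k \<omega> *\<^sub>R Vs k \<omega>)))) \<partial>M)
          - (\<integral>\<omega>. exp (- (\<Sum>k. real (X k \<omega>) * f (Z k \<omega> *\<^sub>R Vs k \<omega>))) \<partial>M)\<bar>
     \<le> (\<integral>\<^sup>+\<omega>. (\<Sum>k. if (X k \<omega>, Z k \<omega>) \<notin> K
                 then of_nat (X k \<omega>) * ennreal (f (Z k \<omega> *\<^sub>R Vs k \<omega>)) else 0) \<partial>M)"
proof -
  interpret M: prob_space M by (rule M)
  let ?W = "\<lambda>k \<omega>. Z k \<omega> *\<^sub>R Vs k \<omega>"
  let ?t = "\<lambda>\<omega>. \<Sum>k. real (X k \<omega>) * (cutoff m (Z k \<omega>) * f (?W k \<omega>))"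
  let ?s = "\<lambda>\<omega>. \<Sum>k. real (X k \<omega>) * f (?W k \<omega>)"
  note W = scaled_measurable[OF Z Vs]
  have W_in: "?W k \<omega> \<in> punctured_space" if "\<omega> \<in> space M" for k \<omega>
    using measurable_space[OF W that] unfolding space_restrict_space by blast
  have f0: "0 \<le> f (?W k \<omega>)" if "\<omega> \<in> space M" for k \<omega>
    using C_hat_nonneg[OF f W_in[OF that]] .
  have [measurable]: "?s \<in> borel_measurable M" by (rule sum_measurable_atomic[OF X W f])
  have [measurable]: "(\<lambda>\<omega>. real (X k \<omega>)) \<in> borel_measurable M" for k
    using measurable_compose[OF X[of k], of real borel] by simp
  have [measurable]: "(\<lambda>\<omega>. cutoff m (Z k \<omega>)) \<in> borel_measurable M" for k
    by (rule measurable_compose[OF Z borel_measurable_continuous_on_restrict[OF continuous_on_cutoff]])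
  have [measurable]: "(\<lambda>\<omega>. f (?W k \<omega>)) \<in> borel_measurable M" for k
    by (rule measurable_compose[OF W C_hat_measurable[OF f]])
  have [measurable]: "?t \<in> borel_measurable M" by measurable
  have pointwise: "AE \<omega> in M. 0 \<le> ?t \<omega> \<and> ?t \<omega> \<le> ?s \<omega> \<and> ennreal (?s \<omega> - ?t \<omega>) \<le>
      (\<Sum>k. if (X k \<omega>, Z k \<omega>) \<notin> K then of_nat (X k \<omega>) * ennreal (f (?W k \<omega>)) else 0)"
    using lf
  proof (rule AE_mp, intro AE_I2 impI)
    fix \<omega> assume \<omega>: "\<omega> \<in> space M" and L: "atomic_measure punctured_space (\<lambda>k. X k \<omega>) (\<lambda>k. ?W k \<omega>)
               \<in> locally_finite_measures punctured_space"
    have fin: "finite {k. X k \<omega> \<noteq> 0 \<and> f (?W k \<omega>) \<noteq> 0}"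
      by (rule atomic_measure_finite_support[OF W_in[OF \<omega>] L f])
    have s: "summable (\<lambda>k. real (X k \<omega>) * f (?W k \<omega>))" by (rule summable_finite[OF fin]) auto
    have t: "summable (\<lambda>k. real (X k \<omega>) * (cutoff m (Z k \<omega>) * f (?W k \<omega>)))" by (rule summable_finite[OF fin]) auto
    let ?r = "\<lambda>k. real (X k \<omega>) * ((1 - cutoff m (Z k \<omega>)) * f (?W k \<omega>))"
    have r0: "0 \<le> ?r k" for k using cutoff_bounds(2) f0[OF \<omega>] by simp
    have r: "summable ?r" by (rule summable_finite[OF fin]) auto
    have diff: "?s \<omega> - ?t \<omega> = (\<Sum>k. ?r k)"
      unfolding suminf_diff[OF s t] by (simp add: algebra_simps)
    have "0 \<le> ?t \<omega>" using cutoff_bounds(1) f0[OF \<omega>] by (intro suminf_nonneg[OF t]) simp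
    moreover have "?t \<omega> \<le> ?s \<omega>" using suminf_nonneg[OF r r0] diff by linarith
    moreover have "ennreal (?s \<omega> - ?t \<omega>) \<le>
      (\<Sum>k. if (X k \<omega>, Z k \<omega>) \<notin> K then of_nat (X k \<omega>) * ennreal (f (?W k \<omega>)) else 0)"
      unfolding diff suminf_ennreal2[OF r0 r, symmetric]
    proof (rule suminf_le)
      fix k
      show "ennreal (?r k) \<le> (if (X k \<omega>, Z k \<omega>) \<notin> K then of_nat (X k \<omega>) * ennreal (f (?W k \<omega>)) else 0)"
      proof (cases "(X k \<omega>, Z k \<omega>) \<in> K")
        case True
        then show ?thesis using K by force
      next
        case False
        have "?r k \<le> real (X k \<omega>) * (1 * f (?W k \<omega>))"
          using cutoff_bounds(1) f0[OF \<omega>] by (intro mult_left_mono mult_right_mono) auto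
        then have "ennreal (?r k) \<le> ennreal (real (X k \<omega>) * f (?W k \<omega>))" by (intro ennreal_leI) simp
        also have "\<dots> = of_nat (X k \<omega>) * ennreal (f (?W k \<omega>))"
          using f0[OF \<omega>] by (simp add: ennreal_mult ennreal_of_nat_eq_real_of_nat)
        finally show ?thesis using False by simp
      qed
    qed simp_all
    ultimately show "0 \<le> ?t \<omega> \<and> ?t \<omega> \<le> ?s \<omega> \<and> ennreal (?s \<omega> - ?t \<omega>) \<le>
      (\<Sum>k. if (X k \<omega>, Z k \<omega>) \<notin> K then of_nat (X k \<omega>) * ennreal (f (?W k \<omega>)) else 0)" by blast
  qed
  have it: "integrable M (\<lambda>\<omega>. exp (- ?t \<omega>))"
    using pointwise by (intro M.integrable_const_bound[where B = 1]) auto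
  have is_int: "integrable M (\<lambda>\<omega>. exp (- ?s \<omega>))"
    using pointwise by (intro M.integrable_const_bound[where B = 1]) auto
  have "ennreal \<bar>(\<integral>\<omega>. exp (- ?t \<omega>) \<partial>M) - (\<integral>\<omega>. exp (- ?s \<omega>) \<partial>M)\<bar>
      \<le> (\<integral>\<^sup>+\<omega>. ennreal \<bar>exp (- ?t \<omega>) - exp (- ?s \<omega>)\<bar> \<partial>M)"
    using integral_norm_bound_ennreal[OF Bochner_Integration.integrable_diff[OF it is_int]]
    unfolding Bochner_Integration.integral_diff[OF it is_int] real_norm_def .
  also have "\<dots> \<le> (\<integral>\<^sup>+\<omega>. (\<Sum>k. if (X k \<omega>, Z k \<omega>) \<notin> K
                 then of_nat (X k \<omega>) * ennreal (f (?W k \<omega>)) else 0) \<partial>M)"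
  proof (rule nn_integral_mono_AE, use pointwise in eventually_elim)
    case (elim \<omega>)
    then have "ennreal \<bar>exp (- ?t \<omega>) - exp (- ?s \<omega>)\<bar> \<le> ennreal (?s \<omega> - ?t \<omega>)"
      by (intro ennreal_leI exp_neg_diff_le) auto
    with elim show ?case by (meson order_trans)
  qed
  finally show ?thesis .
qed

text \<open>Almost surely only finitely many points contribute, and for each of them the cutoff is eventually
  \<open>1\<close>.\<close>

lemma cutoff_laplace_tendsto:
  fixes M :: "'w measure" and Vs :: "nat \<Rightarrow> 'w \<Rightarrow> real ^ 'd"
  assumes M: "prob_space M" and f: "f \<in> C_hat punctured_space"
    and X: "\<And>k. X k \<in> M \<rightarrow>\<^sub>M count_space UNIV" and Z: "\<And>k. Z k \<in> M \<rightarrow>\<^sub>M borel_on {0<..}"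
    and Vs: "\<And>k. Vs k \<in> M \<rightarrow>\<^sub>M borel_on punctured_space"
    and lf: "AE \<omega> in M. atomic_measure punctured_space (\<lambda>k. X k \<omega>) (\<lambda>k. Z k \<omega> *\<^sub>R Vs k \<omega>)
               \<in> locally_finite_measures punctured_space"
  shows "(\<lambda>m. \<integral>\<omega>. exp (- (\<Sum>k. real (X k \<omega>) * (cutoff m (Z k \<omega>) * f (Z k \<omega> *\<^sub>R Vs k \<omega>)))) \<partial>M)
     \<longlonglongrightarrow> (\<integral>\<omega>. exp (- (\<Sum>k. real (X k \<omega>) * f (Z k \<omega> *\<^sub>R Vs k \<omega>))) \<partial>M)"
proof (rule integral_dominated_convergence[where w = "\<lambda>_. 1"])
  let ?W = "\<lambda>k \<omega>. Z k \<omega> *\<^sub>R Vs k \<omega>"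
  interpret M: prob_space M by (rule M)
  note W = scaled_measurable[OF Z Vs]
  have W_in: "?W k \<omega> \<in> punctured_space" if "\<omega> \<in> space M" for k \<omega>
    using measurable_space[OF W that] unfolding space_restrict_space by blast
  have f0: "0 \<le> f (?W k \<omega>)" if "\<omega> \<in> space M" for k \<omega>
    using C_hat_nonneg[OF f W_in[OF that]] .
  have [measurable]: "(\<lambda>\<omega>. real (X k \<omega>)) \<in> borel_measurable M" for k
    using measurable_compose[OF X[of k], of real borel] by simp
  have [measurable]: "(\<lambda>\<omega>. cutoff m (Z k \<omega>)) \<in> borel_measurable M" for k m
    by (rule measurable_compose[OF Z borel_measurable_continuous_on_restrict[OF continuous_on_cutoff]])
  have [measurable]: "(\<lambda>\<omega>. f (?W k \<omega>)) \<in> borel_measurable M" for k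
    by (rule measurable_compose[OF W C_hat_measurable[OF f]])
  show "(\<lambda>\<omega>. exp (- (\<Sum>k. real (X k \<omega>) * f (?W k \<omega>)))) \<in> borel_measurable M" by measurable
  show "(\<lambda>\<omega>. exp (- (\<Sum>k. real (X k \<omega>) * (cutoff m (Z k \<omega>) * f (?W k \<omega>))))) \<in> borel_measurable M" for m
    by measurable
  have fin: "AE \<omega> in M. finite {k. X k \<omega> \<noteq> 0 \<and> f (?W k \<omega>) \<noteq> 0}"
    using lf
  proof (rule AE_mp, intro AE_I2 impI)
    fix \<omega> assume \<omega>: "\<omega> \<in> space M" and L: "atomic_measure punctured_space (\<lambda>k. X k \<omega>) (\<lambda>k. ?W k \<omega>)
               \<in> locally_finite_measures punctured_space"
    show "finite {k. X k \<omega> \<noteq> 0 \<and> f (?W k \<omega>) \<noteq> 0}"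
      by (rule atomic_measure_finite_support[OF W_in[OF \<omega>] L f])
  qed
  show "AE \<omega> in M. norm (exp (- (\<Sum>k. real (X k \<omega>) * (cutoff m (Z k \<omega>) * f (?W k \<omega>))))) \<le> 1" for m
    using fin
  proof (rule AE_mp, intro AE_I2 impI)
    fix \<omega> assume \<omega>: "\<omega> \<in> space M" and F: "finite {k. X k \<omega> \<noteq> 0 \<and> f (?W k \<omega>) \<noteq> 0}"
    have "summable (\<lambda>k. real (X k \<omega>) * (cutoff m (Z k \<omega>) * f (?W k \<omega>)))" by (rule summable_finite[OF F]) auto
    then have "0 \<le> (\<Sum>k. real (X k \<omega>) * (cutoff m (Z k \<omega>) * f (?W k \<omega>)))"
      using cutoff_bounds(1) f0[OF \<omega>] by (intro suminf_nonneg) auto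
    then show "norm (exp (- (\<Sum>k. real (X k \<omega>) * (cutoff m (Z k \<omega>) * f (?W k \<omega>))))) \<le> 1" by simp
  qed
  show "AE \<omega> in M. (\<lambda>m. exp (- (\<Sum>k. real (X k \<omega>) * (cutoff m (Z k \<omega>) * f (?W k \<omega>)))))
      \<longlonglongrightarrow> exp (- (\<Sum>k. real (X k \<omega>) * f (?W k \<omega>)))"
    using fin
  proof eventually_elim
    case (elim \<omega>)
    let ?F = "{k. X k \<omega> \<noteq> 0 \<and> f (?W k \<omega>) \<noteq> 0}"
    have "\<forall>\<^sub>F m in sequentially. \<forall>k\<in>?F. cutoff m (Z k \<omega>) = 1"
      using elim eventually_cutoff_eq_1 by (intro eventually_ball_finite) auto
    then have "\<forall>\<^sub>F m in sequentially. exp (- (\<Sum>k. real (X k \<omega>) * (cutoff m (Z k \<omega>) * f (?W k \<omega>))))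
        = exp (- (\<Sum>k. real (X k \<omega>) * f (?W k \<omega>)))"
    proof eventually_elim
      case (elim m)
      have "real (X k \<omega>) * (cutoff m (Z k \<omega>) * f (?W k \<omega>)) = real (X k \<omega>) * f (?W k \<omega>)" for k
        using elim by (cases "k \<in> ?F") auto
      then show ?case by (simp only:)
    qed
    then show ?case by (rule tendsto_eventually)
  qed
  show "integrable M (\<lambda>_. 1 :: real)" by simp
qed

lemma expectation_atomic_laplace:
  fixes M :: "'w measure" and S :: "'a::t2_space set"
  assumes X: "\<And>k. X k \<in> M \<rightarrow>\<^sub>M count_space UNIV" and W: "\<And>k. W k \<in> M \<rightarrow>\<^sub>M borel_on S"
    and lf: "AE \<omega> in M. atomic_measure S (\<lambda>k. X k \<omega>) (\<lambda>k. W k \<omega>) \<in> locally_finite_measures S"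
    and f: "f \<in> C_hat S"
    and meas: "(\<lambda>\<omega>. \<integral>x. f x \<partial>random_atomic_measure S X W \<omega>) \<in> borel_measurable M"
  shows "(\<integral>\<omega>. exp (- (\<integral>x. f x \<partial>random_atomic_measure S X W \<omega>)) \<partial>M)
       = (\<integral>\<omega>. exp (- (\<Sum>k. real (X k \<omega>) * f (W k \<omega>))) \<partial>M)"
proof (rule integral_cong_AE)
  note [measurable] = meas sum_measurable_atomic[OF X W f]
  show "(\<lambda>\<omega>. exp (- (\<integral>x. f x \<partial>random_atomic_measure S X W \<omega>))) \<in> borel_measurable M" by measurable
  show "(\<lambda>\<omega>. exp (- (\<Sum>k. real (X k \<omega>) * f (W k \<omega>)))) \<in> borel_measurable M" by measurable
  show "AE \<omega> in M. exp (- (\<integral>x. f x \<partial>random_atomic_measure S X W \<omega>)) = exp (- (\<Sum>k. real (X k \<omega>) * f (W k \<omega>)))"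
    using lf
  proof (rule AE_mp, intro AE_I2 impI)
    fix \<omega> assume \<omega>: "\<omega> \<in> space M" and L: "atomic_measure S (\<lambda>k. X k \<omega>) (\<lambda>k. W k \<omega>) \<in> locally_finite_measures S"
    have W_in: "W k \<omega> \<in> S" for k
      using measurable_space[OF W \<omega>] unfolding space_restrict_space by blast
    have "random_atomic_measure S X W \<omega> = atomic_measure S (\<lambda>k. X k \<omega>) (\<lambda>k. W k \<omega>)"
      using L by (simp add: random_atomic_measure_def)
    then show "exp (- (\<integral>x. f x \<partial>random_atomic_measure S X W \<omega>)) = exp (- (\<Sum>k. real (X k \<omega>) * f (W k \<omega>)))"
      by (simp only: integral_atomic_measure[of "\<lambda>k. W k \<omega>", OF W_in L f])
  qed
qed

text \<open>The usual interchange of limits. The approximation has to be uniform in \<open>n\<close> only up to finitely many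
  \<open>n\<close>, which is what a bound on a limit superior provides.\<close>

lemma tendsto_from_approximations:
  fixes A :: "nat \<Rightarrow> real" and B :: "nat \<Rightarrow> nat \<Rightarrow> real"
  assumes approx: "\<And>e. 0 < e \<Longrightarrow> \<forall>\<^sub>F m in sequentially. \<forall>\<^sub>F n in sequentially. \<bar>B m n - A n\<bar> < e"
    and inner: "\<And>m. B m \<longlonglongrightarrow> B' m" and outer: "B' \<longlonglongrightarrow> A'"
  shows "A \<longlonglongrightarrow> A'"
proof (rule tendstoI)
  fix e :: real assume "0 < e"
  then have e: "0 < e / 3" by simp
  have "\<forall>\<^sub>F m in sequentially. (\<forall>\<^sub>F n in sequentially. \<bar>B m n - A n\<bar> < e / 3) \<and> dist (B' m) A' < e / 3"
    using approx[OF e] tendstoD[OF outer e] by (rule eventually_conj)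
  then obtain m where m: "\<forall>\<^sub>F n in sequentially. \<bar>B m n - A n\<bar> < e / 3" "dist (B' m) A' < e / 3"
    using eventually_happens'[OF sequentially_bot] by blast
  from m(1) tendstoD[OF inner e, of m] show "\<forall>\<^sub>F n in sequentially. dist (A n) A' < e"
  proof eventually_elim
    case (elim n)
    then show ?case using m(2) unfolding dist_real_def by linarith
  qed
qed

theorem theorem4p2:
  fixes M :: "'w measure" and X :: "nat \<Rightarrow> 'w \<Rightarrow> nat" and Z :: "nat \<Rightarrow> nat \<Rightarrow> 'w \<Rightarrow> real"
    and M' :: "'u measure" and X' :: "nat \<Rightarrow> 'u \<Rightarrow> nat" and Z' :: "nat \<Rightarrow> 'u \<Rightarrow> real"
    and N :: "'v measure" and V :: "'v \<Rightarrow> real ^ 'd"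
    and Vs :: "nat \<Rightarrow> 'w \<Rightarrow> real ^ 'd" and Vs' :: "nat \<Rightarrow> 'u \<Rightarrow> real ^ 'd"
  assumes prob_M: "prob_space M" and prob_M': "prob_space M'" and prob_N: "prob_space N"
    and pp_\<xi>n: "\<And>n. represents_point_process {0<..} M X (Z n)"
    and intensity_\<xi>n: "\<And>n. finite_intensity {0<..} M (random_atomic_measure {0<..} X (Z n))"
    and pp_\<xi>: "represents_point_process {0<..} M' X' Z'"
    and intensity_\<xi>: "finite_intensity {0<..} M' (random_atomic_measure {0<..} X' Z')"
    and simple_\<xi>: "simple_point_process {0<..} M' (random_atomic_measure {0<..} X' Z')"
    and conv: "converges_in_distribution (vague_topology {0<..})
                 M (\<lambda>n. random_atomic_measure {0<..} X (Z n))
                 M' (random_atomic_measure {0<..} X' Z')"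
    and V: "V \<in> N \<rightarrow>\<^sub>M borel_on punctured_space"
    and copies_\<xi>n: "\<And>n. independent_iid_copies N V M Vs X (Z n)"
    and copies_\<xi>: "independent_iid_copies N V M' Vs' X' Z'"
    and moments_\<xi>n: "\<And>n. finite_uplift_moments M X (Z n) Vs"
    and moments_\<xi>: "finite_uplift_moments M' X' Z' Vs'"
    and tail: "\<And>f \<epsilon>. f \<in> C_hat punctured_space \<Longrightarrow> 0 < \<epsilon> \<Longrightarrow>
           \<exists>K :: (nat \<times> real) set. compact K \<and> K \<subseteq> UNIV \<times> {0<..} \<and>
             limsup (\<lambda>n. \<integral>\<^sup>+\<omega>. (\<Sum>k. if (X k \<omega>, Z n k \<omega>) \<notin> K
                 then of_nat (X k \<omega>) * ennreal (f (Z n k \<omega> *\<^sub>R Vs k \<omega>)) else 0) \<partial>M)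
               \<le> ennreal \<epsilon>"
  shows "converges_in_distribution (vague_topology punctured_space)
           M (\<lambda>n. uplift X (Z n) Vs) M' (uplift X' Z' Vs')"
proof (rule converges_in_distribution_from_laplace)
  interpret M: prob_space M by (rule prob_M)
  interpret M': prob_space M' by (rule prob_M')
  have X: "\<And>k. X k \<in> M \<rightarrow>\<^sub>M count_space UNIV" and Z: "\<And>n k. Z n k \<in> M \<rightarrow>\<^sub>M borel_on {0<..}"
    using pp_\<xi>n by (auto simp: represents_point_process_def)
  have X': "\<And>k. X' k \<in> M' \<rightarrow>\<^sub>M count_space UNIV" and Z': "\<And>k. Z' k \<in> M' \<rightarrow>\<^sub>M borel_on {0<..}"
    using pp_\<xi> by (auto simp: represents_point_process_def)
  have Vs: "\<And>k. Vs k \<in> M \<rightarrow>\<^sub>M borel_on punctured_space" and Vs': "\<And>k. Vs' k \<in> M' \<rightarrow>\<^sub>M borel_on punctured_space"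
    using copies_\<xi>n copies_\<xi> by (auto simp: independent_iid_copies_def)
  note lf = AE_uplift_atomic_locally_finite[OF X Z Vs moments_\<xi>n]
  note lf' = AE_uplift_atomic_locally_finite[OF X' Z' Vs' moments_\<xi>]
  show "open (punctured_space :: (real ^ 'd) set)" by (simp add: open_Diff)
  show rm: "random_lf_measure M punctured_space (uplift X (Z n) Vs)" for n
    unfolding uplift_def by (rule random_lf_measure_atomic[OF prob_M X scaled_measurable[OF Z Vs]])
  show rm': "random_lf_measure M' punctured_space (uplift X' Z' Vs')"
    unfolding uplift_def by (rule random_lf_measure_atomic[OF prob_M' X' scaled_measurable[OF Z' Vs']])
  fix f :: "real ^ 'd \<Rightarrow> real" assume f: "f \<in> C_hat punctured_space"
  \<comment> \<open>\<open>A\<close> is the Laplace functional of the uplift, \<open>B m\<close> the one with \<open>m\<close>-th cutoff. The error between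
    them vanishes as \<open>m \<rightarrow> \<infinity>\<close>, uniformly in large \<open>n\<close>, by the tail hypothesis.\<close>
  define A where "A n = (\<integral>\<omega>. exp (- (\<Sum>k. real (X k \<omega>) * f (Z n k \<omega> *\<^sub>R Vs k \<omega>))) \<partial>M)" for n
  define A' where "A' = (\<integral>\<omega>. exp (- (\<Sum>k. real (X' k \<omega>) * f (Z' k \<omega> *\<^sub>R Vs' k \<omega>))) \<partial>M')"
  define B where "B m n = (\<integral>\<omega>. exp (- (\<Sum>k. real (X k \<omega>) * (cutoff m (Z n k \<omega>) * f (Z n k \<omega> *\<^sub>R Vs k \<omega>)))) \<partial>M)" for m n
  define B' where "B' m = (\<integral>\<omega>. exp (- (\<Sum>k. real (X' k \<omega>) * (cutoff m (Z' k \<omega>) * f (Z' k \<omega> *\<^sub>R Vs' k \<omega>)))) \<partial>M')" for m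
  have "A \<longlonglongrightarrow> A'"
  proof (rule tendsto_from_approximations[where B = B and B' = B'])
    show "B' \<longlonglongrightarrow> A'"
      unfolding B'_def A'_def by (rule cutoff_laplace_tendsto[OF prob_M' f X' Z' Vs' lf'])
    show "\<forall>\<^sub>F m in sequentially. \<forall>\<^sub>F n in sequentially. \<bar>B m n - A n\<bar> < e" if e: "0 < e" for e
    proof -
      obtain K :: "(nat \<times> real) set" where K: "compact K" "K \<subseteq> UNIV \<times> {0<..}"
        and lim: "limsup (\<lambda>n. \<integral>\<^sup>+\<omega>. (\<Sum>k. if (X k \<omega>, Z n k \<omega>) \<notin> K
                 then of_nat (X k \<omega>) * ennreal (f (Z n k \<omega> *\<^sub>R Vs k \<omega>)) else 0) \<partial>M) \<le> ennreal (e / 2)"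
        using tail[OF f, of "e / 2"] e by auto
      have "ennreal (e / 2) < ennreal e" using e by (simp add: ennreal_less_iff)
      note small = Limsup_lessD[OF le_less_trans[OF lim this]]
      from eventually_cutoff_eq_1_on_compact[OF K] show ?thesis
      proof eventually_elim
        case (elim m)
        from small show ?case
        proof eventually_elim
          case (elim n)
          from le_less_trans[OF thinning_error[OF prob_M f X Z Vs lf \<open>\<forall>p\<in>K. cutoff m (snd p) = 1\<close>] this]
          show ?case unfolding A_def B_def by (simp add: ennreal_less_iff)
        qed
      qed
    qed
    show "B m \<longlonglongrightarrow> B' m" for m
    proof -
      let ?a = "1 / (real m + 2)" and ?b = "real m + 2"
      define g where "g = mark_exponent N V (cutoff m) f"
      have a: "0 < ?a" and ab: "?a \<le> ?b" by (simp_all add: field_simps add_increasing)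
      note context_facts = prob_N V f continuous_on_cutoff cutoff_bounds a cutoff_eq_0
      have g: "g \<in> C_hat {0<..}"
        unfolding g_def by (rule mark_exponent_in_C_hat[OF context_facts])
      \<comment> \<open>\<open>C\<close> is the Laplace functional of the original processes at the test function \<open>g\<close>.\<close>
      define C where "C n = (\<integral>\<omega>. exp (- (\<Sum>k. real (X k \<omega>) * g (Z n k \<omega>))) \<partial>M)" for n
      define C' where "C' = (\<integral>\<omega>. exp (- (\<Sum>k. real (X' k \<omega>) * g (Z' k \<omega>))) \<partial>M')"
      let ?bad = "\<lambda>n. measure M {\<omega>\<in>space M. \<exists>k. 2 \<le> X k \<omega> \<and> Z n k \<omega> \<in> {?a..?b}}"
      have le: "\<bar>B m n - C n\<bar> \<le> ?bad n" for n
        unfolding B_def C_def g_def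
        by (rule thinned_laplace_estimate[OF context_facts prob_M pp_\<xi>n copies_\<xi>n])
      have "?bad \<longlonglongrightarrow> 0"
        by (rule multiple_points_vanish[OF prob_M prob_M' pp_\<xi>n pp_\<xi> simple_\<xi> conv a ab])
      then have BC: "(\<lambda>n. B m n - C n) \<longlonglongrightarrow> 0"
        by (rule Lim_null_comparison[rotated]) (use le in simp)
      have cont: "continuous_map (vague_topology {0<..}) euclideanreal (\<lambda>\<mu>. \<integral>z. g z \<partial>\<mu>)"
        by (rule continuous_map_vague_integral[OF g])
      note int_meas = borel_measurable_continuous_map[OF cont]
      have meas: "(\<lambda>\<omega>. \<integral>z. g z \<partial>random_atomic_measure {0<..} X (Z n) \<omega>) \<in> borel_measurable M" for n
        using conv unfolding converges_in_distribution_def by (intro measurable_compose[OF _ int_meas]) blast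
      have meas': "(\<lambda>\<omega>. \<integral>z. g z \<partial>random_atomic_measure {0<..} X' Z' \<omega>) \<in> borel_measurable M'"
        using conv unfolding converges_in_distribution_def by (intro measurable_compose[OF _ int_meas]) blast
      have exp_cont: "continuous_map (vague_topology {0<..}) euclideanreal (\<lambda>\<mu>. exp (- (\<integral>z. g z \<partial>\<mu>)))"
        using continuous_map_compose[OF cont, of euclideanreal "\<lambda>t. exp (- t)"]
        by (simp add: comp_def continuous_intros)
      have "bounded ((\<lambda>\<mu>. exp (- (\<integral>z. g z \<partial>\<mu>))) ` topspace (vague_topology {0<..}))"
        using integral_C_hat_nonneg[OF _ g] by (auto simp: bounded_iff topspace_vague_topology intro!: exI[of _ 1])
      with conv exp_cont have "(\<lambda>n. \<integral>\<omega>. exp (- (\<integral>z. g z \<partial>random_atomic_measure {0<..} X (Z n) \<omega>)) \<partial>M)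
          \<longlonglongrightarrow> (\<integral>\<omega>. exp (- (\<integral>z. g z \<partial>random_atomic_measure {0<..} X' Z' \<omega>)) \<partial>M')"
        unfolding converges_in_distribution_def by blast
      moreover have "(\<integral>\<omega>. exp (- (\<integral>z. g z \<partial>random_atomic_measure {0<..} X (Z n) \<omega>)) \<partial>M) = C n" for n
        unfolding C_def using pp_\<xi>n
        by (intro expectation_atomic_laplace[OF X Z _ g meas]) (simp add: represents_point_process_def)
      moreover have "(\<integral>\<omega>. exp (- (\<integral>z. g z \<partial>random_atomic_measure {0<..} X' Z' \<omega>)) \<partial>M') = C'"
        unfolding C'_def using pp_\<xi>
        by (intro expectation_atomic_laplace[OF X' Z' _ g meas']) (simp add: represents_point_process_def)
      ultimately have "C \<longlonglongrightarrow> C'" by simp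
      from tendsto_add[OF BC this] have "B m \<longlonglongrightarrow> C'" by simp
      moreover have "B' m = C'"
      proof -
        have ae: "AE \<omega> in M'. \<not> (\<exists>k. 2 \<le> X' k \<omega> \<and> Z' k \<omega> \<in> {?a..?b})"
          using AE_simple_multiplicity[OF pp_\<xi> simple_\<xi>]
        proof eventually_elim
          case (elim \<omega>)
          have "\<not> 2 \<le> X' k \<omega>" for k using spec[OF elim, of k] by linarith
          then show ?case by blast
        qed
        have "measure M' {\<omega>\<in>space M'. \<exists>k. 2 \<le> X' k \<omega> \<and> Z' k \<omega> \<in> {?a..?b}} = measure M' {}"
        proof (rule M'.finite_measure_eq_AE)
          show "AE \<omega> in M'. \<omega> \<in> {\<omega>\<in>space M'. \<exists>k. 2 \<le> X' k \<omega> \<and> Z' k \<omega> \<in> {?a..?b}} \<longleftrightarrow> \<omega> \<in> {}"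
            using ae by eventually_elim blast
          have [measurable]: "X' k \<in> M' \<rightarrow>\<^sub>M count_space UNIV" "Z' k \<in> borel_measurable M'" for k
            using X' Z' by (auto dest: measurable_restrict_space2_iff[THEN iffD1])
          show "{\<omega>\<in>space M'. \<exists>k. 2 \<le> X' k \<omega> \<and> Z' k \<omega> \<in> {?a..?b}} \<in> sets M'" by measurable
        qed simp
        moreover have "\<bar>B' m - C'\<bar> \<le> measure M' {\<omega>\<in>space M'. \<exists>k. 2 \<le> X' k \<omega> \<and> Z' k \<omega> \<in> {?a..?b}}"
          unfolding B'_def C'_def g_def
          by (rule thinned_laplace_estimate[OF context_facts prob_M' pp_\<xi> copies_\<xi>])
        ultimately have "\<bar>B' m - C'\<bar> \<le> 0" by simp
        then show ?thesis by simp
      qed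
      ultimately show ?thesis by simp
    qed
  qed
  moreover have "(\<integral>\<omega>. exp (- (\<integral>x. f x \<partial>uplift X (Z n) Vs \<omega>)) \<partial>M) = A n" for n
    using random_lf_measure.integral_measurable[OF rm f]
    unfolding uplift_def A_def by (rule expectation_atomic_laplace[OF X scaled_measurable[OF Z Vs] lf f])
  moreover have "(\<integral>\<omega>. exp (- (\<integral>x. f x \<partial>uplift X' Z' Vs' \<omega>)) \<partial>M') = A'"
    using random_lf_measure.integral_measurable[OF rm' f]
    unfolding uplift_def A'_def by (rule expectation_atomic_laplace[OF X' scaled_measurable[OF Z' Vs'] lf' f])
  ultimately show "(\<lambda>n. \<integral>\<omega>. exp (- (\<integral>x. f x \<partial>uplift X (Z n) Vs \<omega>)) \<partial>M)
      \<longlonglongrightarrow> (\<integral>\<omega>. exp (- (\<integral>x. f x \<partial>uplift X' Z' Vs' \<omega>)) \<partial>M')" by simp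
qed

end
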